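(* Let $\mathfrak{g}$ be a finite dimensional Lie algebra of vector fields on (some open subset of) $\mathbb{C}^2$ such that $\mathfrak{g}$ is solvable and not nilpotent, $\mathfrak{g}$ has rank $2$, and its commutator algebra $\mathfrak{g}'=[\mathfrak{g},\mathfrak{g}]$ is abelian and of rank $1$. Then, in suitable local coordinates $(x,y)$, there are a finite set $S\subset\mathbb{C}$ and positive integers $n_\lambda$ ($\lambda\in S$) such that, with $\mathfrak{h}=\sum_{\lambda\in S}V(\lambda)$, where $V(\lambda)$ consists of all vector fields $e^{\lambda y}P(y)\partial_x$ with $P$ a polynomial of degree $<n_\lambda$, the algebra $\mathfrak{g}$ has one of the following forms: 1. $\mathfrak{g}=\langle \mathfrak{h},\, \partial_y\rangle$, if zero is not an eigenvalue of $\partial_y$ operating on $\mathfrak{h}$. 2. $\mathfrak{g}=\langle \mathfrak{h},\, \partial_y,\, x\partial_x\rangle$. 3. $\mathfrak{g}=\langle \mathfrak{h},\, \partial_y,\, y^N\partial_x\rangle$, where $N$ is the multiplicity of the zero eigenvalue of $\partial_y$ operating on $\mathfrak{h}$. 4. $\mathfrak{g}=\langle \mathfrak{h},\, x\partial_x+\partial_y\rangle$, if zero is not an eigenvalue of $x\partial_x+\partial_y$ operating on $\mathfrak{h}$. 5. $\mathfrak{g}=\langle \mathfrak{h},\, x\partial_x+\partial_y,\, y^Ne^y\partial_x\rangle$, where $N\geq 0$ is the multiplicity of the zero eigenvalue of $x\partial_x+\partial_y$ operating on $\mathfrak{h}$. 6. $\mathfrak{g}=\langle \mathfrak{h},\,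 x\partial_x+\partial_y,\, x\partial_x+y^Ne^y\partial_x\rangle$, where $N>0$ is the multiplicity of the zero eigenvalue of $x\partial_x+\partial_y$ operating on $\mathfrak{h}$. In each of the six cases 1–6, $\mathfrak{h}=\mathfrak{g}'$.
   Context: All vector fields are $C^\infty$, and a Lie algebra of vector fields on $\mathbb{C}^2$ means a Lie algebra (under the Lie bracket) of vector fields $P(x,y)\partial_x+Q(x,y)\partial_y$ defined on some open subset of $\mathbb{C}^2$. The rank of a Lie algebra of vector fields is the dimension of its generic orbit (equivalently, the dimension of the span of its vector fields at a generic point). Here $\partial_x=\frac{\partial}{\partial x}$, $\partial_y=\frac{\partial}{\partial y}$, and $\langle\,\cdot\,\rangle$ denotes $\mathbb{C}$-linear span. A vector field $X$ operates on $\mathfrak{h}$ by the adjoint action $Y\mapsto [X,Y]$; "eigenvalue" refers to this action, and "multiplicity" means algebraic multiplicity (the dimension of the generalized eigenspace, zero if not an eigenvalue). "In suitable coordinates" means up to a locally defined $C^\infty$ change of variables (point transformation), possibly after shrinking the open set. *)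

theory Defs
  imports
    "HOL-Analysis.Analysis"
    "HOL-Computational_Algebra.Polynomial"
    "HOL-Library.Function_Algebras"
begin

type_synonym C2 = "complex \<times> complex"

(* The vector field P d/dx + Q d/dy is the map p \<mapsto> (P p, Q p). *)
type_synonym vfield = "C2 \<Rightarrow> C2"


definition pt_scale :: "complex \<Rightarrow> C2 \<Rightarrow> C2"
  where "pt_scale c v = (c * fst v, c * snd v)"

definition vf_scale :: "complex \<Rightarrow> vfield \<Rightarrow> vfield"
  where "vf_scale c X = (\<lambda>p. pt_scale c (X p))"

global_interpretation C2: vector_space pt_scale
  by unfold_locales (auto simp: pt_scale_def algebra_simps)

(* Addition and zero of vector fields are the pointwise ones of Function_Algebras. *)
global_interpretation VF: vector_space vf_scale
  by unfold_locales (auto simp: vf_scale_def pt_scale_def fun_eq_iff algebra_simps)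


definition pdx :: "(C2 \<Rightarrow> complex) \<Rightarrow> C2 \<Rightarrow> complex"
  where "pdx f p = deriv (\<lambda>t. f (t, snd p)) (fst p)"

definition pdy :: "(C2 \<Rightarrow> complex) \<Rightarrow> C2 \<Rightarrow> complex"
  where "pdy f p = deriv (\<lambda>t. f (fst p, t)) (snd p)"

(* C^k in the complex sense (partial derivatives with respect to the complex variables),
   meant for open U. *)
primrec Ck_on :: "nat \<Rightarrow> C2 set \<Rightarrow> (C2 \<Rightarrow> complex) \<Rightarrow> bool" where
  "Ck_on 0 U f \<longleftrightarrow> continuous_on U f"
| "Ck_on (Suc k) U f \<longleftrightarrow>
     (\<forall>p\<in>U. (\<lambda>t. f (t, snd p)) field_differentiable at (fst p) \<and>
            (\<lambda>t. f (fst p, t)) field_differentiable at (snd p)) \<and>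
     Ck_on k U (pdx f) \<and> Ck_on k U (pdy f)"

definition smooth_on :: "C2 set \<Rightarrow> (C2 \<Rightarrow> complex) \<Rightarrow> bool"
  where "smooth_on U f \<longleftrightarrow> (\<forall>k. Ck_on k U f)"

definition smooth_map_on :: "C2 set \<Rightarrow> (C2 \<Rightarrow> C2) \<Rightarrow> bool"
  where "smooth_map_on U F \<longleftrightarrow> smooth_on U (\<lambda>p. fst (F p)) \<and> smooth_on U (\<lambda>p. snd (F p))"


(* A vector field on U is represented by its extension by zero outside U, so that equality of
   vector fields on U is equality of functions. *)
definition vector_field_on :: "C2 set \<Rightarrow> vfield \<Rightarrow> bool"
  where "vector_field_on U X \<longleftrightarrow> smooth_map_on U X \<and> (\<forall>p. p \<notin> U \<longrightarrow> X p = 0)"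

definition vf_restrict :: "C2 set \<Rightarrow> vfield \<Rightarrow> vfield"
  where "vf_restrict U X = (\<lambda>p. if p \<in> U then X p else 0)"

definition vf_apply :: "vfield \<Rightarrow> (C2 \<Rightarrow> complex) \<Rightarrow> C2 \<Rightarrow> complex"
  where "vf_apply X f p = fst (X p) * pdx f p + snd (X p) * pdy f p"

(* For vector fields on U extended by zero, the bracket is again zero outside U. *)
definition lie_bracket :: "vfield \<Rightarrow> vfield \<Rightarrow> vfield"
  where "lie_bracket X Y = (\<lambda>p.
     (vf_apply X (\<lambda>q. fst (Y q)) p - vf_apply Y (\<lambda>q. fst (X q)) p,
      vf_apply X (\<lambda>q. snd (Y q)) p - vf_apply Y (\<lambda>q. snd (X q)) p))"


definition lie_algebra_on :: "C2 set \<Rightarrow> vfield set \<Rightarrow> bool"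
  where "lie_algebra_on U g \<longleftrightarrow>
     (\<forall>X\<in>g. vector_field_on U X) \<and> VF.subspace g \<and>
     (\<forall>X\<in>g. \<forall>Y\<in>g. lie_bracket X Y \<in> g)"

definition finite_dim :: "vfield set \<Rightarrow> bool"
  where "finite_dim g \<longleftrightarrow> (\<exists>B. finite B \<and> g = VF.span B)"

definition commutator :: "vfield set \<Rightarrow> vfield set \<Rightarrow> vfield set"
  where "commutator a b = VF.span {lie_bracket X Y | X Y. X \<in> a \<and> Y \<in> b}"

abbreviation derived :: "vfield set \<Rightarrow> vfield set"
  where "derived g \<equiv> commutator g g"

primrec derived_series :: "vfield set \<Rightarrow> nat \<Rightarrow> vfield set" where
  "derived_series g 0 = g"
| "derived_series g (Suc k) = derived (derived_series g k)"

primrec lower_central_series :: "vfield set \<Rightarrow> nat \<Rightarrow> vfield set" where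
  "lower_central_series g 0 = g"
| "lower_central_series g (Suc k) = commutator g (lower_central_series g k)"

definition solvable :: "vfield set \<Rightarrow> bool"
  where "solvable g \<longleftrightarrow> (\<exists>k. derived_series g k = {0})"

definition nilpotent :: "vfield set \<Rightarrow> bool"
  where "nilpotent g \<longleftrightarrow> (\<exists>k. lower_central_series g k = {0})"

definition abelian :: "vfield set \<Rightarrow> bool"
  where "abelian g \<longleftrightarrow> (\<forall>X\<in>g. \<forall>Y\<in>g. lie_bracket X Y = 0)"

(* "Generic" means on an open dense subset of U. *)
definition has_rank :: "C2 set \<Rightarrow> vfield set \<Rightarrow> nat \<Rightarrow> bool"
  where "has_rank U g r \<longleftrightarrow>
     (\<exists>D. open D \<and> D \<subseteq> U \<and> U \<subseteq> closure D \<and> (\<forall>p\<in>D. C2.dim ((\<lambda>X. X p) ` g) = r))"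


definition local_coordinates :: "C2 set \<Rightarrow> (C2 \<Rightarrow> C2) \<Rightarrow> bool"
  where "local_coordinates W \<phi> \<longleftrightarrow>
     open W \<and> W \<noteq> {} \<and> inj_on \<phi> W \<and> open (\<phi> ` W) \<and>
     smooth_map_on W \<phi> \<and> smooth_map_on (\<phi> ` W) (the_inv_into W \<phi>)"

(* The restriction of X to W, expressed in the coordinates \<phi>: a vector field on \<phi> ` W. *)
definition in_coordinates :: "C2 set \<Rightarrow> (C2 \<Rightarrow> C2) \<Rightarrow> vfield \<Rightarrow> vfield"
  where "in_coordinates W \<phi> X = vf_restrict (\<phi> ` W) (\<lambda>q.
     let p = the_inv_into W \<phi> q
     in (vf_apply X (\<lambda>r. fst (\<phi> r)) p, vf_apply X (\<lambda>r. snd (\<phi> r)) p))"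


definition is_eigenvalue :: "vfield \<Rightarrow> vfield set \<Rightarrow> complex \<Rightarrow> bool"
  where "is_eigenvalue X h \<mu> \<longleftrightarrow> (\<exists>Y\<in>h. Y \<noteq> 0 \<and> lie_bracket X Y = vf_scale \<mu> Y)"

definition eigenvalue_mult :: "vfield \<Rightarrow> vfield set \<Rightarrow> complex \<Rightarrow> nat"
  where "eigenvalue_mult X h \<mu> =
     VF.dim {Y \<in> h. \<exists>k. ((\<lambda>Z. lie_bracket X Z - vf_scale \<mu> Z) ^^ k) Y = 0}"


definition x_dx :: vfield where "x_dx = (\<lambda>(x, y). (x, 0))"

definition d_y :: vfield where "d_y = (\<lambda>(x, y). (0, 1))"

(* f(y) d/dx *)
definition fun_dx :: "(complex \<Rightarrow> complex) \<Rightarrow> vfield"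
  where "fun_dx f = (\<lambda>(x, y). (f y, 0))"

definition V :: "complex \<Rightarrow> nat \<Rightarrow> vfield set"
  where "V \<mu> m = {fun_dx (\<lambda>y. exp (\<mu> * y) * poly P y) | P. degree P < m}"

definition sum_V :: "complex set \<Rightarrow> (complex \<Rightarrow> nat) \<Rightarrow> vfield set"
  where "sum_V S n = {(\<Sum>\<mu>\<in>S. v \<mu>) | v. \<forall>\<mu>\<in>S. v \<mu> \<in> V \<mu> (n \<mu>)}"

(* The six normal forms G over h, as algebras of vector fields on the whole of C^2. *)
definition normal_form :: "vfield set \<Rightarrow> vfield set \<Rightarrow> bool"
  where "normal_form h G \<longleftrightarrow>
     (G = VF.span (h \<union> {d_y}) \<and> \<not> is_eigenvalue d_y h 0) \<or>
     (G = VF.span (h \<union> {d_y, x_dx})) \<or>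
     (\<exists>N. N = eigenvalue_mult d_y h 0 \<and>
        G = VF.span (h \<union> {d_y, fun_dx (\<lambda>y. y ^ N)})) \<or>
     (G = VF.span (h \<union> {x_dx + d_y}) \<and> \<not> is_eigenvalue (x_dx + d_y) h 0) \<or>
     (\<exists>N. N = eigenvalue_mult (x_dx + d_y) h 0 \<and>
        G = VF.span (h \<union> {x_dx + d_y, fun_dx (\<lambda>y. y ^ N * exp y)})) \<or>
     (\<exists>N. N = eigenvalue_mult (x_dx + d_y) h 0 \<and> N > 0 \<and>
        G = VF.span (h \<union> {x_dx + d_y, x_dx + fun_dx (\<lambda>y. y ^ N * exp y)}))"

definition has_form_in :: "C2 set \<Rightarrow> (C2 \<Rightarrow> C2) \<Rightarrow> vfield set \<Rightarrow> vfield set \<Rightarrow> bool"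
  where "has_form_in W \<phi> g h \<longleftrightarrow>
     (\<exists>G. normal_form h G \<and> in_coordinates W \<phi> ` g = vf_restrict (\<phi> ` W) ` G)"

end

(* Let X in g' be nonzero and Z in g be independent of X at a point where both ranks are generic.
   Since g' is abelian of rank 1, [X, Z] = c X with X c = 0. Hence the form dual to Z is closed, and
   so is exp gamma times the form dual to X, where X gamma = 0 and Z gamma = -c. Their potentials are
   coordinates in which Z = d_y and g' consists of fields k(y) d_x; then every field of g is
   (alpha x + f(y)) d_x + beta d_y with constants alpha and beta.

   The fields f(y) d_x of g form a finite dimensional space F invariant under D = d/dy. If
   D e = lambda e with e nonzero in F, then F is the full preimage of (D - lambda) F, which has smaller
   dimension, so by induction F is a space of exponential polynomials. If no dilation occurs
   (alpha = 0 throughout) this is form 1 or form 3, according to whether F contains the constants.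
   Otherwise (x + f0(y)) d_x lies in g, and the shear x + f0(y) brings g to form 2. The forms 4-6 are
   never needed: the change of variables x exp(-y) turns 4 into 1 and 5 into 3, and a further shear
   turns 6 into 2. *)

theory Submission
  imports Defs "HOL-Complex_Analysis.Complex_Analysis"
    "HOL-Computational_Algebra.Fundamental_Theorem_Algebra"
begin

text \<open>Smoothness is defined by iterating one-variable complex derivatives, so the chain rule
  and the symmetry of mixed derivatives have to be earned. Both come from Cauchy's integral over a
  fixed circle: it makes continuous separately holomorphic functions stable under both partial
  derivatives, and these turn out to be all smooth functions.

  That alpha is constant comes from the brackets with X and Z, which lie in g': they force the
  d_x-coefficient m of a field to have m_x and m_y depending on y only, so m_xy = m_yx = 0 and m_x
  is constant.

  The claim h = g' concerns every coordinate system in which some form holds, so there all six forms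
  count. They are uniform in c = 0 or 1: c x d_x + d_y acts on f(y) d_x as D - c, and on e^(mu y)
  p(y) this is p' + (mu - c) p. Eigenvalue zero is thus the frequency mu = c, and forms 3, 5 and 6
  involve the first resonant monomial y^N e^(c y), which D - c sends back into h. Brackets commute
  with push-forward and with restriction, so computing on all of C^2 is enough.\<close>

section \<open>Holomorphic functions of two variables\<close>

text \<open>The contour integral is unfolded to a real interval, so that x and y become mere
  parameters and the theorems on parametric integrals apply.\<close>

lemma cauchy_deriv_param:
  fixes h :: "complex \<Rightarrow> complex \<Rightarrow> complex"
  assumes "continuous_on (cball a r) (\<lambda>x. h x y)" "(\<lambda>x. h x y) holomorphic_on ball a r"
    and "x \<in> ball a r"
  shows "deriv (\<lambda>x. h x y) x =
    1 / (2 * of_real pi * \<i>) * integral (cbox 0 1) (\<lambda>t. h (circlepath a r t) y / (circlepath a r t - x)^2 *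
      (2 * of_real pi * \<i> * r * exp (2 * of_real pi * \<i> * t)))"
  using DERIV_imp_deriv[OF Cauchy_derivative_integral_circlepath(2)[OF assms]]
  by (simp add: contour_integral_integral vector_derivative_circlepath cbox_interval)

lemma circlepath_in_cball: "r > 0 \<Longrightarrow> circlepath a r t \<in> cball a r"
  by (simp add: circlepath dist_norm norm_mult)

lemma circlepath_neq: "r > 0 \<Longrightarrow> x \<in> ball a r \<Longrightarrow> circlepath a r t \<noteq> x"
  by (auto simp add: circlepath dist_norm norm_mult)

text \<open>The circle is the boundary while x stays in the open disc, so the denominator never
  vanishes.\<close>

lemma continuous_cauchy_kernel:
  fixes k :: "complex \<times> complex \<Rightarrow> complex"
  assumes "continuous_on (cball a r \<times> B) k" and r: "r > 0"
  shows "continuous_on ((ball a r \<times> B) \<times> cbox 0 1)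
     (\<lambda>((x, y), t). k (circlepath a r t, y) / (circlepath a r t - x)^2 *
      (2 * of_real pi * \<i> * r * exp (2 * of_real pi * \<i> * t)))"
proof -
  have c: "continuous_on S (circlepath a r)" for S
    by (simp add: circlepath_def part_circlepath_def continuous_intros)
  have "continuous_on ((ball a r \<times> B) \<times> cbox (0::real) 1) (\<lambda>q. k (circlepath a r (snd q), snd (fst q)))"
    by (rule continuous_on_compose2[OF assms(1)])
       (auto intro!: continuous_intros continuous_on_compose2[OF c] simp: circlepath_in_cball[OF r, simplified])
  moreover have "circlepath a r (snd q) - fst (fst q) \<noteq> 0" if "q \<in> ((ball a r \<times> B) \<times> cbox (0::real) 1)" for q
    using circlepath_neq[OF r] that by auto
  ultimately show ?thesis
    unfolding case_prod_beta
    by (intro continuous_intros continuous_on_compose2[OF c]) auto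
qed

lemma continuous_on_slice_fst:
  assumes "continuous_on (A \<times> B) (\<lambda>q. h (fst q) (snd q))" "y \<in> B"
  shows "continuous_on A (\<lambda>x. h x y)"
proof -
  have "continuous_on A (\<lambda>x. (x, y))" by (intro continuous_intros)
  from continuous_on_compose2[OF assms(1) this] assms(2) show ?thesis by auto
qed

text \<open>The derivative is an integral of h itself, so joint continuity passes from h to its
  derivative.\<close>

lemma continuous_on_deriv_fst:
  fixes h :: "complex \<Rightarrow> complex \<Rightarrow> complex"
  assumes c: "continuous_on (cball a r \<times> B) (\<lambda>q. h (fst q) (snd q))" and r: "r > 0"
    and hol: "\<And>y. y \<in> B \<Longrightarrow> (\<lambda>x. h x y) holomorphic_on ball a r"
  shows "continuous_on (ball a r \<times> B) (\<lambda>q. deriv (\<lambda>x. h x (snd q)) (fst q))"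
proof -
  have "continuous_on (ball a r \<times> B) (\<lambda>q. 1 / (2 * of_real pi * \<i>) * integral (cbox 0 1)
      (\<lambda>t. h (circlepath a r t) (snd q) / (circlepath a r t - fst q)^2 *
      (2 * of_real pi * \<i> * r * exp (2 * of_real pi * \<i> * t))))"
    using continuous_cauchy_kernel[OF c r]
    by (intro continuous_intros integral_continuous_on_param) (simp add: case_prod_beta)
  moreover have "1 / (2 * of_real pi * \<i>) * integral (cbox 0 1)
      (\<lambda>t. h (circlepath a r t) (snd q) / (circlepath a r t - fst q)^2 *
      (2 * of_real pi * \<i> * r * exp (2 * of_real pi * \<i> * t))) = deriv (\<lambda>x. h x (snd q)) (fst q)"
    if "q \<in> ball a r \<times> B" for q
    using that
    by (intro cauchy_deriv_param[symmetric] hol continuous_on_slice_fst[OF c]) auto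
  ultimately show ?thesis
    by (rule continuous_on_eq)
qed

text \<open>Differentiation in y under Cauchy's integral. The result is Cauchy's formula for the
  x-derivative of \<open>h'\<close>, which later gives the symmetry of mixed derivatives.\<close>

lemma has_field_derivative_deriv_fst:
  fixes h :: "complex \<Rightarrow> complex \<Rightarrow> complex"
  assumes c: "continuous_on (cball a r \<times> B) (\<lambda>q. h (fst q) (snd q))" and r: "r > 0"
    and hol: "\<And>y. y \<in> B \<Longrightarrow> (\<lambda>x. h x y) holomorphic_on ball a r"
    and c': "continuous_on (cball a r \<times> B) (\<lambda>q. h' (fst q) (snd q))"
    and d: "\<And>x y. x \<in> cball a r \<Longrightarrow> y \<in> B \<Longrightarrow> ((\<lambda>y. h x y) has_field_derivative h' x y) (at y)"
    and B: "open B" "convex B" and x: "x \<in> ball a r" and y: "y \<in> B"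
  shows "((\<lambda>y. deriv (\<lambda>x. h x y) x) has_field_derivative
    1 / (2 * of_real pi * \<i>) * integral (cbox 0 1) (\<lambda>t. h' (circlepath a r t) y / (circlepath a r t - x)^2 *
      (2 * of_real pi * \<i> * r * exp (2 * of_real pi * \<i> * t)))) (at y)"
proof -
  let ?w = "\<lambda>t::real. 2 * of_real pi * \<i> * r * exp (2 * of_real pi * \<i> * t)"
  let ?K = "\<lambda>y t. h (circlepath a r t) y / (circlepath a r t - x)^2 * ?w t"
  let ?K' = "\<lambda>y t. h' (circlepath a r t) y / (circlepath a r t - x)^2 * ?w t"
  have ck: "continuous_on (B \<times> cbox 0 1) (\<lambda>(y, t). k (circlepath a r t) y / (circlepath a r t - x)^2 * ?w t)"
    if "continuous_on (cball a r \<times> B) (\<lambda>q. k (fst q) (snd q))" for k :: "complex \<Rightarrow> complex \<Rightarrow> complex"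
  proof -
    have "continuous_on (B \<times> cbox 0 1) (\<lambda>q. ((x, fst q), snd q))"
      by (intro continuous_intros)
    note * = continuous_on_compose2[OF continuous_cauchy_kernel[OF that r] this]
    have "(\<lambda>q. ((x, fst q), snd q)) ` (B \<times> cbox 0 1) \<subseteq> (ball a r \<times> B) \<times> cbox (0::real) 1"
      using x by auto
    from *[OF this] show ?thesis
      by (simp add: case_prod_beta del: times_divide_eq_left)
  qed
  have "((\<lambda>y. integral (cbox 0 1) (?K y)) has_field_derivative integral (cbox 0 1) (?K' y)) (at y within B)"
  proof (rule leibniz_rule_field_derivative[OF _ _ ck[OF c'] y B(2)])
    fix z t assume z: "z \<in> B" and t: "t \<in> cbox (0::real) 1"
    have "((\<lambda>y. h (circlepath a r t) y) has_field_derivative h' (circlepath a r t) z) (at z within B)"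
      using d[OF circlepath_in_cball[OF r] z] has_field_derivative_at_within by blast
    from DERIV_cmult[OF this, of "?w t / (circlepath a r t - x)^2"]
    show "((\<lambda>y. ?K y t) has_field_derivative ?K' z t) (at z within B)"
      by (simp add: mult_ac)
  next
    fix z assume z: "z \<in> B"
    have "continuous_on (cbox 0 1) (\<lambda>t::real. (z, t))"
      by (intro continuous_intros)
    from continuous_on_compose2[OF ck[OF c] this] z show "?K z integrable_on cbox 0 1"
      by (intro integrable_continuous) auto
  qed
  from DERIV_cmult[OF this, of "1 / (2 * of_real pi * \<i>)"]
  have D: "((\<lambda>y. 1 / (2 * of_real pi * \<i>) * integral (cbox 0 1) (?K y)) has_field_derivative
      1 / (2 * of_real pi * \<i>) * integral (cbox 0 1) (?K' y)) (at y)"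
    by (simp only: at_within_open[OF y B(1)])
  have e: "1 / (2 * of_real pi * \<i>) * integral (cbox 0 1) (?K y) = deriv (\<lambda>x. h x y) x" if "y \<in> B" for y
    using x that by (intro cauchy_deriv_param[symmetric] hol continuous_on_slice_fst[OF c]) auto
  show ?thesis
    by (rule has_field_derivative_transform_within_open[OF D B(1) y e])
qed

text \<open>The first two levels of \<open>Ck_on\<close> without continuity of the partial
  derivatives; on open sets this already equals \<open>smooth_on\<close>.\<close>

definition sep_holo :: "C2 set \<Rightarrow> (C2 \<Rightarrow> complex) \<Rightarrow> bool"
  where "sep_holo U f \<longleftrightarrow> continuous_on U f \<and>
     (\<forall>p\<in>U. (\<lambda>t. f (t, snd p)) field_differentiable at (fst p) \<and>
            (\<lambda>t. f (fst p, t)) field_differentiable at (snd p))"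

lemma cball_prod_subset:
  fixes p :: C2
  assumes "open U" "p \<in> U"
  obtains r where "r > 0" "cball (fst p) r \<times> cball (snd p) r \<subseteq> U"
proof -
  obtain A B where AB: "open A" "open B" "p \<in> A \<times> B" "A \<times> B \<subseteq> U"
    using assms by (metis open_prod_elim)
  then obtain r1 r2 where "r1 > 0" "cball (fst p) r1 \<subseteq> A" "r2 > 0" "cball (snd p) r2 \<subseteq> B"
    by (metis mem_Times_iff open_contains_cball)
  then have "cball (fst p) (min r1 r2) \<times> cball (snd p) (min r1 r2) \<subseteq> A \<times> B" "min r1 r2 > 0"
    by (auto simp: subset_iff)
  with AB have "cball (fst p) (min r1 r2) \<times> cball (snd p) (min r1 r2) \<subseteq> U" "min r1 r2 > 0"
    by blast+
  then show ?thesis using that by blast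
qed

text \<open>Exchanging the variables turns each statement about \<open>pdx\<close> into one about
  \<open>pdy\<close>.\<close>

lemma sep_holo_swap:
  assumes "sep_holo U f"
  shows "sep_holo (prod.swap ` U) (f \<circ> prod.swap)"
proof -
  have "continuous_on (prod.swap ` U) (f \<circ> prod.swap)"
    using assms unfolding sep_holo_def
    by (intro continuous_on_compose continuous_on_swap) (auto simp: image_image)
  then show ?thesis using assms unfolding sep_holo_def by auto
qed

lemma open_swap: "open U \<Longrightarrow> open (prod.swap ` (U :: C2 set))"
proof -
  assume "open U"
  moreover have "prod.swap ` U = prod.swap -` U" by force
  ultimately show ?thesis
    by (simp add: open_vimage continuous_on_swap)
qed

lemma pdy_swap: "pdy f = pdx (f \<circ> prod.swap) \<circ> prod.swap"
  by (auto simp: pdx_def pdy_def fun_eq_iff)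

lemma sep_holo_fst:
  assumes "sep_holo U f" "A \<times> {y} \<subseteq> U"
  shows "(\<lambda>x. f (x, y)) holomorphic_on A"
  unfolding holomorphic_on_def
proof
  fix x assume "x \<in> A"
  then have "(x, y) \<in> U" using assms(2) by blast
  with assms(1) have "(\<lambda>x. f (x, y)) field_differentiable at x"
    unfolding sep_holo_def by fastforce
  then show "(\<lambda>x. f (x, y)) field_differentiable at x within A"
    by (rule field_differentiable_at_within)
qed

lemma continuous_on_pdx:
  assumes U: "open U" and f: "sep_holo U f"
  shows "continuous_on U (pdx f)"
proof (rule continuous_at_imp_continuous_on, rule ballI)
  fix p assume p: "p \<in> U"
  obtain r where r: "r > 0" "cball (fst p) r \<times> cball (snd p) r \<subseteq> U"
    using cball_prod_subset[OF U p] .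
  then have sub: "cball (fst p) r \<times> ball (snd p) r \<subseteq> U" by auto
  have "continuous_on (ball (fst p) r \<times> ball (snd p) r) (pdx f)"
    unfolding pdx_def
  proof (rule continuous_on_deriv_fst[OF _ r(1)])
    show "continuous_on (cball (fst p) r \<times> ball (snd p) r) (\<lambda>q. f (fst q, snd q))"
      using f sub continuous_on_subset unfolding sep_holo_def by auto
    show "(\<lambda>x. f (x, y)) holomorphic_on ball (fst p) r" if "y \<in> ball (snd p) r" for y
      using that sub by (intro sep_holo_fst[OF f]) auto
  qed
  moreover have "p \<in> ball (fst p) r \<times> ball (snd p) r" using r(1) by (simp add: mem_Times_iff)
  ultimately show "isCont (pdx f) p"
    using continuous_on_eq_continuous_at open_Times open_ball by metis
qed

lemma continuous_on_pdy:
  assumes U: "open U" and f: "sep_holo U f"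
  shows "continuous_on U (pdy f)"
proof -
  from continuous_on_pdx[OF open_swap[OF U] sep_holo_swap[OF f]] show ?thesis
    unfolding pdy_swap by (intro continuous_on_compose continuous_on_swap)
qed

lemma sep_holo_pd:
  assumes f: "sep_holo U f" and p: "p \<in> U"
  shows "((\<lambda>y. f (fst p, y)) has_field_derivative pdy f p) (at (snd p))"
    and "((\<lambda>x. f (x, snd p)) has_field_derivative pdx f p) (at (fst p))"
  unfolding pdy_def pdx_def
  by (rule field_differentiable_derivI; use f p in \<open>simp add: sep_holo_def\<close>)+

text \<open>The derivative is kept as an integral: this serves both for the existence of the mixed
  derivative and for its identification with \<open>pdx (pdy f)\<close>.\<close>

lemma pdx_has_pdy_aux:
  assumes U: "open U" and f: "sep_holo U f" and p: "p \<in> U"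
  obtains r where "r > 0" "cball (fst p) r \<times> ball (snd p) r \<subseteq> U"
    "((\<lambda>t. pdx f (fst p, t)) has_field_derivative
    1 / (2 * of_real pi * \<i>) * integral (cbox 0 1) (\<lambda>t. pdy f (circlepath (fst p) r t, snd p) / (circlepath (fst p) r t - fst p)^2 *
      (2 * of_real pi * \<i> * r * exp (2 * of_real pi * \<i> * t)))) (at (snd p))"
proof -
  obtain r where r: "r > 0" "cball (fst p) r \<times> cball (snd p) r \<subseteq> U"
    using cball_prod_subset[OF U p] .
  then have sub: "cball (fst p) r \<times> ball (snd p) r \<subseteq> U" by auto
  let ?A = "cball (fst p) r" and ?B = "ball (snd p) r"
  have cf: "continuous_on (?A \<times> ?B) f" and cy: "continuous_on (?A \<times> ?B) (pdy f)"
    using f sub continuous_on_pdy[OF U f] continuous_on_subset unfolding sep_holo_def by auto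
  have dy: "((\<lambda>y. f (x, y)) has_field_derivative pdy f (x, y)) (at y)" if "x \<in> ?A" "y \<in> ?B" for x y
    using sep_holo_pd(1)[OF f, of "(x, y)"] subsetD[OF sub, of "(x, y)"] that by simp
  have "((\<lambda>t. pdx f (fst p, t)) has_field_derivative
    1 / (2 * of_real pi * \<i>) * integral (cbox 0 1) (\<lambda>t. pdy f (circlepath (fst p) r t, snd p) / (circlepath (fst p) r t - fst p)^2 *
      (2 * of_real pi * \<i> * r * exp (2 * of_real pi * \<i> * t)))) (at (snd p))"
    unfolding pdx_def fst_conv snd_conv
  proof (rule has_field_derivative_deriv_fst[where B = ?B and h' = "\<lambda>x y. pdy f (x, y)"])
    show "(\<lambda>x. f (x, y)) holomorphic_on ball (fst p) r" if "y \<in> ball (snd p) r" for y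
      using that sub by (intro sep_holo_fst[OF f]) auto
  qed (use cf cy r sub dy in \<open>auto simp: case_prod_beta\<close>)
  with r(1) sub that show ?thesis by blast
qed

lemma sep_holo_pdx:
  assumes U: "open U" and f: "sep_holo U f"
  shows "sep_holo U (pdx f)"
proof -
  have "(\<lambda>t. pdx f (t, snd p)) field_differentiable at (fst p)" if p: "p \<in> U" for p
  proof -
    obtain r where r: "r > 0" "cball (fst p) r \<times> cball (snd p) r \<subseteq> U"
      using cball_prod_subset[OF U p] .
    have "(\<lambda>x. f (x, snd p)) holomorphic_on ball (fst p) r"
      using r by (intro sep_holo_fst[OF f]) force
    from holomorphic_deriv[OF this] r(1) show ?thesis
      unfolding pdx_def by (auto intro: holomorphic_on_imp_differentiable_at)
  qed
  moreover have "(\<lambda>t. pdx f (fst p, t)) field_differentiable at (snd p)" if p: "p \<in> U" for p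
    by (rule pdx_has_pdy_aux[OF U f p]) (unfold field_differentiable_def, erule exI)
  ultimately show ?thesis
    unfolding sep_holo_def using continuous_on_pdx[OF U f] by blast
qed

lemma sep_holo_pdy:
  assumes U: "open U" and f: "sep_holo U f"
  shows "sep_holo U (pdy f)"
  using sep_holo_swap[OF sep_holo_pdx[OF open_swap[OF U] sep_holo_swap[OF f]]]
  unfolding pdy_swap by (simp add: image_image)

text \<open>Both sides equal the same Cauchy integral of \<open>pdy f\<close> over one
  circle.\<close>

lemma pdx_pdy_commute:
  assumes U: "open U" and f: "sep_holo U f" and p: "p \<in> U"
  shows "pdy (pdx f) p = pdx (pdy f) p"
proof -
  obtain r where r: "r > 0" "cball (fst p) r \<times> ball (snd p) r \<subseteq> U"
    and D: "((\<lambda>t. pdx f (fst p, t)) has_field_derivative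
    1 / (2 * of_real pi * \<i>) * integral (cbox 0 1) (\<lambda>t. pdy f (circlepath (fst p) r t, snd p) / (circlepath (fst p) r t - fst p)^2 *
      (2 * of_real pi * \<i> * r * exp (2 * of_real pi * \<i> * t)))) (at (snd p))"
    using pdx_has_pdy_aux[OF U f p] .
  have h: "(\<lambda>x. pdy f (x, snd p)) holomorphic_on cball (fst p) r"
    using r by (intro sep_holo_fst[OF sep_holo_pdy[OF U f]]) force
  have "pdy (pdx f) p = deriv (\<lambda>x. pdy f (x, snd p)) (fst p)"
    unfolding pdy_def[of "pdx f"] DERIV_imp_deriv[OF D]
    using h r(1) by (intro cauchy_deriv_param[symmetric])
      (auto intro: holomorphic_on_imp_continuous_on holomorphic_on_subset)
  then show ?thesis by (simp add: pdx_def)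
qed

text \<open>The class is closed under both partial derivatives, so a first complex derivative in
  each variable yields all orders.\<close>

lemma Ck_on_sep_holo: "open U \<Longrightarrow> sep_holo U f \<Longrightarrow> Ck_on k U f"
proof (induction k arbitrary: f)
  case 0
  then show ?case by (simp add: sep_holo_def)
next
  case (Suc k)
  then show ?case
    using sep_holo_pdx sep_holo_pdy by (auto simp: sep_holo_def)
qed

lemma smooth_on_iff_sep_holo:
  assumes "open U"
  shows "smooth_on U f \<longleftrightarrow> sep_holo U f"
proof
  assume "smooth_on U f"
  then have "Ck_on 0 U f" "Ck_on (Suc 0) U f" unfolding smooth_on_def by blast+
  then show "sep_holo U f" by (auto simp: sep_holo_def)
qed (use assms Ck_on_sep_holo in \<open>auto simp: smooth_on_def\<close>)

section \<open>Total derivatives and the chain rule\<close>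

definition has_pd :: "(C2 \<Rightarrow> complex) \<Rightarrow> complex \<Rightarrow> complex \<Rightarrow> C2 \<Rightarrow> bool"
  where "has_pd f a b p \<longleftrightarrow> (f has_derivative (\<lambda>h. a * fst h + b * snd h)) (at p)"

lemma has_pd_fst: "has_pd f a b p \<Longrightarrow> ((\<lambda>t. f (t, snd p)) has_field_derivative a) (at (fst p))"
  unfolding has_pd_def has_field_derivative_def
proof -
  assume "(f has_derivative (\<lambda>h. a * fst h + b * snd h)) (at p)"
  then have "(f has_derivative (\<lambda>h. a * fst h + b * snd h)) (at (fst p, snd p))" by simp
  from has_derivative_compose[OF has_derivative_Pair[OF has_derivative_ident has_derivative_const] this]
  show "((\<lambda>t. f (t, snd p)) has_derivative (*) a) (at (fst p))" by simp
qed

lemma has_pd_snd: "has_pd f a b p \<Longrightarrow> ((\<lambda>t. f (fst p, t)) has_field_derivative b) (at (snd p))"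
  unfolding has_pd_def has_field_derivative_def
proof -
  assume "(f has_derivative (\<lambda>h. a * fst h + b * snd h)) (at p)"
  then have "(f has_derivative (\<lambda>h. a * fst h + b * snd h)) (at (fst p, snd p))" by simp
  from has_derivative_compose[OF has_derivative_Pair[OF has_derivative_const has_derivative_ident] this]
  show "((\<lambda>t. f (fst p, t)) has_derivative (*) b) (at (snd p))" by simp
qed

lemma has_pdD: "has_pd f a b p \<Longrightarrow> pdx f p = a" "has_pd f a b p \<Longrightarrow> pdy f p = b"
  using has_pd_fst has_pd_snd by (auto simp: pdx_def pdy_def DERIV_imp_deriv)

text \<open>Continuity of the y-derivative controls the increment in y uniformly for nearby x;
  together with the x-derivative at p itself this gives the total derivative.\<close>

lemma has_pd_partials:
  assumes U: "open U" and p: "p \<in> U"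
    and x: "\<And>q. q \<in> U \<Longrightarrow> ((\<lambda>t. f (t, snd q)) has_field_derivative a q) (at (fst q))"
    and y: "\<And>q. q \<in> U \<Longrightarrow> ((\<lambda>t. f (fst q, t)) has_field_derivative b q) (at (snd q))"
    and b: "continuous_on U b"
  shows "has_pd f (a p) (b p) p"
proof -
  obtain r where r: "r > 0" "cball (fst p) r \<times> cball (snd p) r \<subseteq> U"
    using cball_prod_subset[OF U p] .
  let ?A = "ball (fst p) r" and ?B = "ball (snd p) r"
  have sub: "?A \<times> ?B \<subseteq> U" using r by force
  have "((\<lambda>(x, y). f (x, y)) has_derivative (\<lambda>(tx, ty). a p * tx + blinfun_mult_right (b (fst p, snd p)) ty))
    (at (fst p, snd p) within ?A \<times> ?B)"
  proof (rule has_derivative_partialsI[where fy = "\<lambda>x y. blinfun_mult_right (b (x, y))"])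
    show "((\<lambda>x. f (x, snd p)) has_derivative (*) (a p)) (at (fst p) within ?A)"
      using x[OF p] unfolding has_field_derivative_def by (rule has_derivative_at_withinI)
    show "((\<lambda>y. f (x, y)) has_derivative blinfun_apply (blinfun_mult_right (b (x, y)))) (at y within ?B)"
      if "x \<in> ?A" "y \<in> ?B" for x y
    proof -
      have "(x, y) \<in> U" using that sub by blast
      from y[OF this] have "((\<lambda>y. f (x, y)) has_derivative (*) (b (x, y))) (at y within ?B)"
        unfolding has_field_derivative_def fst_conv snd_conv by (rule has_derivative_at_withinI)
      then show ?thesis by simp
    qed
    have "continuous_on (?A \<times> ?B) (\<lambda>q. blinfun_mult_right (b q))"
      by (rule bounded_linear.continuous_on[OF bounded_linear_blinfun_mult_right continuous_on_subset[OF b sub]])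
    moreover have "(fst p, snd p) \<in> ?A \<times> ?B" using r(1) by (simp add: mem_Times_iff)
    ultimately show "continuous (at (fst p, snd p) within ?A \<times> ?B) (\<lambda>(x, y). blinfun_mult_right (b (x, y)))"
      unfolding continuous_on_eq_continuous_within case_prod_beta prod.collapse by blast
  qed (use r in auto)
  moreover have "at (fst p, snd p) within ?A \<times> ?B = at p"
    using r(1) by (subst at_within_open) (auto simp: open_Times mem_Times_iff)
  ultimately show ?thesis
    by (simp add: has_pd_def case_prod_beta')
qed

lemma sep_holo_has_pd: "open U \<Longrightarrow> sep_holo U f \<Longrightarrow> p \<in> U \<Longrightarrow> has_pd f (pdx f p) (pdy f p) p"
  by (rule has_pd_partials) (auto intro: sep_holo_pd continuous_on_pdy)

lemma sep_holo_iff_has_pd: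
  assumes "open U"
  shows "sep_holo U f \<longleftrightarrow> (\<forall>p\<in>U. \<exists>a b. has_pd f a b p)"
proof
  assume *: "\<forall>p\<in>U. \<exists>a b. has_pd f a b p"
  then have "continuous_on U f"
    unfolding has_pd_def by (metis continuous_at_imp_continuous_on has_derivative_continuous)
  with * show "sep_holo U f"
    unfolding sep_holo_def field_differentiable_def using has_pd_fst has_pd_snd by blast
qed (use assms sep_holo_has_pd in blast)

lemma smooth_on_iff: "open U \<Longrightarrow> smooth_on U f \<longleftrightarrow> (\<forall>p\<in>U. \<exists>a b. has_pd f a b p)"
  by (simp add: smooth_on_iff_sep_holo sep_holo_iff_has_pd)

lemma smooth_onI: "open U \<Longrightarrow> (\<And>p. p \<in> U \<Longrightarrow> has_pd f (a p) (b p) p) \<Longrightarrow> smooth_on U f"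
  using smooth_on_iff by blast

lemma smooth_on_has_pd: "smooth_on U f \<Longrightarrow> open U \<Longrightarrow> p \<in> U \<Longrightarrow> has_pd f (pdx f p) (pdy f p) p"
  by (simp add: sep_holo_has_pd smooth_on_iff_sep_holo)

lemma smooth_on_subset: "smooth_on U f \<Longrightarrow> open U \<Longrightarrow> open W \<Longrightarrow> W \<subseteq> U \<Longrightarrow> smooth_on W f"
  by (auto simp: smooth_on_iff)

lemma smooth_on_pdx: "smooth_on U f \<Longrightarrow> open U \<Longrightarrow> smooth_on U (pdx f)"
  by (simp add: smooth_on_iff_sep_holo sep_holo_pdx)

lemma smooth_on_pdy: "smooth_on U f \<Longrightarrow> open U \<Longrightarrow> smooth_on U (pdy f)"
  by (simp add: smooth_on_iff_sep_holo sep_holo_pdy)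

lemma smooth_on_continuous: "smooth_on U f \<Longrightarrow> continuous_on U f"
  unfolding smooth_on_def using Ck_on.simps(1) by blast

lemma has_pd_const: "has_pd (\<lambda>_. c) 0 0 p"
  by (simp add: has_pd_def)

lemma has_pd_add: "has_pd f a b p \<Longrightarrow> has_pd g c d p \<Longrightarrow> has_pd (\<lambda>q. f q + g q) (a + c) (b + d) p"
  unfolding has_pd_def by (erule (1) has_derivative_add[THEN has_derivative_eq_rhs]) (auto simp: algebra_simps)

lemma has_pd_diff: "has_pd f a b p \<Longrightarrow> has_pd g c d p \<Longrightarrow> has_pd (\<lambda>q. f q - g q) (a - c) (b - d) p"
  unfolding has_pd_def by (erule (1) has_derivative_diff[THEN has_derivative_eq_rhs]) (auto simp: algebra_simps)

lemma has_pd_mult: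
  "has_pd f a b p \<Longrightarrow> has_pd g c d p \<Longrightarrow> has_pd (\<lambda>q. f q * g q) (a * g p + f p * c) (b * g p + f p * d) p"
  unfolding has_pd_def by (erule (1) has_derivative_mult[THEN has_derivative_eq_rhs]) (auto simp: algebra_simps)

lemma has_pd_comp1:
  assumes "has_pd f a b p" "(h has_field_derivative d) (at (f p))"
  shows "has_pd (\<lambda>q. h (f q)) (d * a) (d * b) p"
  using has_derivative_compose[OF assms(1)[unfolded has_pd_def] assms(2)[unfolded has_field_derivative_def]]
  by (simp add: has_pd_def algebra_simps)

lemma has_pd_comp:
  assumes "has_pd f a b (F p)" "has_pd (\<lambda>q. fst (F q)) a1 b1 p" "has_pd (\<lambda>q. snd (F q)) a2 b2 p"
  shows "has_pd (\<lambda>q. f (F q)) (a * a1 + b * a2) (a * b1 + b * b2) p"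
proof -
  have "(f has_derivative (\<lambda>h. a * fst h + b * snd h)) (at (fst (F p), snd (F p)))"
    using assms(1) by (simp add: has_pd_def)
  from has_derivative_compose[OF has_derivative_Pair[OF assms(2,3)[unfolded has_pd_def]] this]
  show ?thesis by (simp add: has_pd_def algebra_simps)
qed

lemma has_pd_fst_proj: "has_pd fst 1 0 p" and has_pd_snd_proj: "has_pd snd 0 1 p"
  by (auto simp: has_pd_def intro!: has_derivative_eq_rhs[OF has_derivative_fst[OF has_derivative_ident]]
    has_derivative_eq_rhs[OF has_derivative_snd[OF has_derivative_ident]])

lemma has_pd_cong:
  assumes "has_pd f a b p" "open U" "p \<in> U" "\<And>q. q \<in> U \<Longrightarrow> f q = g q"
  shows "has_pd g a b p"
  using has_derivative_transform_within_open[OF assms(1)[unfolded has_pd_def] assms(2-4)]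
  by (simp add: has_pd_def)

section \<open>Eigenvectors in finite dimensional spaces of vector fields\<close>

text \<open>Linearity only on K: differentiation, the intended \<open>T\<close>, is additive only on
  fields with differentiable coefficients.\<close>

definition linear_on_sub :: "vfield set \<Rightarrow> (vfield \<Rightarrow> vfield) \<Rightarrow> bool"
  where "linear_on_sub K T \<longleftrightarrow> (\<forall>X\<in>K. \<forall>Y\<in>K. T (X + Y) = T X + T Y) \<and>
    (\<forall>c. \<forall>X\<in>K. T (vf_scale c X) = vf_scale c (T X))"

lemma linear_on_sub_0: "linear_on_sub K T \<Longrightarrow> VF.subspace K \<Longrightarrow> T 0 = 0"
  unfolding linear_on_sub_def by (metis VF.scale_zero_left VF.subspace_0)

lemma linear_on_sub_sum:
  assumes "linear_on_sub K T" "VF.subspace K" "\<And>i. i \<in> I \<Longrightarrow> X i \<in> K"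
  shows "T (\<Sum>i\<in>I. vf_scale (c i) (X i)) = (\<Sum>i\<in>I. vf_scale (c i) (T (X i)))"
  using assms(3)
proof (induction I rule: infinite_finite_induct)
  case (insert i I)
  have "(\<Sum>i\<in>I. vf_scale (c i) (X i)) \<in> K"
    using insert by (intro VF.subspace_sum VF.subspace_scale assms(2)) auto
  moreover have "vf_scale (c i) (X i) \<in> K"
    using insert by (intro VF.subspace_scale assms(2)) auto
  moreover have "T (vf_scale (c i) (X i)) = vf_scale (c i) (T (X i))"
    using assms(1) insert.prems unfolding linear_on_sub_def by blast
  moreover have "T (X + Y) = T X + T Y" if "X \<in> K" "Y \<in> K" for X Y
    using that assms(1) unfolding linear_on_sub_def by blast
  ultimately show ?case
    using insert by (simp del: plus_fun_apply)
qed (simp_all add: linear_on_sub_0[OF assms(1,2)])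

text \<open>With a root z, p = (t - z) q and w = q(T) v, one has T w - z w = p(T) v = 0. Either w is
  the eigenvector, or q annihilates v and has smaller degree.\<close>

lemma eigenvector_of_annihilator:
  assumes K: "VF.subspace K" and T: "linear_on_sub K T" "\<And>X. X \<in> K \<Longrightarrow> T X \<in> K"
    and v: "v \<in> K" "v \<noteq> 0"
  shows "p \<noteq> 0 \<Longrightarrow> degree p \<le> m \<Longrightarrow> (\<Sum>i<Suc m. vf_scale (coeff p i) ((T ^^ i) v)) = 0 \<Longrightarrow>
    \<exists>c w. w \<in> K \<and> w \<noteq> 0 \<and> T w = vf_scale c w"
proof (induction m arbitrary: p)
  case 0
  then have "coeff p 0 \<noteq> 0" by (metis le_0_eq leading_coeff_0_iff)
  with 0(3) v show ?case by (simp del: zero_fun_apply)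
next
  case (Suc m)
  show ?case
  proof (cases "degree p = 0")
    case True
    then have "coeff p 0 \<noteq> 0" "\<And>i. coeff p (Suc i) = 0"
      using Suc.prems(1) by (auto simp: coeff_eq_0 leading_coeff_0_iff[symmetric] simp del: leading_coeff_0_iff)
    with Suc.prems v show ?thesis by (simp add: sum.lessThan_Suc_shift del: sum.lessThan_Suc zero_fun_apply)
  next
    case False
    then have "\<exists>z. poly p z = 0"
      by (intro fundamental_theorem_of_algebra_alt) auto
    then obtain z where "poly p z = 0" ..
    then obtain q where q: "p = [:-z, 1:] * q" using poly_eq_0_iff_dvd by blast
    with Suc.prems have q0: "q \<noteq> 0" by auto
    then have dq: "degree q \<le> m" using Suc.prems(2) unfolding q by (subst (asm) degree_mult_eq) auto
    have it: "(T ^^ i) v \<in> K" for i by (induction i) (auto simp: v T)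
    define w where "w = (\<Sum>i<Suc m. vf_scale (coeff q i) ((T ^^ i) v))"
    have Tw: "T w = (\<Sum>i<Suc m. vf_scale (coeff q i) ((T ^^ Suc i) v))"
      unfolding w_def by (subst linear_on_sub_sum[OF T(1) K]) (auto simp: it)
    have "(\<Sum>i<Suc (Suc m). vf_scale (coeff p i) ((T ^^ i) v)) =
       (\<Sum>i<Suc (Suc m). vf_scale (coeff (pCons 0 q) i) ((T ^^ i) v)) -
       (\<Sum>i<Suc (Suc m). vf_scale (z * coeff q i) ((T ^^ i) v))"
      unfolding q sum_subtractf[symmetric]
      by (intro sum.cong refl) (simp add: VF.scale_left_diff_distrib[symmetric])
    also have "(\<Sum>i<Suc (Suc m). vf_scale (coeff (pCons 0 q) i) ((T ^^ i) v)) = T w"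
      unfolding Tw by (subst sum.lessThan_Suc_shift) simp
    also have "(\<Sum>i<Suc (Suc m). vf_scale (z * coeff q i) ((T ^^ i) v)) = vf_scale z w"
      using dq unfolding w_def VF.scale_sum_right
      by (subst sum.lessThan_Suc) (simp add: coeff_eq_0)
    finally have e: "T w = vf_scale z w" unfolding Suc.prems(3) by (simp only: eq_iff_diff_eq_0[of "T w"])
    have "w \<in> K" unfolding w_def by (intro VF.subspace_sum VF.subspace_scale K it)
    then show ?thesis
      using Suc.IH[OF q0 dq] e unfolding w_def by blast
  qed
qed

lemma eigenvector_exists:
  assumes K: "VF.subspace K" and T: "linear_on_sub K T" "\<And>X. X \<in> K \<Longrightarrow> T X \<in> K"
    and C: "finite C" "K \<subseteq> VF.span C" and "K \<noteq> {0}"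
  shows "\<exists>c w. w \<in> K \<and> w \<noteq> 0 \<and> T w = vf_scale c w"
proof -
  obtain v where v: "v \<in> K" "v \<noteq> 0" using \<open>K \<noteq> {0}\<close> VF.subspace_0[OF K] by blast
  define t where "t i = (T ^^ i) v" for i
  have tK: "t i \<in> K" for i unfolding t_def by (induction i) (auto simp: v T)
  define m where "m = card C"
  \<comment> \<open>The m + 1 iterates exceed the size of a spanning set. Dependence of a set does
    not see repetitions, so two equal iterates are a separate case.\<close>
  obtain c where c: "\<exists>i\<le>m. c i \<noteq> 0" "(\<Sum>i<Suc m. vf_scale (c i) (t i)) = 0"
  proof (cases "inj_on t {..m}")
    case True
    have "VF.dependent (t ` {..m})"
      using VF.independent_span_bound[OF C(1), of "t ` {..m}"] C(2) tK card_image[OF True]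
      unfolding m_def by fastforce
    then obtain u where u: "\<exists>v\<in>t ` {..m}. u v \<noteq> 0" "(\<Sum>v\<in>t ` {..m}. vf_scale (u v) v) = 0"
      by (subst (asm) VF.dependent_finite) auto
    show ?thesis
      using u by (intro that[of "u \<circ> t"]) (auto simp: sum.reindex[OF True] lessThan_Suc_atMost)
  next
    case False
    then obtain i j where ij: "i \<le> m" "j \<le> m" "i \<noteq> j" "t i = t j" by (auto simp: inj_on_def)
    have "(\<Sum>k<Suc m. vf_scale ((if k = i then 1 else 0) + (if k = j then -1 else 0)) (t k)) =
       (\<Sum>k<Suc m. if k = i then t k else 0) + (\<Sum>k<Suc m. if k = j then - t k else 0)"
      unfolding sum.distrib[symmetric] by (intro sum.cong refl) (auto simp: ij)
    also have "\<dots> = 0" using ij by (simp add: sum.delta del: sum.lessThan_Suc)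
    finally show ?thesis
      using ij by (intro that[of "\<lambda>k. (if k = i then 1 else 0) + (if k = j then -1 else 0)"]) auto
  qed
  define p where "p = (\<Sum>i\<le>m. monom (c i) i)"
  have cp: "coeff p i = (if i \<le> m then c i else 0)" for i
    unfolding p_def by (simp add: coeff_sum sum.delta)
  have "p \<noteq> 0" using c(1) cp by (metis coeff_0)
  moreover have "degree p \<le> m" by (auto intro!: degree_le simp: cp)
  moreover have "(\<Sum>i<Suc m. vf_scale (coeff p i) ((T ^^ i) v)) = 0"
    using c(2) unfolding t_def cp by (simp add: lessThan_Suc_atMost del: sum.lessThan_Suc)
  ultimately show ?thesis using eigenvector_of_annihilator[OF K T v, of p m] by blast
qed

text \<open>Rank and nullity: w extends to a basis of K, and the images of the other basis vectors
  span the image. The bound is on the size of a spanning set, the quantity on which the later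
  induction runs.\<close>

lemma kernel_reduces:
  assumes K: "VF.subspace K" and T: "linear_on_sub K T"
    and C: "finite C" "K \<subseteq> VF.span C" and w: "w \<in> K" "w \<noteq> 0" "T w = 0"
  shows "\<exists>C'. finite C' \<and> card C' < card C \<and> T ` K \<subseteq> VF.span C'"
proof -
  obtain B where B: "{w} \<subseteq> B" "B \<subseteq> K" "VF.independent B" "K \<subseteq> VF.span B"
    using w by (metis VF.maximal_independent_subset_extend VF.independent_insert VF.independent_empty
      VF.span_empty singletonD insert_subset empty_subsetI)
  have fB: "finite B" "card B \<le> card C"
    using VF.independent_span_bound[OF C(1) B(3)] B(2) C(2) by auto
  define C' where "C' = T ` (B - {w})"
  have "VF.subspace {v \<in> K. T v \<in> VF.span C'}"
    using K T linear_on_sub_0[OF T K] unfolding linear_on_sub_def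
    by (intro VF.subspaceI) (auto simp: VF.subspace_0 VF.subspace_add VF.subspace_scale
      VF.span_zero intro: VF.span_add VF.span_scale)
  moreover have "T v \<in> VF.span C'" if "v \<in> B" for v
    using w(3) that by (cases "v = w") (auto simp only: C'_def intro: VF.span_base VF.span_zero)
  then have "B \<subseteq> {v \<in> K. T v \<in> VF.span C'}" using B(2) by blast
  ultimately have "VF.span B \<subseteq> {v \<in> K. T v \<in> VF.span C'}" by (rule VF.span_minimal[rotated])
  then have "T ` K \<subseteq> VF.span C'" using B(4) by blast
  moreover have "card C' < card C"
    using card_image_le[of "B - {w}" T] fB B(1) card_Diff1_less[of B w] unfolding C'_def by auto
  moreover have "finite C'" using fB by (simp add: C'_def)
  ultimately show ?thesis by (intro exI[of _ C'] conjI)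
qed

section \<open>Exponential polynomials\<close>

definition exp_poly :: "complex set \<Rightarrow> (complex \<Rightarrow> complex poly) \<Rightarrow> complex \<Rightarrow> complex"
  where "exp_poly S P = (\<lambda>y. \<Sum>\<mu>\<in>S. exp (\<mu> * y) * poly (P \<mu>) y)"

definition deg_bounded :: "complex set \<Rightarrow> (complex \<Rightarrow> nat) \<Rightarrow> (complex \<Rightarrow> complex poly) set"
  where "deg_bounded S n = {P. \<forall>\<mu>\<in>S. P \<mu> = 0 \<or> degree (P \<mu>) < n \<mu>}"

text \<open>The operator exp(-c y) D exp(c y) on polynomials: it describes how D acts on exp(c y)
  p(y). Passing from D to D - c shifts the index by -c.\<close>

definition twisted_deriv :: "complex \<Rightarrow> complex poly \<Rightarrow> complex poly"
  where "twisted_deriv c p = pderiv p + smult c p"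

lemma deg_bound_add:
  "p = 0 \<or> degree p < n \<Longrightarrow> q = 0 \<or> degree q < n \<Longrightarrow> p + q = 0 \<or> degree (p + q) < n"
  by (cases "p = 0"; cases "q = 0") (auto intro: degree_add_less)

lemma exp_poly_add: "exp_poly S (\<lambda>\<mu>. P \<mu> + Q \<mu>) y = exp_poly S P y + exp_poly S Q y"
  by (simp add: exp_poly_def algebra_simps sum.distrib)

lemma exp_poly_smult: "exp_poly S (\<lambda>\<mu>. smult c (P \<mu>)) y = c * exp_poly S P y"
  by (simp add: exp_poly_def algebra_simps sum_distrib_left)

lemma exp_poly_diff: "exp_poly S (\<lambda>\<mu>. P \<mu> - Q \<mu>) y = exp_poly S P y - exp_poly S Q y"
  by (simp add: exp_poly_def algebra_simps sum_subtractf)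

lemma exp_poly_cong: "(\<And>\<mu>. \<mu> \<in> S \<Longrightarrow> P \<mu> = Q \<mu>) \<Longrightarrow> exp_poly S P = exp_poly S Q"
  by (simp add: exp_poly_def)

lemma exp_poly_mono_neutral:
  "finite S' \<Longrightarrow> S \<subseteq> S' \<Longrightarrow> (\<And>\<mu>. \<mu> \<in> S' - S \<Longrightarrow> P \<mu> = 0) \<Longrightarrow> exp_poly S' P = exp_poly S P"
  unfolding exp_poly_def by (intro ext sum.mono_neutral_right) auto

lemma exp_poly_has_deriv:
  "(exp_poly S P has_field_derivative exp_poly S (\<lambda>\<mu>. twisted_deriv \<mu> (P \<mu>)) y) (at y)"
  unfolding exp_poly_def twisted_deriv_def
  by (rule DERIV_cong, rule DERIV_sum, rule derivative_intros)
     (auto intro!: derivative_eq_intros poly_DERIV simp: algebra_simps)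

lemma exp_poly_deriv: "deriv (exp_poly S P) y = exp_poly S (\<lambda>\<mu>. twisted_deriv \<mu> (P \<mu>)) y"
  by (rule DERIV_imp_deriv[OF exp_poly_has_deriv])

lemma exp_poly_holomorphic: "exp_poly S P holomorphic_on A"
proof -
  have "exp_poly S P field_differentiable at y within A" for y
    using has_field_derivative_at_within[OF exp_poly_has_deriv] unfolding field_differentiable_def ..
  then show ?thesis by (simp add: holomorphic_on_def)
qed

lemma twisted_deriv_shift:
  "twisted_deriv \<mu> p - smult c p = twisted_deriv (\<mu> - c) p"
  by (simp add: twisted_deriv_def smult_diff_left)

lemma exp_poly_deriv_shift:
  "deriv (exp_poly S P) y - c * exp_poly S P y = exp_poly S (\<lambda>\<mu>. twisted_deriv (\<mu> - c) (P \<mu>)) y"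
  by (simp add: exp_poly_deriv exp_poly_smult[symmetric] exp_poly_diff[symmetric] twisted_deriv_shift)

lemma degree_twisted_deriv_le: "degree (twisted_deriv c p) \<le> degree p"
  unfolding twisted_deriv_def
  by (intro degree_add_le) (auto simp: degree_pderiv)

text \<open>At the degree of p only the term c p contributes, so the leading coefficient is
  multiplied by c.\<close>

lemma twisted_deriv_eq_0_iff: "c \<noteq> 0 \<Longrightarrow> twisted_deriv c p = 0 \<longleftrightarrow> p = 0"
proof
  assume c: "c \<noteq> 0" and 0: "twisted_deriv c p = 0"
  have "coeff (twisted_deriv c p) (degree p) = c * lead_coeff p"
    by (simp add: twisted_deriv_def coeff_pderiv coeff_eq_0)
  with 0 c show "p = 0" by simp
qed (simp add: twisted_deriv_def)

lemma twisted_deriv_power_eq_0_iff: "c \<noteq> 0 \<Longrightarrow> (twisted_deriv c ^^ k) p = 0 \<longleftrightarrow> p = 0"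
  by (induction k) (auto simp: twisted_deriv_eq_0_iff)

lemma twisted_deriv_0_power: "degree p < k \<or> p = 0 \<Longrightarrow> (twisted_deriv 0 ^^ k) p = 0"
proof (induction k arbitrary: p)
  case (Suc k)
  have "degree (twisted_deriv 0 p) < k \<or> twisted_deriv 0 p = 0"
    using Suc.prems by (cases "degree p") (auto simp: twisted_deriv_def degree_pderiv pderiv_eq_0_iff)
  from Suc.IH[OF this] show ?case by (simp add: funpow_swap1)
qed auto

text \<open>p / c solves the equation up to the error p' / c of smaller degree, which the induction
  removes.\<close>

lemma twisted_deriv_surj:
  assumes "c \<noteq> 0"
  shows "p = 0 \<or> degree p < n \<Longrightarrow> \<exists>q. twisted_deriv c q = p \<and> (q = 0 \<or> degree q < n)"
proof (induction n arbitrary: p)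
  case 0
  then show ?case by (auto intro!: exI[of _ 0] simp: twisted_deriv_def)
next
  case (Suc n)
  let ?r = "smult (- 1 / c) (pderiv p)"
  have "?r = 0 \<or> degree ?r < n"
    using Suc.prems by (cases "degree p") (auto simp: degree_pderiv pderiv_eq_0_iff)
  then obtain q where q: "twisted_deriv c q = ?r" "q = 0 \<or> degree q < n" using Suc.IH by blast
  have "twisted_deriv c (q + smult (1 / c) p) = twisted_deriv c q + twisted_deriv c (smult (1 / c) p)"
    by (simp add: twisted_deriv_def pderiv_add smult_add_right)
  also have "\<dots> = p"
    unfolding q(1) using assms by (simp add: twisted_deriv_def pderiv_smult)
  finally have "twisted_deriv c (q + smult (1 / c) p) = p" .
  moreover have "degree (q + smult (1 / c) p) < Suc n"
    using q(2) Suc.prems by (intro degree_add_less) auto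
  ultimately show ?case by blast
qed

text \<open>At resonance the solution is an antiderivative, which costs one degree; the successor in
  the later bounds at the frequency c comes from here.\<close>

lemma twisted_deriv_0_surj: "\<exists>q. twisted_deriv 0 q = (p :: complex poly) \<and> degree q \<le> degree p + 1"
proof -
  define q where "q = (\<Sum>i\<le>degree p. monom (coeff p i / of_nat (Suc i)) (Suc i))"
  have c: "coeff q k = (case k of 0 \<Rightarrow> 0 | Suc i \<Rightarrow> coeff p i / of_nat (Suc i))" for k
    unfolding q_def by (cases k) (auto simp: coeff_sum sum.delta coeff_eq_0)
  have "twisted_deriv 0 q = p"
    by (rule poly_eqI) (simp add: twisted_deriv_def coeff_pderiv c del: of_nat_Suc)
  moreover have "degree q \<le> degree p + 1"
    by (rule degree_le) (auto simp: c coeff_eq_0 split: nat.splits)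
  ultimately show ?thesis by blast
qed

text \<open>Applying D - nu often enough kills the summand of frequency nu and is injective on all
  others, so these vanish by induction; then the remaining polynomial vanishes identically.\<close>

lemma exp_poly_eq_0D:
  assumes "finite S"
  shows "(\<And>y. exp_poly S P y = 0) \<Longrightarrow> \<mu> \<in> S \<Longrightarrow> P \<mu> = 0"
  using assms
proof (induction S arbitrary: P \<mu> rule: finite_induct)
  case (insert \<nu> S)
  define E where "E Q y = exp_poly (insert \<nu> S) Q y" for Q y
  have E0: "E (\<lambda>\<mu>. (twisted_deriv (\<mu> - \<nu>) ^^ k) (P \<mu>)) y = 0" for k y
  proof (induction k arbitrary: y)
    case 0
    then show ?case using insert.prems by (simp add: E_def)
  next
    case (Suc k)
    have z: "exp_poly (insert \<nu> S) (\<lambda>\<mu>. (twisted_deriv (\<mu> - \<nu>) ^^ k) (P \<mu>)) = (\<lambda>_. 0)"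
      using Suc unfolding E_def by blast
    show ?case
      using exp_poly_deriv_shift[of "insert \<nu> S" "\<lambda>\<mu>. (twisted_deriv (\<mu> - \<nu>) ^^ k) (P \<mu>)" y \<nu>]
      unfolding z by (simp add: E_def)
  qed
  \<comment> \<open>One more than the degree, so that the k-th derivative of \<open>P \<nu>\<close>
    is zero.\<close>
  define k where "k = Suc (degree (P \<nu>))"
  have "(twisted_deriv (\<nu> - \<nu>) ^^ k) (P \<nu>) = 0"
    using twisted_deriv_0_power[of "P \<nu>" k] by (simp add: k_def)
  then have "exp_poly S (\<lambda>\<mu>. (twisted_deriv (\<mu> - \<nu>) ^^ k) (P \<mu>)) y = 0" for y
    using E0[of k y] insert.hyps unfolding E_def exp_poly_def by simp
  from insert.IH[OF this] have S0: "P \<mu> = 0" if "\<mu> \<in> S" for \<mu>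
    using that insert.hyps twisted_deriv_power_eq_0_iff[of "\<mu> - \<nu>"] by (metis eq_iff_diff_eq_0)
  have "exp (\<nu> * y) * poly (P \<nu>) y = 0" for y
    using insert.prems(1)[of y] insert.hyps S0 unfolding exp_poly_def by (simp add: sum.neutral)
  then have "\<forall>y. poly (P \<nu>) y = 0" by simp
  then have "P \<nu> = 0" using poly_all_0_iff_0 by blast
  with S0 insert.prems show ?case by blast
qed auto

lemma sum_fun_dx: "(\<Sum>i\<in>I. fun_dx (f i)) = fun_dx (\<lambda>y. \<Sum>i\<in>I. f i y)"
  by (induction I rule: infinite_finite_induct) (auto simp: fun_dx_def fun_eq_iff zero_prod_def)

text \<open>For n mu > 0 the zero polynomial, of degree 0, meets the bound in \<open>V\<close>, so
  both degree conditions agree.\<close>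

lemma sum_V_eq:
  assumes "finite S" "\<And>\<mu>. \<mu> \<in> S \<Longrightarrow> n \<mu> > 0"
  shows "sum_V S n = {fun_dx (exp_poly S P) | P. P \<in> deg_bounded S n}"
proof (intro equalityI subsetI)
  fix X assume "X \<in> sum_V S n"
  then obtain v where v: "X = (\<Sum>\<mu>\<in>S. v \<mu>)" "\<forall>\<mu>\<in>S. v \<mu> \<in> V \<mu> (n \<mu>)" unfolding sum_V_def by blast
  then have "\<forall>\<mu>\<in>S. \<exists>p. v \<mu> = fun_dx (\<lambda>y. exp (\<mu> * y) * poly p y) \<and> degree p < n \<mu>"
    unfolding V_def by blast
  then obtain P where P: "\<forall>\<mu>\<in>S. v \<mu> = fun_dx (\<lambda>y. exp (\<mu> * y) * poly (P \<mu>) y) \<and> degree (P \<mu>) < n \<mu>"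
    by metis
  then have "X = fun_dx (exp_poly S P)"
    unfolding v(1) exp_poly_def sum_fun_dx[symmetric] by (intro sum.cong) auto
  moreover have "P \<in> deg_bounded S n" using P by (simp add: deg_bounded_def)
  ultimately show "X \<in> {fun_dx (exp_poly S P) | P. P \<in> deg_bounded S n}" by (intro CollectI exI conjI)
next
  fix X assume "X \<in> {fun_dx (exp_poly S P) | P. P \<in> deg_bounded S n}"
  then obtain P where P: "X = fun_dx (exp_poly S P)" "P \<in> deg_bounded S n" by blast
  have "degree (P \<mu>) < n \<mu>" if "\<mu> \<in> S" for \<mu>
    using P(2) that assms(2)[OF that] unfolding deg_bounded_def by auto
  then have "\<forall>\<mu>\<in>S. fun_dx (\<lambda>y. exp (\<mu> * y) * poly (P \<mu>) y) \<in> V \<mu> (n \<mu>)"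
    unfolding V_def by blast
  moreover have "X = (\<Sum>\<mu>\<in>S. fun_dx (\<lambda>y. exp (\<mu> * y) * poly (P \<mu>) y))"
    unfolding P(1) exp_poly_def sum_fun_dx ..
  ultimately show "X \<in> sum_V S n" unfolding sum_V_def by blast
qed

text \<open>Frequencies with bound 0 contribute nothing and are dropped, because the normal forms
  ask for n mu > 0 on all of S.\<close>

lemma deg_bounded_support:
  assumes "finite S"
  shows "{fun_dx (exp_poly S P) | P. P \<in> deg_bounded S n} = sum_V {\<mu>\<in>S. n \<mu> > 0} n"
proof -
  have *: "P \<mu> = 0" if "P \<in> deg_bounded S n" "\<mu> \<in> S - {\<mu>\<in>S. n \<mu> > 0}" for P \<mu>
    using that unfolding deg_bounded_def by auto
  have 1: "exp_poly S P = exp_poly {\<mu>\<in>S. n \<mu> > 0} P" if "P \<in> deg_bounded S n" for P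
    using *[OF that] assms by (intro exp_poly_mono_neutral) auto
  have 2: "P \<in> deg_bounded {\<mu>\<in>S. n \<mu> > 0} n" if "P \<in> deg_bounded S n" for P
    using that unfolding deg_bounded_def by auto
  have 3: "\<exists>Q. Q \<in> deg_bounded S n \<and> exp_poly {\<mu>\<in>S. n \<mu> > 0} P = exp_poly {\<mu>\<in>S. n \<mu> > 0} Q"
    if "P \<in> deg_bounded {\<mu>\<in>S. n \<mu> > 0} n" for P
    using that unfolding deg_bounded_def
    by (intro exI[of _ "\<lambda>\<mu>. if n \<mu> > 0 then P \<mu> else 0"] conjI exp_poly_cong) auto
  have "{fun_dx (exp_poly S P) | P. P \<in> deg_bounded S n} =
    {fun_dx (exp_poly {\<mu>\<in>S. n \<mu> > 0} P) | P. P \<in> deg_bounded {\<mu>\<in>S. n \<mu> > 0} n}"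
  proof (intro equalityI subsetI)
    fix X assume "X \<in> {fun_dx (exp_poly S P) | P. P \<in> deg_bounded S n}"
    then show "X \<in> {fun_dx (exp_poly {\<mu>\<in>S. n \<mu> > 0} P) | P. P \<in> deg_bounded {\<mu>\<in>S. n \<mu> > 0} n}"
      using 1 2 by auto
  next
    fix X assume "X \<in> {fun_dx (exp_poly {\<mu>\<in>S. n \<mu> > 0} P) | P. P \<in> deg_bounded {\<mu>\<in>S. n \<mu> > 0} n}"
    then obtain P where P: "X = fun_dx (exp_poly {\<mu>\<in>S. n \<mu> > 0} P)" "P \<in> deg_bounded {\<mu>\<in>S. n \<mu> > 0} n"
      by blast
    obtain Q where Q: "Q \<in> deg_bounded S n" "exp_poly {\<mu>\<in>S. n \<mu> > 0} P = exp_poly {\<mu>\<in>S. n \<mu> > 0} Q"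
      using 3[OF P(2)] by blast
    have "X = fun_dx (exp_poly S Q)" unfolding P(1) Q(2) 1[OF Q(1)] ..
    with Q(1) show "X \<in> {fun_dx (exp_poly S P) | P. P \<in> deg_bounded S n}" by blast
  qed
  then show ?thesis using assms by (subst sum_V_eq) auto
qed

lemma deg_bounded_subspace: "VF.subspace {fun_dx (exp_poly S P) | P. P \<in> deg_bounded S n}"
proof (rule VF.subspaceI)
  have "fun_dx (exp_poly S (\<lambda>_. 0)) = 0"
    by (simp add: exp_poly_def fun_dx_def fun_eq_iff zero_prod_def)
  moreover have "(\<lambda>_. 0) \<in> deg_bounded S n" unfolding deg_bounded_def by simp
  ultimately show "0 \<in> {fun_dx (exp_poly S P) | P. P \<in> deg_bounded S n}" by (metis (mono_tags, lifting) mem_Collect_eq)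
next
  fix X Y assume "X \<in> {fun_dx (exp_poly S P) | P. P \<in> deg_bounded S n}" "Y \<in> {fun_dx (exp_poly S P) | P. P \<in> deg_bounded S n}"
  then obtain P Q where "X = fun_dx (exp_poly S P)" "P \<in> deg_bounded S n" "Y = fun_dx (exp_poly S Q)" "Q \<in> deg_bounded S n"
    by blast
  moreover from this have "(\<lambda>\<mu>. P \<mu> + Q \<mu>) \<in> deg_bounded S n"
    unfolding deg_bounded_def by (intro CollectI ballI deg_bound_add) auto
  moreover have "fun_dx (exp_poly S P) + fun_dx (exp_poly S Q) = fun_dx (exp_poly S (\<lambda>\<mu>. P \<mu> + Q \<mu>))"
    by (simp add: fun_dx_def fun_eq_iff exp_poly_add)
  ultimately show "X + Y \<in> {fun_dx (exp_poly S P) | P. P \<in> deg_bounded S n}" by auto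
next
  fix c X assume "X \<in> {fun_dx (exp_poly S P) | P. P \<in> deg_bounded S n}"
  then obtain P where "X = fun_dx (exp_poly S P)" "P \<in> deg_bounded S n" by blast
  moreover from this have "(\<lambda>\<mu>. smult c (P \<mu>)) \<in> deg_bounded S n"
    unfolding deg_bounded_def by (auto simp: degree_smult_eq)
  moreover have "vf_scale c (fun_dx (exp_poly S P)) = fun_dx (exp_poly S (\<lambda>\<mu>. smult c (P \<mu>)))"
    by (simp add: fun_dx_def fun_eq_iff exp_poly_smult vf_scale_def pt_scale_def)
  ultimately show "vf_scale c X \<in> {fun_dx (exp_poly S P) | P. P \<in> deg_bounded S n}" by auto
qed

lemma sum_V_subspace: "finite S \<Longrightarrow> \<forall>\<mu>\<in>S. n \<mu> > 0 \<Longrightarrow> VF.subspace (sum_V S n)"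
  using deg_bounded_subspace by (simp add: sum_V_eq)

section \<open>Spaces of functions invariant under differentiation\<close>

text \<open>A function on B as a zero-extended field, so that the linear algebra of
  \<open>VF\<close> applies to functions known only on B.\<close>

definition dx_on :: "C2 set \<Rightarrow> (complex \<Rightarrow> complex) \<Rightarrow> vfield"
  where "dx_on U f = vf_restrict U (fun_dx f)"

lemma dx_on_apply: "dx_on U f p = (if p \<in> U then (f (snd p), 0) else 0)"
  by (simp add: dx_on_def vf_restrict_def fun_dx_def case_prod_beta)

lemma dx_on_eq_iff: "a \<in> A \<Longrightarrow> dx_on (A \<times> B) f = dx_on (A \<times> B) g \<longleftrightarrow> (\<forall>y\<in>B. f y = g y)"
  by (auto simp: dx_on_apply fun_eq_iff)

lemma dx_on_cong: "(\<And>y. y \<in> B \<Longrightarrow> f y = g y) \<Longrightarrow> dx_on (A \<times> B) f = dx_on (A \<times> B) g"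
  by (auto simp: dx_on_apply fun_eq_iff)

lemma dx_on_add: "dx_on U f + dx_on U g = dx_on U (\<lambda>y. f y + g y)"
  and dx_on_diff: "dx_on U f - dx_on U g = dx_on U (\<lambda>y. f y - g y)"
  and dx_on_scale: "vf_scale c (dx_on U f) = dx_on U (\<lambda>y. c * f y)"
  and dx_on_0: "dx_on U (\<lambda>_. 0) = 0"
  by (auto simp: dx_on_apply fun_eq_iff vf_scale_def pt_scale_def zero_prod_def)

text \<open>The product u exp(-c y) has zero derivative on a convex set.\<close>

lemma exponential_ode:
  assumes B: "open B" "convex B" and u: "u holomorphic_on B"
    and ode: "\<And>y. y \<in> B \<Longrightarrow> deriv u y = c * u y"
  shows "\<exists>k. \<forall>y\<in>B. u y = k * exp (c * y)"
proof -
  have "((\<lambda>y. u y * exp (- c * y)) has_field_derivative 0) (at y within B)" if y: "y \<in> B" for y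
  proof -
    have "(u has_field_derivative c * u y) (at y within B)"
      using holomorphic_derivI[OF u B(1) y] ode[OF y] has_field_derivative_at_within by metis
    then show ?thesis by (auto intro!: derivative_eq_intros)
  qed
  from has_field_derivative_zero_constant[OF B(2) this]
  obtain k where k: "\<And>y. y \<in> B \<Longrightarrow> u y * exp (- c * y) = k" by blast
  have "u y = k * exp (c * y)" if "y \<in> B" for y
    using k[OF that] by (simp add: exp_minus field_simps)
  then show ?thesis by blast
qed

text \<open>D - c as an operator on fields; the coefficient is read off along x = a because the
  fields in question do not depend on x.\<close>

definition shifted_deriv :: "complex \<Rightarrow> complex set \<Rightarrow> complex set \<Rightarrow> complex \<Rightarrow> vfield \<Rightarrow> vfield"
  where "shifted_deriv a A B c X =
    dx_on (A \<times> B) (\<lambda>y. deriv (\<lambda>y. fst (X (a, y))) y - c * fst (X (a, y)))"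

lemma shifted_deriv_dx_on:
  assumes "a \<in> A" "open B"
  shows "shifted_deriv a A B c (dx_on (A \<times> B) f) = dx_on (A \<times> B) (\<lambda>y. deriv f y - c * f y)"
  unfolding shifted_deriv_def
proof (rule dx_on_cong)
  fix y assume y: "y \<in> B"
  have "eventually (\<lambda>y. fst (dx_on (A \<times> B) f (a, y)) = f y) (nhds y)"
    using eventually_nhds_in_open[OF assms(2) y] by eventually_elim (simp add: dx_on_apply assms)
  then show "deriv (\<lambda>y. fst (dx_on (A \<times> B) f (a, y))) y - c * fst (dx_on (A \<times> B) f (a, y)) = deriv f y - c * f y"
    using y assms(1) by (simp add: deriv_cong_ev[OF _ refl] dx_on_apply)
qed

lemma linear_on_sub_shifted_deriv:
  assumes a: "a \<in> A" and B: "open B"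
    and shape: "\<And>Y. Y \<in> K \<Longrightarrow> \<exists>f. f holomorphic_on B \<and> Y = dx_on (A \<times> B) f"
  shows "linear_on_sub K (shifted_deriv a A B c)"
  unfolding linear_on_sub_def
proof (intro conjI ballI allI)
  fix X Y assume "X \<in> K" "Y \<in> K"
  then obtain f g where fg: "f holomorphic_on B" "X = dx_on (A \<times> B) f" "g holomorphic_on B" "Y = dx_on (A \<times> B) g"
    using shape by meson
  have "deriv (\<lambda>y. f y + g y) y = deriv f y + deriv g y" if "y \<in> B" for y
    using fg B that by (intro deriv_add) (auto intro: holomorphic_on_imp_differentiable_at)
  then show "shifted_deriv a A B c (X + Y) = shifted_deriv a A B c X + shifted_deriv a A B c Y"
    unfolding fg dx_on_add shifted_deriv_dx_on[OF a B] by (intro dx_on_cong) (simp add: algebra_simps)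
next
  fix k X assume "X \<in> K"
  then obtain f where fg: "f holomorphic_on B" "X = dx_on (A \<times> B) f" using shape by meson
  have "deriv (\<lambda>y. k * f y) y = k * deriv f y" if "y \<in> B" for y
    using fg B that by (intro deriv_cmult) (auto intro: holomorphic_on_imp_differentiable_at)
  then show "shifted_deriv a A B c (vf_scale k X) = vf_scale k (shifted_deriv a A B c X)"
    unfolding fg dx_on_scale shifted_deriv_dx_on[OF a B] by (intro dx_on_cong) (simp add: algebra_simps)
qed

lemma linear_on_sub_image:
  assumes "VF.subspace K" "linear_on_sub K T"
  shows "VF.subspace (T ` K)"
proof (rule VF.subspaceI)
  show "0 \<in> T ` K" using linear_on_sub_0[OF assms(2,1)] VF.subspace_0[OF assms(1)] by (metis imageI)
next
  fix X Y assume "X \<in> T ` K" "Y \<in> T ` K"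
  then obtain x y where "X = T x" "Y = T y" "x \<in> K" "y \<in> K" by blast
  then show "X + Y \<in> T ` K"
    using assms unfolding linear_on_sub_def by (metis VF.subspace_add imageI)
next
  fix c X assume "X \<in> T ` K"
  then obtain x where "X = T x" "x \<in> K" by blast
  then show "vf_scale c X \<in> T ` K"
    using assms unfolding linear_on_sub_def by (metis VF.subspace_scale imageI)
qed

text \<open>The equation decouples into one equation per frequency. Only mu = c is resonant and may
  cost one more degree; \<open>n c\<close> is arbitrary for c outside S, hence the inner
  \<open>if\<close>.\<close>

lemma solve_shifted:
  assumes S: "finite S" and P: "P \<in> deg_bounded S n"
    and n': "n' = (\<lambda>\<mu>. if \<mu> = c then Suc (if c \<in> S then n c else 0) else n \<mu>)"
  obtains Q where "Q \<in> deg_bounded (insert c S) n'"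
    "\<And>y. deriv (exp_poly (insert c S) Q) y - c * exp_poly (insert c S) Q y = exp_poly S P y"
proof -
  have "\<exists>q. twisted_deriv (\<mu> - c) q = (if \<mu> \<in> S then P \<mu> else 0) \<and> (q = 0 \<or> degree q < n' \<mu>)" if "\<mu> \<in> insert c S" for \<mu>
  proof (cases "\<mu> = c")
    case True
    show ?thesis
    proof (cases "\<mu> \<in> S \<and> P \<mu> \<noteq> 0")
      case True
      then have "degree (P \<mu>) < n \<mu>" using P unfolding deg_bounded_def by auto
      then show ?thesis
        using twisted_deriv_0_surj[of "P \<mu>"] \<open>\<mu> = c\<close> True unfolding n' by force
    next
      case False
      then show ?thesis by (intro exI[of _ 0]) (auto simp: twisted_deriv_def)
    qed
  next
    case False
    with that P have "P \<mu> = 0 \<or> degree (P \<mu>) < n \<mu>" "\<mu> \<in> S" unfolding deg_bounded_def by auto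
    then show ?thesis
      using twisted_deriv_surj[of "\<mu> - c" "P \<mu>" "n \<mu>"] False unfolding n' by auto
  qed
  then obtain Q where Q: "\<And>\<mu>. \<mu> \<in> insert c S \<Longrightarrow>
      twisted_deriv (\<mu> - c) (Q \<mu>) = (if \<mu> \<in> S then P \<mu> else 0) \<and> (Q \<mu> = 0 \<or> degree (Q \<mu>) < n' \<mu>)"
    by metis
  have "exp_poly (insert c S) (\<lambda>\<mu>. twisted_deriv (\<mu> - c) (Q \<mu>)) =
      exp_poly (insert c S) (\<lambda>\<mu>. if \<mu> \<in> S then P \<mu> else 0)"
    using Q by (intro exp_poly_cong) auto
  also have "\<dots> = exp_poly S (\<lambda>\<mu>. if \<mu> \<in> S then P \<mu> else 0)"
    using S by (intro exp_poly_mono_neutral) auto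
  also have "\<dots> = exp_poly S P" by (intro exp_poly_cong) auto
  finally show ?thesis
    using Q by (intro that[of Q]) (auto simp: deg_bounded_def exp_poly_deriv_shift)
qed

text \<open>Converse of \<open>solve_shifted\<close>. If c is not in S, the bound at c is 1, so that
  summand is a constant multiple of exp(c y) and is killed.\<close>

lemma shifted_deg_bounded:
  assumes P: "P \<in> deg_bounded (insert c S) n'"
    and n': "n' = (\<lambda>\<mu>. if \<mu> = c then Suc (if c \<in> S then n c else 0) else n \<mu>)" and S: "finite S"
  shows "(\<lambda>\<mu>. twisted_deriv (\<mu> - c) (P \<mu>)) \<in> deg_bounded S n"
    and "deriv (exp_poly (insert c S) P) y - c * exp_poly (insert c S) P y =
      exp_poly S (\<lambda>\<mu>. twisted_deriv (\<mu> - c) (P \<mu>)) y"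
proof -
  have b: "twisted_deriv (c - c) (P c) = 0 \<or> degree (twisted_deriv (c - c) (P c)) < (if c \<in> S then n c else 0)"
    using P unfolding deg_bounded_def n'
    by (cases "degree (P c)") (auto simp: twisted_deriv_def degree_pderiv pderiv_eq_0_iff split: if_splits)
  show "(\<lambda>\<mu>. twisted_deriv (\<mu> - c) (P \<mu>)) \<in> deg_bounded S n"
    unfolding deg_bounded_def
  proof (intro CollectI ballI)
    fix \<mu> assume \<mu>: "\<mu> \<in> S"
    show "twisted_deriv (\<mu> - c) (P \<mu>) = 0 \<or> degree (twisted_deriv (\<mu> - c) (P \<mu>)) < n \<mu>"
    proof (cases "\<mu> = c")
      case True
      then show ?thesis using b \<mu> by auto
    next
      case False
      then have "P \<mu> = 0 \<or> degree (P \<mu>) < n \<mu>" using P \<mu> unfolding deg_bounded_def n' by auto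
      then show ?thesis using degree_twisted_deriv_le[of "\<mu> - c" "P \<mu>"]
        by (auto simp: twisted_deriv_def[of _ 0] simp del: not_less)
    qed
  qed
  have "exp_poly (insert c S) (\<lambda>\<mu>. twisted_deriv (\<mu> - c) (P \<mu>)) = exp_poly S (\<lambda>\<mu>. twisted_deriv (\<mu> - c) (P \<mu>))"
    using S b by (intro exp_poly_mono_neutral) auto
  then show "deriv (exp_poly (insert c S) P) y - c * exp_poly (insert c S) P y =
      exp_poly S (\<lambda>\<mu>. twisted_deriv (\<mu> - c) (P \<mu>)) y"
    by (simp add: exp_poly_deriv_shift)
qed

text \<open>An eigenvector of D in K is a multiple of exp(c y), so K contains the whole kernel of D
  - c. Hence K contains every solution of f' - c f = k with k in the image K1 = (D - c) K, since it
  contains one of them. The induction is on the size of a spanning set.\<close>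

lemma deriv_invariant_structure:
  assumes a: "a \<in> A" and B: "open B" "convex B"
  shows "VF.subspace K \<Longrightarrow> finite C \<Longrightarrow> K \<subseteq> VF.span C \<Longrightarrow>
    (\<And>Y. Y \<in> K \<Longrightarrow> \<exists>f. f holomorphic_on B \<and> Y = dx_on (A \<times> B) f) \<Longrightarrow>
    (\<And>f. f holomorphic_on B \<Longrightarrow> dx_on (A \<times> B) f \<in> K \<Longrightarrow> dx_on (A \<times> B) (deriv f) \<in> K) \<Longrightarrow>
    \<exists>S n. finite S \<and> K = {dx_on (A \<times> B) (exp_poly S P) | P. P \<in> deg_bounded S n}"
proof (induction "card C" arbitrary: K C rule: less_induct)
  case less
  note K = less.prems(1) and C = less.prems(2,3) and shape = less.prems(4) and D = less.prems(5)
  let ?R = "dx_on (A \<times> B)"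
  show ?case
  proof (cases "K = {0}")
    case True
    have "?R (exp_poly {} P) = 0" for P by (simp add: exp_poly_def dx_on_0)
    then show ?thesis unfolding True by (intro exI[of _ "{}"]) (auto simp: deg_bounded_def)
  next
    case False
    let ?T = "shifted_deriv a A B"
    note T = shifted_deriv_dx_on[OF a B(1)]
    have lin: "linear_on_sub K (?T c)" for c
      by (rule linear_on_sub_shifted_deriv[OF a B(1)]) (rule shape)
    have TK: "?T c X \<in> K" if X: "X \<in> K" for c X
    proof -
      obtain f where f: "f holomorphic_on B" "X = ?R f" using shape[OF X] by blast
      have "?T c X = ?R (deriv f) - vf_scale c X"
        unfolding f T by (simp add: dx_on_scale dx_on_diff)
      then show ?thesis using D f X K by (simp add: VF.subspace_diff VF.subspace_scale)
    qed
    obtain c w where w: "w \<in> K" "w \<noteq> 0" "?T 0 w = vf_scale c w"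
      using eigenvector_exists[OF K lin[of 0] TK C False] by blast
    obtain e where e: "e holomorphic_on B" "w = ?R e" using shape[OF w(1)] by blast
    have de: "deriv e y = c * e y" if "y \<in> B" for y
      using w(3) that unfolding e T dx_on_scale dx_on_eq_iff[OF a] by simp
    obtain k where k: "\<forall>y\<in>B. e y = k * exp (c * y)"
      using exponential_ode[OF B e(1) de] by blast
    have "k \<noteq> 0"
    proof
      assume "k = 0"
      then have "w = ?R (\<lambda>_. 0)" unfolding e using k by (intro dx_on_cong) auto
      with w(2) show False by (simp add: dx_on_0)
    qed
    \<comment> \<open>The whole kernel of D - c lies in K.\<close>
    have expK: "?R (\<lambda>y. m * exp (c * y)) \<in> K" for m
    proof -
      have "?R (\<lambda>y. m * exp (c * y)) = vf_scale (m / k) w"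
        unfolding e dx_on_scale using k \<open>k \<noteq> 0\<close> by (intro dx_on_cong) simp
      then show ?thesis using w(1) K by (simp add: VF.subspace_scale)
    qed
    define K1 where "K1 = ?T c ` K"
    have "?T c w = ?R (\<lambda>_. 0)" unfolding e T by (intro dx_on_cong) (simp add: de)
    then obtain C' where C': "finite C'" "card C' < card C" "K1 \<subseteq> VF.span C'"
      using kernel_reduces[OF K lin C w(1,2)] unfolding K1_def dx_on_0 by blast
    have "VF.subspace K1" unfolding K1_def by (rule linear_on_sub_image[OF K lin])
    moreover have K1: "K1 \<subseteq> K" unfolding K1_def using TK by blast
    \<comment> \<open>The image is again invariant, since D commutes with D - c.\<close>
    moreover have "?R (deriv g) \<in> K1" if g: "g holomorphic_on B" "?R g \<in> K1" for g
    proof -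
      obtain f where f: "f holomorphic_on B" "?R f \<in> K" "?R g = ?T c (?R f)"
        using g(2) shape unfolding K1_def by blast
      have gf: "g y = deriv f y - c * f y" if "y \<in> B" for y
        using f(3) that unfolding T dx_on_eq_iff[OF a] by blast
      have "deriv g y = deriv (deriv f) y - c * deriv f y" if y: "y \<in> B" for y
      proof -
        have "eventually (\<lambda>y. g y = deriv f y - c * f y) (nhds y)"
          using eventually_nhds_in_open[OF B(1) y] by eventually_elim (rule gf)
        then have "deriv g y = deriv (\<lambda>y. deriv f y - c * f y) y" by (rule deriv_cong_ev) simp
        also have "((\<lambda>y. deriv f y - c * f y) has_field_derivative deriv (deriv f) y - c * deriv f y) (at y)"
          by (intro DERIV_diff DERIV_cmult holomorphic_derivI[OF f(1) B(1) y]
            holomorphic_derivI[OF holomorphic_deriv[OF f(1) B(1)] B(1) y])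
        then have "deriv (\<lambda>y. deriv f y - c * f y) y = deriv (deriv f) y - c * deriv f y"
          by (rule DERIV_imp_deriv)
        finally show ?thesis .
      qed
      then have "?R (deriv g) = ?T c (?R (deriv f))" unfolding T by (intro dx_on_cong)
      then show ?thesis unfolding K1_def using D f by blast
    qed
    ultimately obtain S n where S: "finite S" "K1 = {?R (exp_poly S P) | P. P \<in> deg_bounded S n}"
      using less.hyps[OF C'(2) _ C'(1,3)] shape by blast
    define n' where "n' = (\<lambda>\<mu>. if \<mu> = c then Suc (if c \<in> S then n c else 0) else n \<mu>)"
    let ?S = "insert c S"
    \<comment> \<open>K lies in the model: some exponential polynomial solves the same first order
      equation as f, and the difference m exp(c y) is absorbed into the constant coefficient at
      c.\<close>
    have "X \<in> {?R (exp_poly ?S P) | P. P \<in> deg_bounded ?S n'}" if X: "X \<in> K" for X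
    proof -
      obtain f where f: "f holomorphic_on B" "X = ?R f" using shape[OF X] by blast
      have "?T c X \<in> K1" using X unfolding K1_def by blast
      then obtain P where P: "P \<in> deg_bounded S n" "?T c X = ?R (exp_poly S P)" using S by blast
      obtain Q where Q: "Q \<in> deg_bounded ?S n'"
        "\<And>y. deriv (exp_poly ?S Q) y - c * exp_poly ?S Q y = exp_poly S P y"
        using solve_shifted[OF S(1) P(1) n'_def] by blast
      have fP: "deriv f y - c * f y = exp_poly S P y" if "y \<in> B" for y
        using P(2) that unfolding f T dx_on_eq_iff[OF a] by blast
      have "deriv (\<lambda>y. f y - exp_poly ?S Q y) y = c * (f y - exp_poly ?S Q y)" if y: "y \<in> B" for y
      proof -
        have "((\<lambda>y. f y - exp_poly ?S Q y) has_field_derivative deriv f y - deriv (exp_poly ?S Q) y) (at y)"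
          by (intro derivative_intros holomorphic_derivI[OF f(1) B(1) y]
            holomorphic_derivI[OF exp_poly_holomorphic B(1) y])
        then have "deriv (\<lambda>y. f y - exp_poly ?S Q y) y = deriv f y - deriv (exp_poly ?S Q) y"
          by (rule DERIV_imp_deriv)
        then show ?thesis using fP[OF y] Q(2)[of y] by (simp add: algebra_simps)
      qed
      moreover have "(\<lambda>y. f y - exp_poly ?S Q y) holomorphic_on B"
        by (intro holomorphic_intros f exp_poly_holomorphic)
      ultimately obtain m where m: "\<forall>y\<in>B. f y - exp_poly ?S Q y = m * exp (c * y)"
        using exponential_ode[OF B] by blast
      define Q' where "Q' = (\<lambda>\<mu>. Q \<mu> + (if \<mu> = c then [:m:] else 0))"
      have "Q' \<in> deg_bounded ?S n'"
        using Q(1) unfolding Q'_def deg_bounded_def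
        by (intro CollectI ballI deg_bound_add) (auto simp: n'_def)
      moreover have "exp_poly ?S Q' y = exp_poly ?S Q y + m * exp (c * y)" for y
      proof -
        have "exp_poly ?S Q' y = exp_poly ?S Q y + exp_poly ?S (\<lambda>\<mu>. if \<mu> = c then [:m:] else 0) y"
          unfolding Q'_def exp_poly_add ..
        also have "exp_poly ?S (\<lambda>\<mu>. if \<mu> = c then [:m:] else 0) = exp_poly {c} (\<lambda>\<mu>. if \<mu> = c then [:m:] else 0)"
          using S(1) by (intro exp_poly_mono_neutral) auto
        finally show ?thesis by (simp add: exp_poly_def)
      qed
      then have "X = ?R (exp_poly ?S Q')"
        unfolding f using m by (intro dx_on_cong) (simp add: algebra_simps)
      ultimately show ?thesis by blast
    qed
    \<comment> \<open>The model lies in K: an exponential polynomial is compared with some g in K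
      that has the same image under D - c.\<close>
    moreover have "?R (exp_poly ?S P) \<in> K" if P: "P \<in> deg_bounded ?S n'" for P
    proof -
      let ?f = "exp_poly ?S P"
      have "?R (\<lambda>y. deriv ?f y - c * ?f y) \<in> K1"
        unfolding S(2) shifted_deg_bounded(2)[OF P n'_def S(1)]
        using shifted_deg_bounded(1)[OF P n'_def S(1)] by blast
      then obtain g where g: "g holomorphic_on B" "?R g \<in> K" "?R (\<lambda>y. deriv ?f y - c * ?f y) = ?T c (?R g)"
        using shape unfolding K1_def by blast
      have gf: "deriv ?f y - c * ?f y = deriv g y - c * g y" if "y \<in> B" for y
        using g(3) that unfolding T dx_on_eq_iff[OF a] by blast
      have "deriv (\<lambda>y. ?f y - g y) y = c * (?f y - g y)" if y: "y \<in> B" for y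
      proof -
        have "((\<lambda>y. ?f y - g y) has_field_derivative deriv ?f y - deriv g y) (at y)"
          by (intro derivative_intros holomorphic_derivI[OF g(1) B(1) y]
            holomorphic_derivI[OF exp_poly_holomorphic B(1) y])
        then have "deriv (\<lambda>y. ?f y - g y) y = deriv ?f y - deriv g y" by (rule DERIV_imp_deriv)
        then show ?thesis using gf[OF y] by algebra
      qed
      moreover have "(\<lambda>y. ?f y - g y) holomorphic_on B"
        by (intro holomorphic_intros g exp_poly_holomorphic)
      ultimately obtain m where m: "\<forall>y\<in>B. ?f y - g y = m * exp (c * y)"
        using exponential_ode[OF B] by blast
      have "?R ?f = ?R g + ?R (\<lambda>y. m * exp (c * y))"
        unfolding dx_on_add using m by (intro dx_on_cong) (simp add: algebra_simps)
      then show ?thesis using g(2) expK K by (simp add: VF.subspace_add)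
    qed
    ultimately have "K = {?R (exp_poly ?S P) | P. P \<in> deg_bounded ?S n'}" by blast
    then show ?thesis using S(1) by blast
  qed
qed

section \<open>Brackets of affine vector fields\<close>

lemma eventually_slice_fst: "open U \<Longrightarrow> p \<in> U \<Longrightarrow> eventually (\<lambda>t. (t, snd p) \<in> U) (nhds (fst p))"
  for p :: C2
proof -
  assume "open U" "p \<in> U"
  then have "open ((\<lambda>t. (t, snd p)) -` U)" "fst p \<in> (\<lambda>t. (t, snd p)) -` U"
    by (auto intro!: open_vimage continuous_intros)
  from eventually_nhds_in_open[OF this] show ?thesis by simp
qed

lemma eventually_slice_snd: "open U \<Longrightarrow> p \<in> U \<Longrightarrow> eventually (\<lambda>t. (fst p, t) \<in> U) (nhds (snd p))"
  for p :: C2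
proof -
  assume "open U" "p \<in> U"
  then have "open ((\<lambda>t. (fst p, t)) -` U)" "snd p \<in> (\<lambda>t. (fst p, t)) -` U"
    by (auto intro!: open_vimage continuous_intros)
  from eventually_nhds_in_open[OF this] show ?thesis by simp
qed

lemma pd_cong:
  assumes "open U" "p \<in> U" "\<And>q. q \<in> U \<Longrightarrow> f q = g q"
  shows "pdx f p = pdx g p" "pdy f p = pdy g p"
  unfolding pdx_def pdy_def
  by (rule deriv_cong_ev[OF eventually_mono[OF eventually_slice_fst[OF assms(1,2)]] refl], rule assms(3), assumption)
     (rule deriv_cong_ev[OF eventually_mono[OF eventually_slice_snd[OF assms(1,2)]] refl], rule assms(3), assumption)

lemma vf_apply_cong:
  assumes "open U" "p \<in> U" "X p = Y p" "\<And>q. q \<in> U \<Longrightarrow> f q = g q"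
  shows "vf_apply X f p = vf_apply Y g p"
  using pd_cong[of U p f g] assms by (simp add: vf_apply_def)

lemma lie_bracket_cong:
  assumes "open U" "p \<in> U" "\<And>q. q \<in> U \<Longrightarrow> X q = X' q" "\<And>q. q \<in> U \<Longrightarrow> Y q = Y' q"
  shows "lie_bracket X Y p = lie_bracket X' Y' p"
  unfolding lie_bracket_def
  by (intro arg_cong2[where f = Pair] arg_cong2[where f = minus] vf_apply_cong[OF assms(1,2)]) (simp_all add: assms)

lemma vf_apply_zero: "X p = 0 \<Longrightarrow> vf_apply X f p = 0"
  by (simp add: vf_apply_def)

lemma lie_bracket_outside: "X p = 0 \<Longrightarrow> Y p = 0 \<Longrightarrow> lie_bracket X Y p = 0"
  by (simp add: lie_bracket_def vf_apply_zero zero_prod_def)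

lemma lie_bracket_restrict:
  assumes "open U"
  shows "lie_bracket (vf_restrict U X) (vf_restrict U Y) = vf_restrict U (lie_bracket X Y)"
proof
  fix p
  show "lie_bracket (vf_restrict U X) (vf_restrict U Y) p = vf_restrict U (lie_bracket X Y) p"
  proof (cases "p \<in> U")
    case True
    then show ?thesis
      using lie_bracket_cong[OF assms True, of "vf_restrict U X" X "vf_restrict U Y" Y] by (simp add: vf_restrict_def)
  qed (simp add: vf_restrict_def lie_bracket_outside)
qed

lemma vf_restrict_add: "vf_restrict U (X + Y) = vf_restrict U X + vf_restrict U Y"
  and vf_restrict_scale: "vf_restrict U (vf_scale c X) = vf_scale c (vf_restrict U X)"
  by (auto simp: vf_restrict_def fun_eq_iff vf_scale_def pt_scale_def zero_prod_def)

lemma vf_linear_span_image: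
  assumes add: "\<And>X Y. T (X + Y) = T X + T Y" and scale: "\<And>c X. T (vf_scale c X) = vf_scale c (T X)"
  shows "T ` VF.span A = VF.span (T ` A)"
proof
  have T0: "T 0 = 0" using scale[of 0 0] by (simp only: VF.scale_zero_left)
  have "VF.subspace {X. T X \<in> VF.span (T ` A)}"
    by (intro VF.subspaceI) (simp_all add: T0 add scale VF.span_zero VF.span_add VF.span_scale del: zero_fun_apply plus_fun_apply)
  moreover have "A \<subseteq> {X. T X \<in> VF.span (T ` A)}" by (auto intro: VF.span_base)
  ultimately have "VF.span A \<subseteq> {X. T X \<in> VF.span (T ` A)}" by (rule VF.span_minimal[rotated])
  then show "T ` VF.span A \<subseteq> VF.span (T ` A)" by blast
  have "linear_on_sub (VF.span A) T" unfolding linear_on_sub_def using add scale by blast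
  from linear_on_sub_image[OF VF.subspace_span this]
  show "VF.span (T ` A) \<subseteq> T ` VF.span A"
    by (intro VF.span_minimal image_mono VF.span_superset)
qed

text \<open>This class contains the generators of all six normal forms, and with holomorphic
  coefficients it is closed under the bracket.\<close>

definition aff :: "complex \<Rightarrow> (complex \<Rightarrow> complex) \<Rightarrow> complex \<Rightarrow> vfield"
  where "aff \<alpha> f b = (\<lambda>p. (\<alpha> * fst p + f (snd p), b))"

lemma fun_dx_aff: "fun_dx f = aff 0 f 0" and d_y_aff: "d_y = aff 0 (\<lambda>_. 0) 1" and x_dx_aff: "x_dx = aff 1 (\<lambda>_. 0) 0"
  by (auto simp: fun_dx_def d_y_def x_dx_def aff_def)

lemma aff_add: "aff \<alpha> f b + aff \<beta> g c = aff (\<alpha> + \<beta>) (\<lambda>y. f y + g y) (b + c)"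
  and aff_scale: "vf_scale k (aff \<alpha> f b) = aff (k * \<alpha>) (\<lambda>y. k * f y) (k * b)"
  by (auto simp: aff_def fun_eq_iff vf_scale_def pt_scale_def algebra_simps)

lemma has_pd_aff:
  assumes "(f has_field_derivative f') (at (snd p))"
  shows "has_pd (\<lambda>q. fst (aff \<alpha> f b q)) \<alpha> f' p" "has_pd (\<lambda>q. snd (aff \<alpha> f b q)) 0 0 p"
  using has_pd_add[OF has_pd_mult[OF has_pd_const[of \<alpha>] has_pd_fst_proj] has_pd_comp1[OF has_pd_snd_proj assms]]
    has_pd_const[of b p]
  by (simp_all add: aff_def)

lemma lie_bracket_aff:
  assumes f: "(f has_field_derivative f') (at (snd p))" and g: "(g has_field_derivative g') (at (snd p))"
  shows "lie_bracket (aff \<alpha> f b) (aff \<beta> g c) p = (\<beta> * f (snd p) - \<alpha> * g (snd p) + b * g' - c * f', 0)"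
  unfolding lie_bracket_def vf_apply_def has_pdD[OF has_pd_aff(1)[OF f]] has_pdD[OF has_pd_aff(2)[OF f]]
     has_pdD[OF has_pd_aff(1)[OF g]] has_pdD[OF has_pd_aff(2)[OF g]]
  by (simp add: aff_def algebra_simps)

lemma lie_bracket_aff_entire:
  assumes "f holomorphic_on UNIV" "g holomorphic_on UNIV"
  shows "lie_bracket (aff \<alpha> f b) (aff \<beta> g c) =
    fun_dx (\<lambda>y. \<beta> * f y - \<alpha> * g y + b * deriv g y - c * deriv f y)"
  using lie_bracket_aff[OF holomorphic_derivI[OF assms(1)] holomorphic_derivI[OF assms(2)]]
  by (auto simp: fun_dx_def case_prod_beta)

text \<open>Bracketing with c x d_x + d_y is D - c on coefficients; c = 0 belongs to forms 1-3 and c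
  = 1 to forms 4-6.\<close>

lemma lie_bracket_exp_poly:
  "lie_bracket (aff c (\<lambda>_. 0) 1) (fun_dx (exp_poly S P)) =
    fun_dx (exp_poly S (\<lambda>\<mu>. twisted_deriv (\<mu> - c) (P \<mu>)))"
  unfolding fun_dx_aff[of "exp_poly S P"]
  by (subst lie_bracket_aff_entire) (auto simp: exp_poly_deriv_shift exp_poly_holomorphic)

lemma ad_power_exp_poly:
  "((\<lambda>Z. lie_bracket (aff c (\<lambda>_. 0) 1) Z - vf_scale 0 Z) ^^ k) (fun_dx (exp_poly S P)) =
    fun_dx (exp_poly S (\<lambda>\<mu>. (twisted_deriv (\<mu> - c) ^^ k) (P \<mu>)))"
  by (induction k) (simp_all add: lie_bracket_exp_poly del: zero_fun_apply)

lemma fun_dx_inj: "fun_dx f = fun_dx g \<longleftrightarrow> f = g"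
  by (auto simp: fun_dx_def fun_eq_iff)

lemma fun_dx_eq_0: "fun_dx f = 0 \<longleftrightarrow> (\<forall>y. f y = 0)"
  by (auto simp: fun_dx_def fun_eq_iff zero_prod_def)

lemma fun_dx_exp_poly_eq_0: "finite S \<Longrightarrow> fun_dx (exp_poly S P) = 0 \<longleftrightarrow> (\<forall>\<mu>\<in>S. P \<mu> = 0)"
proof
  assume "finite S" "fun_dx (exp_poly S P) = 0"
  then show "\<forall>\<mu>\<in>S. P \<mu> = 0" unfolding fun_dx_eq_0 using exp_poly_eq_0D[of S P] by blast
qed (simp add: fun_dx_eq_0 exp_poly_def)

lemma dim_exp_times_poly:
  "VF.dim {fun_dx (\<lambda>y. exp (c * y) * poly p y) | p. p = 0 \<or> degree p < N} = N"
proof (rule VF.dim_unique)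
  let ?b = "\<lambda>i. fun_dx (\<lambda>y. exp (c * y) * y ^ i)"
  let ?M = "{fun_dx (\<lambda>y. exp (c * y) * poly p y) | p. p = 0 \<or> degree p < N}"
  have lin: "(\<Sum>i<N. vf_scale (k i) (?b i)) = fun_dx (\<lambda>y. exp (c * y) * poly (\<Sum>i<N. monom (k i) i) y)" for k
  proof -
    have "vf_scale (k i) (?b i) = fun_dx (\<lambda>y. exp (c * y) * poly (monom (k i) i) y)" for i
      by (simp add: fun_dx_def fun_eq_iff vf_scale_def pt_scale_def poly_monom)
    then show ?thesis by (simp add: sum_fun_dx poly_sum sum_distrib_left)
  qed
  have co: "coeff (\<Sum>i<N. monom (k i) i) j = (if j < N then k j else 0)" for k :: "nat \<Rightarrow> complex" and j
    by (simp add: coeff_sum sum.delta)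
  have indep: "k i = 0" if "(\<Sum>i<N. vf_scale (k i) (?b i)) = 0" "i < N" for k i
  proof -
    have "\<forall>y. poly (\<Sum>i<N. monom (k i) i) y = 0" using that(1) unfolding lin fun_dx_eq_0 by simp
    then have "(\<Sum>i<N. monom (k i) i) = 0" using poly_all_0_iff_0 by blast
    then show ?thesis using co[of k i] that(2) by simp
  qed
  have inj: "inj_on ?b {..<N}"
  proof
    fix i j assume i: "i \<in> {..<N}" and j: "j \<in> {..<N}" and e: "?b i = ?b j"
    show "i = j"
    proof (rule ccontr)
      assume ne: "i \<noteq> j"
      have "(\<Sum>k<N. vf_scale ((if k = i then 1 else 0) + (if k = j then -1 else 0)) (?b k)) =
         (\<Sum>k<N. if k = i then ?b k else 0) + (\<Sum>k<N. if k = j then - ?b k else 0)"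
        unfolding sum.distrib[symmetric] by (intro sum.cong refl) (auto simp: ne simp del: zero_fun_apply)
      also have "\<dots> = 0" using i j e by (simp add: sum.delta del: zero_fun_apply)
      finally show False using indep[of "\<lambda>k. (if k = i then 1 else 0) + (if k = j then -1 else 0)" i] i ne by simp
    qed
  qed
  show "?b ` {..<N} \<subseteq> ?M"
  proof
    fix X assume "X \<in> ?b ` {..<N}"
    then obtain i where "i < N" "X = ?b i" by blast
    then show "X \<in> ?M"
      by (intro CollectI exI[of _ "monom 1 i"]) (auto simp: poly_monom degree_monom_eq)
  qed
  show "?M \<subseteq> VF.span (?b ` {..<N})"
  proof
    fix X assume "X \<in> ?M"
    then obtain p where p: "X = fun_dx (\<lambda>y. exp (c * y) * poly p y)" "p = 0 \<or> degree p < N" by blast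
    have "p = (\<Sum>i<N. monom (coeff p i) i)"
      using p(2) by (auto simp: poly_eq_iff co coeff_eq_0)
    then have "X = (\<Sum>i<N. vf_scale (coeff p i) (?b i))" unfolding lin p(1) by simp
    then show "X \<in> VF.span (?b ` {..<N})"
      by (simp only:) (intro VF.span_sum VF.span_scale VF.span_base imageI)
  qed
  show "VF.independent (?b ` {..<N})"
  proof (rule VF.independent_if_scalars_zero)
    fix u X assume 0: "(\<Sum>x\<in>?b ` {..<N}. vf_scale (u x) x) = 0" and X: "X \<in> ?b ` {..<N}"
    then obtain i where i: "i < N" "X = ?b i" by blast
    show "u X = 0"
      using 0 indep[of "u \<circ> ?b" i] i by (simp add: sum.reindex[OF inj] del: zero_fun_apply)
  qed simp
  show "card (?b ` {..<N}) = N" by (simp add: card_image[OF inj])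
qed

text \<open>n is arbitrary outside S, hence the guard.\<close>

definition mult_of :: "complex set \<Rightarrow> (complex \<Rightarrow> nat) \<Rightarrow> complex \<Rightarrow> nat"
  where "mult_of S n c = (if c \<in> S then n c else 0)"

text \<open>The operator is injective on each frequency other than c and nilpotent on c itself, so
  the generalized eigenspace is the summand of frequency c.\<close>

lemma eigenvalue_mult_sum_V:
  assumes S: "finite S" "\<forall>\<mu>\<in>S. n \<mu> > 0"
  shows "eigenvalue_mult (aff c (\<lambda>_. 0) 1) (sum_V S n) 0 = mult_of S n c"
proof -
  let ?T = "\<lambda>k. (\<lambda>Z. lie_bracket (aff c (\<lambda>_. 0) 1) Z - vf_scale 0 Z) ^^ k"
  let ?M = "{fun_dx (\<lambda>y. exp (c * y) * poly p y) | p. p = 0 \<or> degree p < mult_of S n c}"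
  have sv: "sum_V S n = {fun_dx (exp_poly S P) | P. P \<in> deg_bounded S n}"
    using S by (intro sum_V_eq) auto
  have "{Y \<in> sum_V S n. \<exists>k. ?T k Y = 0} = ?M"
  proof (intro equalityI subsetI)
    fix Y assume "Y \<in> {Y \<in> sum_V S n. \<exists>k. ?T k Y = 0}"
    then obtain P k where P: "Y = fun_dx (exp_poly S P)" "P \<in> deg_bounded S n" "?T k Y = 0"
      unfolding sv by blast
    then have "\<forall>\<mu>\<in>S. (twisted_deriv (\<mu> - c) ^^ k) (P \<mu>) = 0"
      unfolding P(1) ad_power_exp_poly fun_dx_exp_poly_eq_0[OF S(1)] by blast
    then have 0: "P \<mu> = 0" if "\<mu> \<in> S - {c}" for \<mu>
      using that twisted_deriv_power_eq_0_iff[of "\<mu> - c" k "P \<mu>"] by auto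
    define p where "p = (if c \<in> S then P c else 0)"
    have "exp_poly S P = (\<lambda>y. exp (c * y) * poly p y)"
    proof (cases "c \<in> S")
      case True
      have "exp_poly S P = exp_poly {c} P" using S(1) True 0 by (intro exp_poly_mono_neutral) auto
      then show ?thesis by (simp add: exp_poly_def p_def True)
    next
      case False
      have "exp_poly S P = exp_poly {} P" using S(1) False 0 by (intro exp_poly_mono_neutral) auto
      then show ?thesis by (simp add: exp_poly_def p_def False)
    qed
    moreover have "p = 0 \<or> degree p < mult_of S n c"
      using P(2) unfolding p_def mult_of_def deg_bounded_def by auto
    ultimately show "Y \<in> ?M" unfolding P(1) by auto
  next
    fix Y assume "Y \<in> ?M"
    then obtain p where p: "Y = fun_dx (\<lambda>y. exp (c * y) * poly p y)" "p = 0 \<or> degree p < mult_of S n c" by blast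
    let ?P = "\<lambda>\<mu>. if \<mu> = c then p else 0"
    have "exp_poly S ?P = (\<lambda>y. exp (c * y) * poly p y)"
    proof (cases "c \<in> S")
      case True
      have "exp_poly S ?P = exp_poly {c} ?P" using S(1) True by (intro exp_poly_mono_neutral) auto
      then show ?thesis by (simp add: exp_poly_def)
    next
      case False
      have "exp_poly S ?P = exp_poly {} ?P" using S(1) False by (intro exp_poly_mono_neutral) auto
      then show ?thesis using p(2) False by (simp add: exp_poly_def mult_of_def)
    qed
    then have Y: "Y = fun_dx (exp_poly S ?P)" by (simp add: p(1))
    have "?P \<in> deg_bounded S n" using p(2) by (auto simp: deg_bounded_def mult_of_def split: if_splits)
    moreover have z: "(twisted_deriv z ^^ k) 0 = 0" for z k
      by (induction k) (simp_all add: twisted_deriv_def)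
    have "?T (Suc (degree p)) Y = 0"
      unfolding Y ad_power_exp_poly fun_dx_exp_poly_eq_0[OF S(1)]
      using twisted_deriv_0_power[of p "Suc (degree p)"] z by (simp del: funpow.simps)
    ultimately show "Y \<in> {Y \<in> sum_V S n. \<exists>k. ?T k Y = 0}" unfolding sv using Y by blast
  qed
  then show ?thesis unfolding eigenvalue_mult_def by (simp add: dim_exp_times_poly)
qed

text \<open>A field in the kernel must have a frequency on which the operator is not injective;
  conversely exp(c y) d_x is annihilated.\<close>

lemma is_eigenvalue_sum_V:
  assumes S: "finite S" "\<forall>\<mu>\<in>S. n \<mu> > 0"
  shows "is_eigenvalue (aff c (\<lambda>_. 0) 1) (sum_V S n) 0 \<longleftrightarrow> c \<in> S"
proof -
  have sv: "sum_V S n = {fun_dx (exp_poly S P) | P. P \<in> deg_bounded S n}"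
    using S by (intro sum_V_eq) auto
  show ?thesis
  proof
    assume "is_eigenvalue (aff c (\<lambda>_. 0) 1) (sum_V S n) 0"
    then obtain P where P: "fun_dx (exp_poly S P) \<noteq> 0"
      "lie_bracket (aff c (\<lambda>_. 0) 1) (fun_dx (exp_poly S P)) = 0"
      unfolding is_eigenvalue_def sv by (auto simp only: VF.scale_zero_left)
    then have "\<forall>\<mu>\<in>S. twisted_deriv (\<mu> - c) (P \<mu>) = 0"
      unfolding lie_bracket_exp_poly fun_dx_exp_poly_eq_0[OF S(1)] by blast
    moreover obtain \<mu> where "\<mu> \<in> S" "P \<mu> \<noteq> 0" using P(1) unfolding fun_dx_exp_poly_eq_0[OF S(1)] by blast
    ultimately show "c \<in> S" using twisted_deriv_eq_0_iff[of "\<mu> - c" "P \<mu>"] by auto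
  next
    assume c: "c \<in> S"
    let ?P = "\<lambda>\<mu>. if \<mu> = c then 1 else 0"
    have "?P \<in> deg_bounded S n" using c S(2) by (auto simp: deg_bounded_def)
    moreover have "fun_dx (exp_poly S ?P) \<noteq> 0" unfolding fun_dx_exp_poly_eq_0[OF S(1)] using c by auto
    moreover have "lie_bracket (aff c (\<lambda>_. 0) 1) (fun_dx (exp_poly S ?P)) = 0"
      unfolding lie_bracket_exp_poly fun_dx_exp_poly_eq_0[OF S(1)] by (auto simp: twisted_deriv_def)
    ultimately show "is_eigenvalue (aff c (\<lambda>_. 0) 1) (sum_V S n) 0"
      unfolding is_eigenvalue_def sv VF.scale_zero_left by blast
  qed
qed

section \<open>The commutator algebras of the normal forms\<close>

lemma span_insert_subspace:
  assumes "VF.subspace h"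
  shows "VF.span (h \<union> {Z}) = {Y + vf_scale c Z | Y c. Y \<in> h}"
proof -
  have h: "VF.span h = h" using assms VF.span_eq_iff by blast
  have "VF.span (h \<union> {Z}) = {X. \<exists>c. X - vf_scale c Z \<in> VF.span h}"
    using VF.span_insert[of Z h] by simp
  also have "\<dots> = {X. \<exists>c. X - vf_scale c Z \<in> h}" unfolding h ..
  also have "{X. \<exists>c. X - vf_scale c Z \<in> h} = {Y + vf_scale c Z | Y c. Y \<in> h}"
  proof (intro equalityI subsetI)
    fix X assume "X \<in> {X. \<exists>c. X - vf_scale c Z \<in> h}"
    then obtain c where "X - vf_scale c Z \<in> h" by blast
    moreover have "X = (X - vf_scale c Z) + vf_scale c Z" by (rule diff_add_cancel[symmetric])
    ultimately show "X \<in> {Y + vf_scale c Z | Y c. Y \<in> h}" by blast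
  next
    fix X assume "X \<in> {Y + vf_scale c Z | Y c. Y \<in> h}"
    then obtain Y c where "X = Y + vf_scale c Z" "Y \<in> h" by blast
    then have "X - vf_scale c Z \<in> h" by (simp only: add_diff_cancel_right')
    then show "X \<in> {X. \<exists>c. X - vf_scale c Z \<in> h}" by blast
  qed
  finally show ?thesis .
qed

lemma span_insert2_subspace:
  assumes "VF.subspace h"
  shows "VF.span (h \<union> {Z, W}) = {Y + vf_scale c Z + vf_scale k W | Y c k. Y \<in> h}"
proof -
  have "VF.span (h \<union> {Z, W}) = VF.span (VF.span (h \<union> {Z}) \<union> {W})"
  proof
    show "VF.span (h \<union> {Z, W}) \<subseteq> VF.span (VF.span (h \<union> {Z}) \<union> {W})"
      by (rule VF.span_minimal[OF _ VF.subspace_span]) (auto intro!: VF.span_base)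
    have "VF.span (h \<union> {Z}) \<union> {W} \<subseteq> VF.span (h \<union> {Z, W})"
      using VF.span_mono[of "h \<union> {Z}" "h \<union> {Z, W}"] VF.span_base[of W "h \<union> {Z, W}"] by auto
    then show "VF.span (VF.span (h \<union> {Z}) \<union> {W}) \<subseteq> VF.span (h \<union> {Z, W})"
      by (rule VF.span_minimal[OF _ VF.subspace_span])
  qed
  also have "\<dots> = {Y + vf_scale k W | Y k. Y \<in> VF.span (h \<union> {Z})}"
    by (rule span_insert_subspace[OF VF.subspace_span])
  also have "\<dots> = {Y + vf_scale c Z + vf_scale k W | Y c k. Y \<in> h}"
    unfolding span_insert_subspace[OF assms] by blast
  finally show ?thesis .
qed

text \<open>With Z = mu x d_x + d_y and W = kappa x d_x + w d_x this covers all six forms; forms 1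
  and 4 have W = 0. Modulo brackets with h only [Z, W] counts, and its coefficient is w' - mu w. For
  kappa = 1 each Y in h equals [Y, W]; otherwise bracketing with Z has to reach all of h.\<close>

lemma derived_span_sum_V:
  assumes S: "finite S" "\<forall>\<mu>\<in>S. n \<mu> > 0"
    and w: "w holomorphic_on UNIV" "fun_dx (\<lambda>y. deriv w y - \<mu> * w y) \<in> sum_V S n"
    and G: "G = VF.span (sum_V S n \<union> {aff \<mu> (\<lambda>_. 0) 1, aff \<kappa> w 0})"
    and gen: "\<kappa> = 1 \<or> sum_V S n \<subseteq> lie_bracket (aff \<mu> (\<lambda>_. 0) 1) ` G"
  shows "derived G = sum_V S n"
proof
  let ?Z = "aff \<mu> (\<lambda>_. 0) 1" and ?W = "aff \<kappa> w 0"
  have sub: "VF.subspace (sum_V S n)" using S by (rule sum_V_subspace)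
  have sv: "sum_V S n = {fun_dx (exp_poly S P) | P. P \<in> deg_bounded S n}"
    using S by (intro sum_V_eq) auto
  have Gf: "\<exists>P c k. P \<in> deg_bounded S n \<and>
      X = aff (c * \<mu> + k * \<kappa>) (\<lambda>y. exp_poly S P y + k * w y) c" if X: "X \<in> G" for X
  proof -
    obtain Y c k where Y: "Y \<in> sum_V S n" "X = Y + vf_scale c ?Z + vf_scale k ?W"
      using X unfolding G span_insert2_subspace[OF sub] by blast
    obtain P where "P \<in> deg_bounded S n" "Y = fun_dx (exp_poly S P)"
      using Y(1) unfolding sv by blast
    with Y(2) show ?thesis
      by (intro exI[of _ P] exI[of _ c] exI[of _ k]) (simp add: fun_dx_aff aff_scale aff_add)
  qed
  have Zh: "fun_dx (\<lambda>y. deriv (exp_poly S P) y - \<mu> * exp_poly S P y) \<in> sum_V S n" if "P \<in> deg_bounded S n" for P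
  proof -
    have "(\<lambda>\<nu>. twisted_deriv (\<nu> - \<mu>) (P \<nu>)) \<in> deg_bounded S n"
      unfolding deg_bounded_def
    proof (intro CollectI ballI)
      fix \<nu> assume "\<nu> \<in> S"
      then have "P \<nu> = 0 \<or> degree (P \<nu>) < n \<nu>" using that unfolding deg_bounded_def by blast
      then show "twisted_deriv (\<nu> - \<mu>) (P \<nu>) = 0 \<or> degree (twisted_deriv (\<nu> - \<mu>) (P \<nu>)) < n \<nu>"
        using degree_twisted_deriv_le[of "\<nu> - \<mu>" "P \<nu>"] by (auto simp: twisted_deriv_def)
    qed
    then show ?thesis unfolding sv exp_poly_deriv_shift by blast
  qed
  have "lie_bracket X Y \<in> sum_V S n" if XY: "X \<in> G" "Y \<in> G" for X Y
  proof -
    obtain P c k where X: "P \<in> deg_bounded S n" "X = aff (c * \<mu> + k * \<kappa>) (\<lambda>y. exp_poly S P y + k * w y) c"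
      using Gf[OF XY(1)] by blast
    obtain Q d m where Y: "Q \<in> deg_bounded S n" "Y = aff (d * \<mu> + m * \<kappa>) (\<lambda>y. exp_poly S Q y + m * w y) d"
      using Gf[OF XY(2)] by blast
    have hol: "(\<lambda>y. exp_poly S P y + k * w y) holomorphic_on UNIV" for P k
      by (intro holomorphic_intros w exp_poly_holomorphic)
    have d: "deriv (\<lambda>y. exp_poly S P y + k * w y) y = deriv (exp_poly S P) y + k * deriv w y" for P k y
      by (rule DERIV_imp_deriv) (intro DERIV_add DERIV_cmult holomorphic_derivI[OF exp_poly_holomorphic open_UNIV]
         holomorphic_derivI[OF w(1) open_UNIV] UNIV_I)
    \<comment> \<open>The terms k m kappa w from the two dilation parts cancel, so w enters only
      through w' - mu w.\<close>
    have "lie_bracket X Y =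
      vf_scale (m * \<kappa>) (fun_dx (exp_poly S P)) - vf_scale (k * \<kappa>) (fun_dx (exp_poly S Q))
      + vf_scale c (fun_dx (\<lambda>y. deriv (exp_poly S Q) y - \<mu> * exp_poly S Q y))
      - vf_scale d (fun_dx (\<lambda>y. deriv (exp_poly S P) y - \<mu> * exp_poly S P y))
      + vf_scale (c * m - d * k) (fun_dx (\<lambda>y. deriv w y - \<mu> * w y))"
      unfolding X(2) Y(2) lie_bracket_aff_entire[OF hol hol] d
      by (auto simp: fun_dx_def vf_scale_def pt_scale_def fun_eq_iff algebra_simps)
    moreover have "fun_dx (exp_poly S P) \<in> sum_V S n" "fun_dx (exp_poly S Q) \<in> sum_V S n"
      using X Y unfolding sv by blast+
    ultimately show ?thesis
      using Zh[OF X(1)] Zh[OF Y(1)] w(2)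
      by (simp only:) (intro VF.subspace_add VF.subspace_diff VF.subspace_scale sub)
  qed
  then have "{lie_bracket X Y | X Y. X \<in> G \<and> Y \<in> G} \<subseteq> sum_V S n" by blast
  then show "derived G \<subseteq> sum_V S n" unfolding commutator_def by (intro VF.span_minimal sub)
  have hG: "sum_V S n \<subseteq> G" unfolding G by (auto intro: VF.span_base)
  have ZG: "?Z \<in> G" "?W \<in> G" unfolding G by (auto intro: VF.span_base)
  have "\<exists>A\<in>G. \<exists>B\<in>G. Y = lie_bracket A B" if Y: "Y \<in> sum_V S n" for Y
    using gen
  proof
    assume "\<kappa> = 1"
    obtain P where P: "Y = fun_dx (exp_poly S P)" using Y sv by blast
    have "Y = lie_bracket Y ?W"
      unfolding P unfolding fun_dx_aff[of "exp_poly S P"] lie_bracket_aff_entire[OF exp_poly_holomorphic w(1)]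
      using \<open>\<kappa> = 1\<close> by (simp add: fun_dx_aff)
    then show ?thesis using Y hG ZG by blast
  next
    assume "sum_V S n \<subseteq> lie_bracket ?Z ` G"
    then show ?thesis using Y ZG by blast
  qed
  then show "sum_V S n \<subseteq> derived G" unfolding commutator_def by (blast intro: VF.span_base)
qed

text \<open>The bounds of \<open>solve_shifted\<close>: one more degree at the resonant frequency
  c.\<close>

definition raise :: "complex set \<Rightarrow> (complex \<Rightarrow> nat) \<Rightarrow> complex \<Rightarrow> complex \<Rightarrow> nat"
  where "raise S n c = (\<lambda>\<mu>. if \<mu> = c then Suc (mult_of S n c) else n \<mu>)"

text \<open>The coefficient of y^N at frequency c is split off. This passes between one space of
  exponential polynomials and the pair of h and a resonant monomial in forms 3 and 5.\<close>

lemma sum_V_raise: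
  assumes S: "finite S" "\<forall>\<mu>\<in>S. n \<mu> > 0"
  shows "{fun_dx (exp_poly (insert c S) P) | P. P \<in> deg_bounded (insert c S) (raise S n c)} =
    VF.span (sum_V S n \<union> {fun_dx (\<lambda>y. y ^ mult_of S n c * exp (c * y))})" (is "?L = VF.span (_ \<union> {?w})")
proof
  let ?N = "mult_of S n c"
  have sv: "sum_V S n = {fun_dx (exp_poly S P) | P. P \<in> deg_bounded S n}"
    using S by (intro sum_V_eq) auto
  have sub: "VF.subspace (sum_V S n)" using S by (rule sum_V_subspace)
  have single: "exp_poly (insert c S) (\<lambda>\<mu>. if \<mu> = c then p else 0) = (\<lambda>y. exp (c * y) * poly p y)" for p
  proof -
    have "exp_poly (insert c S) (\<lambda>\<mu>. if \<mu> = c then p else 0) = exp_poly {c} (\<lambda>\<mu>. if \<mu> = c then p else 0)"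
      using S by (intro exp_poly_mono_neutral) auto
    then show ?thesis by (simp add: exp_poly_def)
  qed
  show "?L \<subseteq> VF.span (sum_V S n \<union> {?w})"
  proof
    fix X assume "X \<in> ?L"
    then obtain P where P: "X = fun_dx (exp_poly (insert c S) P)" "P \<in> deg_bounded (insert c S) (raise S n c)" by blast
    define k where "k = coeff (P c) ?N"
    define q where "q = P c - monom k ?N"
    define Q where "Q = (\<lambda>\<mu>. if \<mu> = c then q else P \<mu>)"
    have Pc: "degree (P c) \<le> ?N" using P(2) by (auto simp: deg_bounded_def raise_def)
    have "coeff q i = 0" if "i \<ge> ?N" for i
      using that Pc by (cases "i = ?N") (auto simp: q_def k_def coeff_eq_0)
    then have q: "q = 0 \<or> degree q < ?N" by (metis leading_coeff_0_iff not_less)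
    have "Q \<in> deg_bounded S n" using q P(2) by (auto simp: deg_bounded_def Q_def raise_def mult_of_def)
    moreover have "exp_poly (insert c S) P y = exp_poly S Q y + k * (y ^ ?N * exp (c * y))" for y
    proof -
      have "exp_poly (insert c S) P = exp_poly (insert c S) (\<lambda>\<mu>. Q \<mu> + (if \<mu> = c then monom k ?N else 0))"
        by (intro exp_poly_cong) (auto simp: Q_def q_def)
      moreover have "exp_poly (insert c S) Q = exp_poly S Q"
        using S q by (intro exp_poly_mono_neutral) (auto simp: Q_def mult_of_def)
      ultimately show ?thesis by (simp add: exp_poly_add single poly_monom)
    qed
    then have "X = fun_dx (exp_poly S Q) + vf_scale k ?w"
      unfolding P(1) by (auto simp: fun_dx_def fun_eq_iff vf_scale_def pt_scale_def)
    moreover have "fun_dx (exp_poly S Q) \<in> sum_V S n" if "Q \<in> deg_bounded S n"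
      unfolding sv using that by blast
    ultimately show "X \<in> VF.span (sum_V S n \<union> {?w})"
      unfolding span_insert_subspace[OF sub] by blast
  qed
  have "sum_V S n \<subseteq> ?L"
  proof
    fix X assume "X \<in> sum_V S n"
    then obtain P where P: "X = fun_dx (exp_poly S P)" "P \<in> deg_bounded S n" unfolding sv by blast
    let ?Q = "\<lambda>\<mu>. if \<mu> \<in> S then P \<mu> else 0"
    have "exp_poly (insert c S) ?Q = exp_poly S ?Q" using S by (intro exp_poly_mono_neutral) auto
    also have "\<dots> = exp_poly S P" by (intro exp_poly_cong) auto
    finally have "X = fun_dx (exp_poly (insert c S) ?Q)" by (simp add: P(1))
    moreover have "?Q \<in> deg_bounded (insert c S) (raise S n c)"
      using P(2) by (auto simp: deg_bounded_def raise_def mult_of_def intro: less_SucI)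
    ultimately show "X \<in> ?L" by blast
  qed
  moreover have "?w \<in> ?L"
    by (intro CollectI exI[of _ "\<lambda>\<mu>. if \<mu> = c then monom 1 ?N else 0"])
       (auto simp: single poly_monom deg_bounded_def raise_def degree_monom_eq mult.commute)
  ultimately show "VF.span (sum_V S n \<union> {?w}) \<subseteq> ?L"
    by (intro VF.span_minimal deg_bounded_subspace) auto
qed

text \<open>Without the frequency c, D - c maps h onto itself; in general a preimage may have one
  more degree at c, which the resonant monomial supplies.\<close>

lemma bracket_onto_sum_V:
  assumes S: "finite S" "\<forall>\<mu>\<in>S. n \<mu> > 0"
  shows "c \<notin> S \<Longrightarrow> sum_V S n \<subseteq> lie_bracket (aff c (\<lambda>_. 0) 1) ` sum_V S n"
    and "sum_V S n \<subseteq> lie_bracket (aff c (\<lambda>_. 0) 1) `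
      VF.span (sum_V S n \<union> {fun_dx (\<lambda>y. y ^ mult_of S n c * exp (c * y))})"
proof -
  have sv: "sum_V S n = {fun_dx (exp_poly S P) | P. P \<in> deg_bounded S n}"
    using S by (intro sum_V_eq) auto
  show "sum_V S n \<subseteq> lie_bracket (aff c (\<lambda>_. 0) 1) ` sum_V S n" if c: "c \<notin> S"
  proof
    fix X assume "X \<in> sum_V S n"
    then obtain P where P: "X = fun_dx (exp_poly S P)" "P \<in> deg_bounded S n" unfolding sv by blast
    have "\<forall>\<mu>\<in>S. \<exists>q. twisted_deriv (\<mu> - c) q = P \<mu> \<and> (q = 0 \<or> degree q < n \<mu>)"
    proof
      fix \<mu> assume "\<mu> \<in> S"
      then show "\<exists>q. twisted_deriv (\<mu> - c) q = P \<mu> \<and> (q = 0 \<or> degree q < n \<mu>)"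
        using P(2) c by (intro twisted_deriv_surj) (auto simp: deg_bounded_def)
    qed
    then obtain Q where Q: "\<forall>\<mu>\<in>S. twisted_deriv (\<mu> - c) (Q \<mu>) = P \<mu> \<and> (Q \<mu> = 0 \<or> degree (Q \<mu>) < n \<mu>)" by metis
    then have "X = lie_bracket (aff c (\<lambda>_. 0) 1) (fun_dx (exp_poly S Q))"
      unfolding lie_bracket_exp_poly P(1) fun_dx_inj by (intro exp_poly_cong) simp
    moreover have "Q \<in> deg_bounded S n" using Q by (simp add: deg_bounded_def)
    ultimately show "X \<in> lie_bracket (aff c (\<lambda>_. 0) 1) ` sum_V S n" unfolding sv by blast
  qed
  show "sum_V S n \<subseteq> lie_bracket (aff c (\<lambda>_. 0) 1) `
      VF.span (sum_V S n \<union> {fun_dx (\<lambda>y. y ^ mult_of S n c * exp (c * y))})"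
  proof
    fix X assume "X \<in> sum_V S n"
    then obtain P where P: "X = fun_dx (exp_poly S P)" "P \<in> deg_bounded S n" unfolding sv by blast
    have r: "raise S n c = (\<lambda>\<mu>. if \<mu> = c then Suc (if c \<in> S then n c else 0) else n \<mu>)"
      by (rule ext) (simp add: raise_def mult_of_def)
    obtain Q where Q: "Q \<in> deg_bounded (insert c S) (raise S n c)"
      "\<And>y. deriv (exp_poly (insert c S) Q) y - c * exp_poly (insert c S) Q y = exp_poly S P y"
      using solve_shifted[OF S(1) P(2) r] by blast
    have "X = lie_bracket (aff c (\<lambda>_. 0) 1) (fun_dx (exp_poly (insert c S) Q))"
      unfolding lie_bracket_exp_poly P(1) fun_dx_inj using Q(2) by (auto simp: exp_poly_deriv_shift)
    then show "X \<in> lie_bracket (aff c (\<lambda>_. 0) 1) `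
      VF.span (sum_V S n \<union> {fun_dx (\<lambda>y. y ^ mult_of S n c * exp (c * y))})"
      unfolding sum_V_raise[OF S, symmetric] using Q(1) by blast
  qed
qed

text \<open>(D - c)(y^N exp(c y)) = N y^(N-1) exp(c y), which meets the degree bound if c is in S;
  otherwise N = 0 and it vanishes.\<close>

lemma monomial_deriv_in_sum_V:
  assumes S: "finite S" "\<forall>\<mu>\<in>S. n \<mu> > 0"
  shows "fun_dx (\<lambda>y. deriv (\<lambda>y. y ^ mult_of S n c * exp (c * y)) y - c * (y ^ mult_of S n c * exp (c * y))) \<in> sum_V S n"
proof -
  let ?N = "mult_of S n c"
  have sv: "sum_V S n = {fun_dx (exp_poly S P) | P. P \<in> deg_bounded S n}"
    using S by (intro sum_V_eq) auto
  have D: "((\<lambda>y. y ^ ?N * exp (c * y)) has_field_derivative of_nat ?N * y ^ (?N - 1) * exp (c * y) + c * (y ^ ?N * exp (c * y))) (at y)" for y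
    by (auto intro!: derivative_eq_intros simp: algebra_simps)
  have d: "deriv (\<lambda>y. y ^ ?N * exp (c * y)) y - c * (y ^ ?N * exp (c * y)) = of_nat ?N * y ^ (?N - 1) * exp (c * y)" for y
    unfolding DERIV_imp_deriv[OF D] by simp
  show ?thesis
  proof (cases "c \<in> S")
    case True
    let ?P = "\<lambda>\<mu>. if \<mu> = c then monom (of_nat ?N) (?N - 1) else 0"
    have "exp_poly S ?P = exp_poly {c} ?P" using S True by (intro exp_poly_mono_neutral) auto
    then have "fun_dx (\<lambda>y. of_nat ?N * y ^ (?N - 1) * exp (c * y)) = fun_dx (exp_poly S ?P)"
      by (simp add: exp_poly_def poly_monom mult_ac)
    moreover have "degree (monom (of_nat ?N :: complex) (?N - 1)) < n c"
      using True S(2) degree_monom_le[of "of_nat ?N :: complex" "?N - 1"]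
      by (auto simp: mult_of_def intro: le_less_trans)
    then have "?P \<in> deg_bounded S n" by (auto simp: deg_bounded_def)
    ultimately show ?thesis unfolding d sv by blast
  next
    case False
    then have "fun_dx (\<lambda>y. of_nat ?N * y ^ (?N - 1) * exp (c * y)) = 0" by (simp add: mult_of_def fun_dx_eq_0)
    then show ?thesis unfolding d using VF.subspace_0[OF sum_V_subspace[OF S]] by simp
  qed
qed

text \<open>The forms pair up as 1 and 4, 3 and 5, 2 and 6. Each pair is one statement with c = 0
  and c = 1; in the last pair the dilation acts on h as a scalar, which recovers all of h.\<close>

lemma normal_form_derived:
  assumes S: "finite S" "\<forall>\<mu>\<in>S. n \<mu> > 0" and G: "normal_form (sum_V S n) G"
  shows "derived G = sum_V S n"
proof -
  let ?h = "sum_V S n"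
  have z: "x_dx + d_y = aff 1 (\<lambda>_. 0) 1" by (simp add: x_dx_aff d_y_aff aff_add)
  have zero: "aff 0 (\<lambda>_. 0) 0 = 0" by (simp add: aff_def fun_eq_iff zero_prod_def)
  have sub: "VF.subspace ?h" using S by (rule sum_V_subspace)
  have f14: "derived G = ?h" if "G = VF.span (?h \<union> {aff c (\<lambda>_. 0) 1})" "\<not> is_eigenvalue (aff c (\<lambda>_. 0) 1) ?h 0" for c
  proof (rule derived_span_sum_V[OF S])
    show "(\<lambda>_. 0) holomorphic_on UNIV" by simp
    show "fun_dx (\<lambda>y. deriv (\<lambda>_. 0) y - c * 0) \<in> ?h"
      using VF.subspace_0[OF sub] fun_dx_eq_0[of "\<lambda>_. 0"] by simp
    show G: "G = VF.span (?h \<union> {aff c (\<lambda>_. 0) 1, aff 0 (\<lambda>_. 0) 0})"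
      unfolding that(1) zero using VF.span_insert_0[of "?h \<union> {aff c (\<lambda>_. 0) 1}"] by (simp add: insert_commute)
    show "0 = (1::complex) \<or> ?h \<subseteq> lie_bracket (aff c (\<lambda>_. 0) 1) ` G"
      using bracket_onto_sum_V(1)[OF S, of c] that(2) is_eigenvalue_sum_V[OF S] VF.span_superset[of "?h \<union> {aff c (\<lambda>_. 0) 1}"]
      unfolding that(1) by blast
  qed
  have f35: "derived G = ?h" if "G = VF.span (?h \<union> {aff c (\<lambda>_. 0) 1, fun_dx (\<lambda>y. y ^ mult_of S n c * exp (c * y))})" for c
  proof (rule derived_span_sum_V[OF S])
    show "(\<lambda>y. y ^ mult_of S n c * exp (c * y)) holomorphic_on UNIV" by (intro holomorphic_intros)
    show "fun_dx (\<lambda>y. deriv (\<lambda>y. y ^ mult_of S n c * exp (c * y)) y - c * (y ^ mult_of S n c * exp (c * y))) \<in> ?h"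
      by (rule monomial_deriv_in_sum_V[OF S])
    show "G = VF.span (?h \<union> {aff c (\<lambda>_. 0) 1, aff 0 (\<lambda>y. y ^ mult_of S n c * exp (c * y)) 0})"
      unfolding that fun_dx_aff ..
    have "VF.span (sum_V S n \<union> {fun_dx (\<lambda>y. y ^ mult_of S n c * exp (c * y))}) \<subseteq> G"
      unfolding that by (intro VF.span_mono) auto
    then show "0 = (1::complex) \<or> ?h \<subseteq> lie_bracket (aff c (\<lambda>_. 0) 1) ` G"
      using bracket_onto_sum_V(2)[OF S, of c] by blast
  qed
  have f26: "derived G = ?h" if "G = VF.span (?h \<union> {aff c (\<lambda>_. 0) 1, aff 1 w 0})"
    "w holomorphic_on UNIV" "fun_dx (\<lambda>y. deriv w y - c * w y) \<in> ?h" for c w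
    by (rule derived_span_sum_V[OF S that(2,3,1)]) simp
  show ?thesis
    using G unfolding normal_form_def
  proof (elim disjE)
    assume "G = VF.span (?h \<union> {d_y}) \<and> \<not> is_eigenvalue d_y ?h 0"
    then show ?thesis using f14[of 0] by (simp add: d_y_aff)
  next
    assume "G = VF.span (?h \<union> {d_y, x_dx})"
    then show ?thesis
      using f26[of 0 "\<lambda>_. 0"] VF.subspace_0[OF sub] fun_dx_eq_0[of "\<lambda>_. 0"] by (simp add: d_y_aff x_dx_aff)
  next
    assume "\<exists>N. N = eigenvalue_mult d_y ?h 0 \<and> G = VF.span (?h \<union> {d_y, fun_dx (\<lambda>y. y ^ N)})"
    then show ?thesis using f35[of 0] eigenvalue_mult_sum_V[OF S, of 0] by (simp add: d_y_aff)
  next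
    assume "G = VF.span (?h \<union> {x_dx + d_y}) \<and> \<not> is_eigenvalue (x_dx + d_y) ?h 0"
    then show ?thesis using f14[of 1] by (simp add: z)
  next
    assume "\<exists>N. N = eigenvalue_mult (x_dx + d_y) ?h 0 \<and> G = VF.span (?h \<union> {x_dx + d_y, fun_dx (\<lambda>y. y ^ N * exp y)})"
    then show ?thesis using f35[of 1] eigenvalue_mult_sum_V[OF S, of 1] by (simp add: z)
  next
    assume *: "\<exists>N. N = eigenvalue_mult (x_dx + d_y) ?h 0 \<and> N > 0 \<and>
        G = VF.span (?h \<union> {x_dx + d_y, x_dx + fun_dx (\<lambda>y. y ^ N * exp y)})"
    have "x_dx + fun_dx w = aff 1 w 0" for w by (simp add: x_dx_aff fun_dx_aff aff_add)
    with * have "G = VF.span (?h \<union> {aff 1 (\<lambda>_. 0) 1, aff 1 (\<lambda>y. y ^ mult_of S n 1 * exp (1 * y)) 0})"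
      using eigenvalue_mult_sum_V[OF S, of 1] by (simp add: z)
    then show ?thesis
      by (rule f26) (intro holomorphic_intros, rule monomial_deriv_in_sum_V[OF S])
  qed
qed

section \<open>Change of coordinates\<close>

lemma smooth_on_cong:
  assumes "open U" "smooth_on U f" "\<And>q. q \<in> U \<Longrightarrow> f q = g q"
  shows "smooth_on U g"
  by (rule smooth_onI[OF assms(1)], rule has_pd_cong[OF smooth_on_has_pd[OF assms(2,1)] assms(1)])
    (use assms(3) in auto)

lemma smooth_on_const: "open U \<Longrightarrow> smooth_on U (\<lambda>_. c)"
  by (rule smooth_onI, assumption, rule has_pd_const)

context
  fixes U f g
  assumes U: "open U" and f: "smooth_on U f" and g: "smooth_on U g"
begin

lemma smooth_on_add: "smooth_on U (\<lambda>p. f p + g p)"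
  by (rule smooth_onI[OF U], rule has_pd_add[OF smooth_on_has_pd[OF f U] smooth_on_has_pd[OF g U]])

lemma smooth_on_diff: "smooth_on U (\<lambda>p. f p - g p)"
  by (rule smooth_onI[OF U], rule has_pd_diff[OF smooth_on_has_pd[OF f U] smooth_on_has_pd[OF g U]])

lemma smooth_on_mult: "smooth_on U (\<lambda>p. f p * g p)"
  by (rule smooth_onI[OF U], rule has_pd_mult[OF smooth_on_has_pd[OF f U] smooth_on_has_pd[OF g U]])

end

lemma smooth_on_comp1:
  assumes U: "open U" and f: "smooth_on U f" and h: "\<And>p. p \<in> U \<Longrightarrow> (h has_field_derivative h' (f p)) (at (f p))"
  shows "smooth_on U (\<lambda>p. h (f p))"
  by (rule smooth_onI[OF U], rule has_pd_comp1[OF smooth_on_has_pd[OF f U] h])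

lemma smooth_on_exp: "open U \<Longrightarrow> smooth_on U f \<Longrightarrow> smooth_on U (\<lambda>p. exp (f p))"
  by (rule smooth_on_comp1) (auto intro: DERIV_exp)

lemma smooth_on_divide:
  assumes U: "open U" and f: "smooth_on U f" and g: "smooth_on U g" and nz: "\<And>p. p \<in> U \<Longrightarrow> g p \<noteq> 0"
  shows "smooth_on U (\<lambda>p. f p / g p)"
proof -
  have "smooth_on U (\<lambda>p. inverse (g p))"
    by (rule smooth_on_comp1[OF U g, of inverse "\<lambda>z. - (inverse z ^ Suc (Suc 0))"], rule DERIV_inverse, rule nz)
  from smooth_on_mult[OF U f this] show ?thesis by (simp add: divide_inverse)
qed

lemma smooth_on_vf_apply:
  assumes "open U" "smooth_map_on U X" "smooth_on U f"
  shows "smooth_on U (vf_apply X f)"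
  using assms unfolding vf_apply_def[abs_def] smooth_map_on_def
  by (intro smooth_on_add smooth_on_mult smooth_on_pdx smooth_on_pdy) auto

lemma has_pd_smooth_comp:
  assumes "open U" "smooth_map_on U F" "p \<in> U" "has_pd f a b (F p)"
  shows "has_pd (\<lambda>q. f (F q)) (a * pdx (\<lambda>q. fst (F q)) p + b * pdx (\<lambda>q. snd (F q)) p)
    (a * pdy (\<lambda>q. fst (F q)) p + b * pdy (\<lambda>q. snd (F q)) p) p"
  using assms by (intro has_pd_comp smooth_on_has_pd[OF _ assms(1,3)]) (auto simp: smooth_map_on_def)

lemma smooth_on_comp:
  assumes U: "open U" and D: "open D" and F: "smooth_map_on U F" "\<And>p. p \<in> U \<Longrightarrow> F p \<in> D" and f: "smooth_on D f"
  shows "smooth_on U (\<lambda>p. f (F p))"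
  by (rule smooth_onI[OF U], rule has_pd_smooth_comp[OF U F(1) _ smooth_on_has_pd[OF f D F(2)]])

text \<open>The second order terms cancel by the symmetry of mixed derivatives.\<close>

lemma vf_apply_bracket:
  assumes U: "open U" "p \<in> U" and X: "smooth_map_on U X" and Y: "smooth_map_on U Y" and f: "smooth_on U f"
  shows "vf_apply (lie_bracket X Y) f p = vf_apply X (vf_apply Y f) p - vf_apply Y (vf_apply X f) p"
proof -
  have fxy: "pdy (pdx f) p = pdx (pdy f) p"
    using pdx_pdy_commute[OF U(1) _ U(2)] f U(1) smooth_on_iff_sep_holo by blast
  note pd = smooth_on_has_pd[OF _ U]
  have app: "has_pd (vf_apply Z f)
      (pdx (\<lambda>q. fst (Z q)) p * pdx f p + fst (Z p) * pdx (pdx f) p + (pdx (\<lambda>q. snd (Z q)) p * pdy f p + snd (Z p) * pdx (pdy f) p))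
      (pdy (\<lambda>q. fst (Z q)) p * pdx f p + fst (Z p) * pdy (pdx f) p + (pdy (\<lambda>q. snd (Z q)) p * pdy f p + snd (Z p) * pdy (pdy f) p)) p"
    if "smooth_map_on U Z" for Z
    unfolding vf_apply_def using that f U
    by (intro has_pd_add has_pd_mult pd smooth_on_pdx smooth_on_pdy) (auto simp: smooth_map_on_def)
  show ?thesis
    unfolding vf_apply_def[of _ "vf_apply _ f"] has_pdD[OF app[OF X]] has_pdD[OF app[OF Y]] fxy
    unfolding lie_bracket_def vf_apply_def fst_conv snd_conv
    by (simp add: algebra_simps)
qed

section \<open>Push-forward of vector fields along local coordinates\<close>

locale coords =
  fixes W \<phi>
  assumes lc: "local_coordinates W \<phi>"
begin

abbreviation "\<psi> \<equiv> the_inv_into W \<phi>"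
abbreviation "push \<equiv> in_coordinates W \<phi>"

lemma W: "open W" and W_ne: "W \<noteq> {}" and inj: "inj_on \<phi> W" and open_img: "open (\<phi> ` W)" and smooth: "smooth_map_on W \<phi>"
  and smooth_inv: "smooth_map_on (\<phi> ` W) \<psi>"
  using lc by (auto simp: local_coordinates_def)

lemma inv: "p \<in> W \<Longrightarrow> \<psi> (\<phi> p) = p"
  by (simp add: inj the_inv_into_f_f)

lemma inv_mem: "q \<in> \<phi> ` W \<Longrightarrow> \<psi> q \<in> W" "q \<in> \<phi> ` W \<Longrightarrow> \<phi> (\<psi> q) = q"
  by (auto simp: inv)

lemma push_apply: "p \<in> W \<Longrightarrow> push X (\<phi> p) = (vf_apply X (\<lambda>r. fst (\<phi> r)) p, vf_apply X (\<lambda>r. snd (\<phi> r)) p)"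
  by (simp add: in_coordinates_def vf_restrict_def inv)

lemma push_outside: "q \<notin> \<phi> ` W \<Longrightarrow> push X q = 0"
  by (simp add: in_coordinates_def vf_restrict_def)

lemma push_add: "push (X + Y) = push X + push Y"
  and push_scale: "push (vf_scale c X) = vf_scale c (push X)"
  by (auto simp: in_coordinates_def vf_restrict_def Let_def fun_eq_iff vf_apply_def vf_scale_def pt_scale_def
    algebra_simps zero_prod_def)

lemma push_smooth:
  assumes "smooth_map_on W X"
  shows "smooth_map_on (\<phi> ` W) (push X)"
  unfolding smooth_map_on_def
proof (intro conjI)
  have *: "smooth_on (\<phi> ` W) (\<lambda>q. vf_apply X g (\<psi> q))" if "smooth_on W g" for g
    by (intro smooth_on_comp[OF open_img W smooth_inv inv_mem(1)] smooth_on_vf_apply W assms that)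
  have e: "push X q = (vf_apply X (\<lambda>r. fst (\<phi> r)) (\<psi> q), vf_apply X (\<lambda>r. snd (\<phi> r)) (\<psi> q))" if "q \<in> \<phi> ` W" for q
    using push_apply[OF inv_mem(1)[OF that]] inv_mem(2)[OF that] by simp
  show "smooth_on (\<phi> ` W) (\<lambda>q. fst (push X q))"
    by (rule smooth_on_cong[OF open_img *]) (use smooth in \<open>auto simp: smooth_map_on_def e\<close>)
  show "smooth_on (\<phi> ` W) (\<lambda>q. snd (push X q))"
    by (rule smooth_on_cong[OF open_img *]) (use smooth in \<open>auto simp: smooth_map_on_def e\<close>)
qed

text \<open>The chain rule, in the form that characterizes the push-forward: derivations correspond
  under composition with \<open>\<phi>\<close>.\<close>

lemma vf_apply_push:
  assumes "p \<in> W" "has_pd f a b (\<phi> p)"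
  shows "vf_apply (push X) f (\<phi> p) = vf_apply X (\<lambda>r. f (\<phi> r)) p"
  unfolding vf_apply_def has_pdD[OF assms(2)] push_apply[OF assms(1)]
    has_pdD[OF has_pd_smooth_comp[OF W smooth assms(1,2)]]
  by (simp add: vf_apply_def algebra_simps)

text \<open>The components of a pushed field are the field applied to the components of
  \<open>\<phi>\<close>, so both sides reduce to \<open>vf_apply_bracket\<close> for these two
  functions.\<close>

lemma push_bracket:
  assumes X: "smooth_map_on W X" and Y: "smooth_map_on W Y"
  shows "push (lie_bracket X Y) = lie_bracket (push X) (push Y)"
proof
  fix q
  show "push (lie_bracket X Y) q = lie_bracket (push X) (push Y) q"
  proof (cases "q \<in> \<phi> ` W")
    case False
    then show ?thesis by (simp add: push_outside lie_bracket_outside)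
  next
    case True
    then obtain p where p: "p \<in> W" "q = \<phi> p" by blast
    \<comment> \<open>Iterated derivatives along pushed fields are pulled back to W; c selects the
      component.\<close>
    have comp: "vf_apply (push A) (\<lambda>q. c (push B q)) q = vf_apply A (vf_apply B (\<lambda>r. c (\<phi> r))) p"
      if "smooth_map_on W B" "c = fst \<or> c = snd" for A B c
    proof -
      have "smooth_on (\<phi> ` W) (\<lambda>q. c (push B q))"
        using push_smooth[OF that(1)] that(2) by (auto simp: smooth_map_on_def)
      from smooth_on_has_pd[OF this open_img True]
      have "vf_apply (push A) (\<lambda>q. c (push B q)) q = vf_apply A (\<lambda>r. c (push B (\<phi> r))) p"
        unfolding p(2) by (rule vf_apply_push[OF p(1)])
      also have "\<dots> = vf_apply A (vf_apply B (\<lambda>r. c (\<phi> r))) p"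
        using that(2) by (intro vf_apply_cong[OF W p(1)]) (auto simp: push_apply)
      finally show ?thesis .
    qed
    have sm: "smooth_on W (\<lambda>r. fst (\<phi> r))" "smooth_on W (\<lambda>r. snd (\<phi> r))"
      using smooth by (auto simp: smooth_map_on_def)
    show ?thesis
      unfolding lie_bracket_def[of "push X"]
      by (simp add: comp X Y p(2)[symmetric] comp[OF X, of fst, simplified] comp[OF Y, of fst, simplified] comp[OF X, of snd, simplified] comp[OF Y, of snd, simplified])
         (simp add: p(2) push_apply[OF p(1)] vf_apply_bracket[OF W p(1) X Y sm(1)] vf_apply_bracket[OF W p(1) X Y sm(2)])
  qed
qed

end

text \<open>Serves both for the push-forward and for the restriction to an open set.\<close>

lemma derived_image:
  assumes add: "\<And>X Y. T (X + Y) = T X + T Y" and scale: "\<And>c X. T (vf_scale c X) = vf_scale c (T X)"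
    and br: "\<And>X Y. X \<in> g \<Longrightarrow> Y \<in> g \<Longrightarrow> T (lie_bracket X Y) = lie_bracket (T X) (T Y)"
  shows "T ` derived g = derived (T ` g)"
proof -
  have "T ` {lie_bracket X Y | X Y. X \<in> g \<and> Y \<in> g} = {lie_bracket X Y | X Y. X \<in> T ` g \<and> Y \<in> T ` g}"
  proof (intro equalityI subsetI)
    fix Z assume "Z \<in> T ` {lie_bracket X Y | X Y. X \<in> g \<and> Y \<in> g}"
    then obtain X Y where "Z = T (lie_bracket X Y)" "X \<in> g" "Y \<in> g" by blast
    with br[of X Y] show "Z \<in> {lie_bracket X Y | X Y. X \<in> T ` g \<and> Y \<in> T ` g}" by blast
  next
    fix Z assume "Z \<in> {lie_bracket X Y | X Y. X \<in> T ` g \<and> Y \<in> T ` g}"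
    then obtain X Y where Z: "Z = lie_bracket (T X) (T Y)" "X \<in> g" "Y \<in> g" by blast
    then have "Z = T (lie_bracket X Y)" using br[of X Y] by simp
    with Z(2,3) show "Z \<in> T ` {lie_bracket X Y | X Y. X \<in> g \<and> Y \<in> g}" by blast
  qed
  then show ?thesis unfolding commutator_def vf_linear_span_image[OF add scale] by simp
qed

lemma smooth_map_on_subset: "smooth_map_on U X \<Longrightarrow> open U \<Longrightarrow> open W \<Longrightarrow> W \<subseteq> U \<Longrightarrow> smooth_map_on W X"
  using smooth_on_subset unfolding smooth_map_on_def by blast

lemma (in coords) push_derived:
  assumes "open U" "lie_algebra_on U g" "W \<subseteq> U"
  shows "push ` derived g = derived (push ` g)"
proof (rule derived_image[OF push_add push_scale])
  fix X Y assume "X \<in> g" "Y \<in> g"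
  then have "smooth_map_on W X" "smooth_map_on W Y"
    using assms smooth_map_on_subset[OF _ assms(1) W assms(3)]
    unfolding lie_algebra_on_def vector_field_on_def by blast+
  then show "push (lie_bracket X Y) = lie_bracket (push X) (push Y)"
    by (rule push_bracket)
qed

text \<open>Push-forward and restriction both preserve commutator algebras, which leaves the
  computation with the normal forms on all of C^2.\<close>

lemma derived_eq_sum_V:
  assumes U: "open U" "lie_algebra_on U g" and W: "W \<subseteq> U" "local_coordinates W \<phi>"
    and S: "finite S" "\<forall>\<mu>\<in>S. n \<mu> > 0" and f: "has_form_in W \<phi> g (sum_V S n)"
  shows "in_coordinates W \<phi> ` derived g = vf_restrict (\<phi> ` W) ` sum_V S n"
proof -
  interpret coords W \<phi> using W(2) by unfold_locales
  obtain G where G: "normal_form (sum_V S n) G" "push ` g = vf_restrict (\<phi> ` W) ` G"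
    using f unfolding has_form_in_def by blast
  have "push ` derived g = derived (vf_restrict (\<phi> ` W) ` G)"
    using push_derived[OF U assms(3)] G(2) by simp
  also have "\<dots> = vf_restrict (\<phi> ` W) ` derived G"
    by (rule derived_image[OF vf_restrict_add vf_restrict_scale, symmetric]) (simp add: lie_bracket_restrict open_img)
  finally show ?thesis using normal_form_derived[OF S G(1)] by simp
qed

section \<open>Potentials of closed forms\<close>

text \<open>F(x, y) is a primitive of f1 along y = b plus the integral of f2 from (x, b) to (x, y).
  By closedness the second part has x-derivative f1(x, y) - f1(x, b), and the sum
  telescopes.\<close>

lemma poincare:
  assumes A: "open A" "convex A" and B: "open B" "convex B" "b \<in> B"
    and f1: "smooth_on (A \<times> B) f1" and f2: "smooth_on (A \<times> B) f2"
    and closed: "\<And>p. p \<in> A \<times> B \<Longrightarrow> pdy f1 p = pdx f2 p"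
  shows "\<exists>F. \<forall>p\<in>A \<times> B. has_pd F (f1 p) (f2 p) p"
proof -
  have U: "open (A \<times> B)" using A B by (simp add: open_Times)
  have s1: "sep_holo (A \<times> B) f1" and s2: "sep_holo (A \<times> B) f2"
    using f1 f2 by (simp_all add: smooth_on_iff_sep_holo U)
  have "(\<lambda>x. f1 (x, b)) holomorphic_on A" using B(3) by (intro sep_holo_fst[OF s1]) auto
  from holomorphic_convex_primitive'[OF A(2,1) this] obtain P
    where P': "\<And>x. x \<in> A \<Longrightarrow> (P has_field_derivative f1 (x, b)) (at x within A)" by blast
  have P: "(P has_field_derivative f1 (x, b)) (at x)" if "x \<in> A" for x
    using P'[OF that] unfolding at_within_open[OF that A(1)] .
  have hy: "(\<lambda>y. f (x, y)) holomorphic_on B" if "sep_holo (A \<times> B) f" "x \<in> A" for f x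
    unfolding holomorphic_on_def
  proof
    fix y assume "y \<in> B"
    with sep_holo_pd(1)[OF that(1), of "(x, y)"] that(2)
    show "(\<lambda>y. f (x, y)) field_differentiable at y within B"
      unfolding field_differentiable_def by (auto intro: has_field_derivative_at_within)
  qed
  have seg: "linepath b y t \<in> B" if "y \<in> B" "t \<in> {0..1}" for y t
    using that B linepath_in_convex_hull[of b B y t] by (simp add: hull_same)
  have cont: "continuous_on (A \<times> {0..1}) (\<lambda>q. f (fst q, linepath b y (snd q)))"
    if "continuous_on (A \<times> B) f" "y \<in> B" for f :: "C2 \<Rightarrow> complex" and y
    using seg[OF that(2)]
    by (intro continuous_on_compose2[OF that(1)]) (auto intro!: continuous_intros simp: linepath_def)
  \<comment> \<open>The vertical integral is taken over the parameter interval of the segment, so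
    that x can be differentiated under it.\<close>
  define I where "I x y = integral (cbox 0 1) (\<lambda>t. f2 (x, linepath b y t) * (y - b))" for x y
  have FTC: "integral (cbox 0 1) (\<lambda>t. Q' (linepath b y t) * (y - b)) = Q y - Q b"
    if "\<And>z. z \<in> B \<Longrightarrow> (Q has_field_derivative Q' z) (at z within B)" "y \<in> B" for Q Q' y
  proof -
    have "(Q' has_contour_integral Q (pathfinish (linepath b y)) - Q (pathstart (linepath b y))) (linepath b y)"
      using that(2) B(2,3) by (intro contour_integral_primitive[OF that(1)]) (auto simp: closed_segment_subset)
    then have "((\<lambda>t. Q' (linepath b y t) * (y - b)) has_integral Q y - Q b) {0..1}"
      by (simp add: has_contour_integral_linepath)
    then show ?thesis by (simp only: integral_unique cbox_interval)
  qed
  have Iy: "((\<lambda>y. I x y) has_field_derivative f2 (x, y)) (at y)" if x: "x \<in> A" and y: "y \<in> B" for x y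
  proof -
    obtain Q where Q: "\<And>z. z \<in> B \<Longrightarrow> (Q has_field_derivative f2 (x, z)) (at z within B)"
      using holomorphic_convex_primitive'[OF B(2,1) hy[OF s2 x]] by blast
    have "(Q has_field_derivative f2 (x, y)) (at y)"
      using Q[OF y] unfolding at_within_open[OF y B(1)] .
    from DERIV_diff[OF this DERIV_const[of "Q b"]]
    have "((\<lambda>y. Q y - Q b) has_field_derivative f2 (x, y)) (at y)" by simp
    then show ?thesis
      by (rule has_field_derivative_transform_within_open[OF _ B(1) y]) (unfold I_def, rule FTC[OF Q, symmetric])
  qed
  have Ix: "((\<lambda>x. I x y) has_field_derivative f1 (x, y) - f1 (x, b)) (at x)" if x: "x \<in> A" and y: "y \<in> B" for x y
  proof -
    have "((\<lambda>x. I x y) has_field_derivative integral (cbox 0 1) (\<lambda>t. pdx f2 (x, linepath b y t) * (y - b))) (at x within A)"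
      unfolding I_def
    proof (rule leibniz_rule_field_derivative[OF _ _ _ x A(2)])
      fix x' t assume x': "x' \<in> A" and t: "t \<in> cbox (0::real) 1"
      have "((\<lambda>x. f2 (x, linepath b y t)) has_field_derivative pdx f2 (x', linepath b y t)) (at x')"
      proof -
        have "(x', linepath b y t) \<in> A \<times> B" using x' seg[OF y] t by (simp add: cbox_interval)
        from sep_holo_pd(2)[OF s2 this] show ?thesis by (simp only: fst_conv snd_conv)
      qed
      then show "((\<lambda>x. f2 (x, linepath b y t) * (y - b)) has_field_derivative pdx f2 (x', linepath b y t) * (y - b)) (at x' within A)"
        by (rule has_field_derivative_at_within[OF DERIV_cmult_right])
    next
      fix x' assume x': "x' \<in> A"
      have "continuous_on (cbox 0 1) (\<lambda>t::real. (x', t))" by (intro continuous_intros)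
      from continuous_on_compose2[OF cont[OF smooth_on_continuous[OF f2] y] this]
      have "continuous_on (cbox 0 1) (\<lambda>t. f2 (x', linepath b y t))" using x' by (auto simp: cbox_interval)
      then show "(\<lambda>t. f2 (x', linepath b y t) * (y - b)) integrable_on cbox 0 1"
        by (intro integrable_continuous continuous_intros)
    next
      show "continuous_on (A \<times> cbox 0 1) (\<lambda>(x, t). pdx f2 (x, linepath b y t) * (y - b))"
        using cont[OF continuous_on_pdx[OF U s2] y] unfolding case_prod_beta cbox_interval
        by (intro continuous_intros)
    qed
    \<comment> \<open>Closedness trades the x-derivative of f2 for the y-derivative of f1, which
      integrates back.\<close>
    also have "integral (cbox 0 1) (\<lambda>t. pdx f2 (x, linepath b y t) * (y - b)) =
       integral (cbox 0 1) (\<lambda>t. pdy f1 (x, linepath b y t) * (y - b))"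
      using seg[OF y] x closed by (intro integral_cong) (simp add: cbox_interval)
    also have "\<dots> = f1 (x, y) - f1 (x, b)"
    proof (rule FTC[OF _ y])
      fix z assume "z \<in> B"
      with x have "(x, z) \<in> A \<times> B" by simp
      from sep_holo_pd(1)[OF s1 this]
      have "((\<lambda>y. f1 (x, y)) has_field_derivative pdy f1 (x, z)) (at z)" by (simp only: fst_conv snd_conv)
      then show "((\<lambda>y. f1 (x, y)) has_field_derivative pdy f1 (x, z)) (at z within B)"
        by (rule has_field_derivative_at_within)
    qed
    finally show ?thesis unfolding at_within_open[OF x A(1)] .
  qed
  define F where "F = (\<lambda>p. P (fst p) + I (fst p) (snd p))"
  have "has_pd F (f1 p) (f2 p) p" if p: "p \<in> A \<times> B" for p
  proof (rule has_pd_partials[OF U p])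
    fix q assume q: "q \<in> A \<times> B"
    then have q': "fst q \<in> A" "snd q \<in> B" by auto
    show "((\<lambda>t. F (t, snd q)) has_field_derivative f1 q) (at (fst q))"
      using DERIV_add[OF P[OF q'(1)] Ix[OF q']] by (simp add: F_def)
    show "((\<lambda>t. F (fst q, t)) has_field_derivative f2 q) (at (snd q))"
      using DERIV_add[OF DERIV_const[of "P (fst q)"] Iy[OF q']] by (simp add: F_def)
  qed (rule smooth_on_continuous[OF f2])
  then show ?thesis by blast
qed

text \<open>The system X F = u, Z F = v reads dF = f1 dx + f2 dy with f1, f2 from Cramer's rule. The
  condition on u, v and c is [X, Z] F = c X F written out, and it amounts to closedness.\<close>

lemma frobenius:
  assumes A: "open A" "convex A" and B: "open B" "convex B" "b \<in> B"
    and X: "smooth_map_on (A \<times> B) X" and Z: "smooth_map_on (A \<times> B) Z"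
    and u: "smooth_on (A \<times> B) u" and v: "smooth_on (A \<times> B) v"
    and indep: "\<And>p. p \<in> A \<times> B \<Longrightarrow> fst (X p) * snd (Z p) - snd (X p) * fst (Z p) \<noteq> 0"
    and br: "\<And>p. p \<in> A \<times> B \<Longrightarrow> lie_bracket X Z p = pt_scale (c p) (X p)"
    and uv: "\<And>p. p \<in> A \<times> B \<Longrightarrow> vf_apply X v p - vf_apply Z u p = c p * u p"
  shows "\<exists>F. smooth_on (A \<times> B) F \<and> (\<forall>p\<in>A \<times> B. vf_apply X F p = u p \<and> vf_apply Z F p = v p)"
proof -
  have U: "open (A \<times> B)" using A B by (simp add: open_Times)
  define D where "D p = fst (X p) * snd (Z p) - snd (X p) * fst (Z p)" for p
  define f1 where "f1 p = (u p * snd (Z p) - v p * snd (X p)) / D p" for p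
  define f2 where "f2 p = (v p * fst (X p) - u p * fst (Z p)) / D p" for p
  have D: "D p \<noteq> 0" if "p \<in> A \<times> B" for p using indep[OF that] by (simp add: D_def)
  have sm: "smooth_on (A \<times> B) (\<lambda>q. fst (X q))" "smooth_on (A \<times> B) (\<lambda>q. snd (X q))"
    "smooth_on (A \<times> B) (\<lambda>q. fst (Z q))" "smooth_on (A \<times> B) (\<lambda>q. snd (Z q))"
    using X Z by (auto simp: smooth_map_on_def)
  have sD: "smooth_on (A \<times> B) D"
    unfolding D_def by (intro smooth_on_diff smooth_on_mult U sm)
  have s1: "smooth_on (A \<times> B) f1" and s2: "smooth_on (A \<times> B) f2"
    unfolding f1_def f2_def by (intro smooth_on_divide smooth_on_diff smooth_on_mult U sm sD u v D; assumption)+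
  have eu: "f1 p * fst (X p) + f2 p * snd (X p) = u p" and ev: "f1 p * fst (Z p) + f2 p * snd (Z p) = v p"
    if "p \<in> A \<times> B" for p
    using D[OF that] unfolding f1_def f2_def by (auto simp: field_simps) (auto simp: D_def algebra_simps)
  have "pdy f1 p = pdx f2 p" if p: "p \<in> A \<times> B" for p
  proof -
    note pd = smooth_on_has_pd[OF _ U p]
    have pu: "has_pd u
      (pdx f1 p * fst (X p) + f1 p * pdx (\<lambda>q. fst (X q)) p + (pdx f2 p * snd (X p) + f2 p * pdx (\<lambda>q. snd (X q)) p))
      (pdy f1 p * fst (X p) + f1 p * pdy (\<lambda>q. fst (X q)) p + (pdy f2 p * snd (X p) + f2 p * pdy (\<lambda>q. snd (X q)) p)) p"
      by (rule has_pd_cong[OF _ U p eu]) (intro has_pd_add has_pd_mult pd s1 s2 sm)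
    have pv: "has_pd v
      (pdx f1 p * fst (Z p) + f1 p * pdx (\<lambda>q. fst (Z q)) p + (pdx f2 p * snd (Z p) + f2 p * pdx (\<lambda>q. snd (Z q)) p))
      (pdy f1 p * fst (Z p) + f1 p * pdy (\<lambda>q. fst (Z q)) p + (pdy f2 p * snd (Z p) + f2 p * pdy (\<lambda>q. snd (Z q)) p)) p"
      by (rule has_pd_cong[OF _ U p ev]) (intro has_pd_add has_pd_mult pd s1 s2 sm)
    \<comment> \<open>The invariant formula for the exterior derivative of f1 dx + f2 dy, evaluated
      on X and Z.\<close>
    have "vf_apply X v p - vf_apply Z u p = D p * (pdx f2 p - pdy f1 p) +
        f1 p * fst (lie_bracket X Z p) + f2 p * snd (lie_bracket X Z p)"
      unfolding lie_bracket_def vf_apply_def fst_conv snd_conv has_pdD[OF pu] has_pdD[OF pv] D_def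
      by (simp add: algebra_simps)
    also have "f1 p * fst (lie_bracket X Z p) = c p * (f1 p * fst (X p))"
      unfolding br[OF p] by (simp add: pt_scale_def)
    also have "f2 p * snd (lie_bracket X Z p) = c p * (f2 p * snd (X p))"
      unfolding br[OF p] by (simp add: pt_scale_def)
    finally have "D p * (pdx f2 p - pdy f1 p) = 0"
      unfolding uv[OF p] eu[OF p, symmetric] by (auto simp: algebra_simps)
    then show ?thesis using D[OF p] by simp
  qed
  from poincare[OF A B s1 s2 this] obtain F where F: "\<forall>p\<in>A \<times> B. has_pd F (f1 p) (f2 p) p" by blast
  have "vf_apply X F p = u p \<and> vf_apply Z F p = v p" if p: "p \<in> A \<times> B" for p
    using has_pdD[OF F[rule_format, OF p]] eu[OF p] ev[OF p] by (simp add: vf_apply_def algebra_simps)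
  moreover have "smooth_on (A \<times> B) F" using F by (auto intro: smooth_onI[OF U])
  ultimately show ?thesis by blast
qed

section \<open>Adapted coordinates\<close>

text \<open>The inverse function theorem is applied over the reals, where C^2 has dimension
  4.\<close>

lemma C2_Basis: "(Basis :: C2 set) = {(1, 0), (\<i>, 0), (0, 1), (0, \<i>)}"
  by (auto simp: Basis_prod_def Basis_complex_def)

text \<open>The real derivative of the inverse map is the inverse of a complex linear map, hence
  complex linear, so the inverse is smooth in the complex sense.\<close>

lemma holomorphic_inverse_function:
  assumes U: "open U" "p0 \<in> U" and F: "smooth_map_on U F"
    and det: "\<And>p. p \<in> U \<Longrightarrow> pdx (\<lambda>q. fst (F q)) p * pdy (\<lambda>q. snd (F q)) p -
      pdy (\<lambda>q. fst (F q)) p * pdx (\<lambda>q. snd (F q)) p \<noteq> 0"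
  obtains U' D G where "open U'" "U' \<subseteq> U" "p0 \<in> U'" "open D" "F p0 \<in> D" "homeomorphism U' D F G"
    "smooth_map_on D G"
proof -
  define xx and xy and yx and yy where "xx = pdx (\<lambda>q. fst (F q))" and "xy = pdy (\<lambda>q. fst (F q))"
    and "yx = pdx (\<lambda>q. snd (F q))" and "yy = pdy (\<lambda>q. snd (F q))"
  note defs = xx_def xy_def yx_def yy_def
  define d where "d p = xx p * yy p - xy p * yx p" for p
  have d: "d p \<noteq> 0" if "p \<in> U" for p using det[OF that] by (simp add: d_def defs)
  define L where "L p h = (xx p * fst h + xy p * snd h, yx p * fst h + yy p * snd h)" for p and h :: C2
  \<comment> \<open>The inverse of the Jacobian \<open>L p\<close> by the adjugate formula.\<close>
  define M where "M p k = ((yy p * fst k - xy p * snd k) / d p, (xx p * snd k - yx p * fst k) / d p)" for p and k :: C2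
  have M_L: "M p (L p h) = h" if "p \<in> U" for p h
    using d[OF that] unfolding L_def M_def by (auto simp: prod_eq_iff field_simps) (auto simp: d_def algebra_simps)
  have bl: "bounded_linear (L p)" and bm: "bounded_linear (M p)" for p
    unfolding L_def[abs_def] M_def[abs_def] divide_inverse
    by (intro bounded_linear_Pair bounded_linear_add bounded_linear_sub bounded_linear_mult_left[THEN bounded_linear_compose]
      bounded_linear_mult_right[THEN bounded_linear_compose] bounded_linear_fst bounded_linear_snd)+
  have der: "(F has_derivative L p) (at p)" if "p \<in> U" for p
    using has_derivative_Pair[OF smooth_on_has_pd[OF _ U(1) that, unfolded has_pd_def] smooth_on_has_pd[OF _ U(1) that, unfolded has_pd_def],
      of "\<lambda>q. fst (F q)" "\<lambda>q. snd (F q)"] F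
    by (simp add: smooth_map_on_def L_def[abs_def] defs)
  have sm: "smooth_on U xx" "smooth_on U xy" "smooth_on U yx" "smooth_on U yy"
    using F U unfolding defs smooth_map_on_def by (auto intro: smooth_on_pdx smooth_on_pdy)
  obtain U' D G G' where *: "open U'" "U' \<subseteq> U" "p0 \<in> U'" "open D" "F p0 \<in> D" "homeomorphism U' D F G"
    and G': "\<And>y. y \<in> D \<Longrightarrow> (G has_derivative (G' y)) (at y)"
      "\<And>y. y \<in> D \<Longrightarrow> G' y = inv (blinfun_apply (Blinfun (L (G y))))" "\<And>y. y \<in> D \<Longrightarrow> bij (blinfun_apply (Blinfun (L (G y))))"
  proof (rule inverse_function_theorem[where U = U and f = F and f' = "\<lambda>p. Blinfun (L p)" and ?x0.0 = p0 and invf = "Blinfun (M p0)"])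
    show "(F has_derivative blinfun_apply (Blinfun (L p))) (at p)" if "p \<in> U" for p
      using der[OF that] by (simp add: bounded_linear_Blinfun_apply[OF bl])
    show "continuous_on U (\<lambda>p. Blinfun (L p))"
      by (rule continuous_on_blinfun_componentwise)
         (use sm[THEN smooth_on_continuous] in \<open>auto simp: bounded_linear_Blinfun_apply[OF bl] L_def C2_Basis intro!: continuous_intros\<close>)
    show "Blinfun (M p0) o\<^sub>L Blinfun (L p0) = id_blinfun"
      by (rule blinfun_eqI) (simp add: bounded_linear_Blinfun_apply[OF bl] bounded_linear_Blinfun_apply[OF bm] M_L U)
  qed (use U in blast)+
  have "smooth_map_on D G"
  proof -
    have "has_pd (\<lambda>q. fst (G q)) (yy (G q) / d (G q)) (- xy (G q) / d (G q)) q \<and>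
      has_pd (\<lambda>q. snd (G q)) (- yx (G q) / d (G q)) (xx (G q) / d (G q)) q" if q: "q \<in> D" for q
    proof -
      have Gq: "G q \<in> U" using * q by (auto simp: homeomorphism_def)
      \<comment> \<open>The derivative is given only as an abstract inverse; applying M to L (G' k)
        = k makes it explicit.\<close>
      have "G' q = M (G q)"
      proof
        fix k
        have "L (G q) (G' q k) = k"
          using surj_f_inv_f[OF bij_is_surj[OF G'(3)[OF q]], of k]
          unfolding G'(2)[OF q] bounded_linear_Blinfun_apply[OF bl] .
        then show "G' q k = M (G q) k" using M_L[OF Gq, of "G' q k"] by simp
      qed
      then have "(G has_derivative M (G q)) (at q)" using G'(1)[OF q] by simp
      from has_derivative_fst[OF this] has_derivative_snd[OF this] show ?thesis
        unfolding has_pd_def M_def by (simp add: diff_divide_distrib algebra_simps)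
    qed
    then show ?thesis unfolding smooth_map_on_def
      by (intro conjI smooth_onI[OF *(4)]) blast+
  qed
  with * that show ?thesis by blast
qed

text \<open>Shrinking the target to a product of discs makes it possible to argue separately along
  the lines of constant y and of constant x.\<close>

lemma local_coordinates_box:
  assumes U: "open U" "p0 \<in> U" and F: "smooth_map_on U F"
    and det: "\<And>p. p \<in> U \<Longrightarrow> pdx (\<lambda>q. fst (F q)) p * pdy (\<lambda>q. snd (F q)) p -
      pdy (\<lambda>q. fst (F q)) p * pdx (\<lambda>q. snd (F q)) p \<noteq> 0"
  obtains W a b r where "W \<subseteq> U" "local_coordinates W F" "r > 0" "F ` W = ball a r \<times> ball b r"
proof -
  obtain U' D G where *: "open U'" "U' \<subseteq> U" "p0 \<in> U'" "open D" "F p0 \<in> D" "homeomorphism U' D F G"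
    "smooth_map_on D G"
    using holomorphic_inverse_function[OF assms] by blast
  obtain r where r: "r > 0" "cball (fst (F p0)) r \<times> cball (snd (F p0)) r \<subseteq> D"
    using cball_prod_subset[OF *(4,5)] .
  let ?B = "ball (fst (F p0)) r \<times> ball (snd (F p0)) r"
  have BD: "?B \<subseteq> D" using r by force
  have Bo: "open ?B" by (simp add: open_Times)
  define W where "W = U' \<inter> F -` ?B"
  have hom: "\<And>x. x \<in> U' \<Longrightarrow> G (F x) = x" "\<And>y. y \<in> D \<Longrightarrow> F (G y) = y" "\<And>y. y \<in> D \<Longrightarrow> G y \<in> U'" "continuous_on U' F"
    using *(6) by (auto simp: homeomorphism_def)
  have W: "open W" unfolding W_def using continuous_open_preimage[OF hom(4) *(1) Bo] by simp
  have img: "F ` W = ?B"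
  proof (intro equalityI subsetI)
    fix q assume q: "q \<in> ?B"
    then have "q \<in> D" using BD by blast
    with q have "G q \<in> W" "F (G q) = q" using hom(2,3)[OF \<open>q \<in> D\<close>] unfolding W_def by simp_all
    then show "q \<in> F ` W" by (metis imageI)
  qed (auto simp: W_def)
  have inj: "inj_on F W" unfolding W_def by (metis IntE hom(1) inj_onI)
  have e: "the_inv_into W F q = G q" if "q \<in> ?B" for q
  proof -
    have "q \<in> D" using that BD by blast
    then have "G q \<in> W" "F (G q) = q" using that hom(2,3)[OF \<open>q \<in> D\<close>] unfolding W_def by simp_all
    then show ?thesis using the_inv_into_f_f[OF inj] by metis
  qed
  have "smooth_map_on ?B G" using smooth_map_on_subset[OF *(7,4) Bo BD] .
  then have "smooth_map_on ?B (the_inv_into W F)"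
    unfolding smooth_map_on_def using smooth_on_cong[OF Bo] e by (auto simp del: mem_Sigma_iff)
  moreover have "p0 \<in> W" using *(3) r(1) by (simp add: W_def mem_Times_iff)
  moreover have "W \<subseteq> U" using *(2) by (auto simp: W_def)
  ultimately have "local_coordinates W F" "W \<subseteq> U"
    unfolding local_coordinates_def img using W inj Bo smooth_map_on_subset[OF F U(1) W] by auto
  with that r(1) img show ?thesis by blast
qed

text \<open>\<open>frobenius\<close> with the right hand sides (0, -c), (exp gamma, 0) and (0, 1)
  yields gamma, x and y. Then X = exp(gamma) d_x, and X gamma = 0 makes this factor depend on y
  only.\<close>

lemma adapted_coordinates:
  assumes U: "open U" "p0 \<in> U" and X: "smooth_map_on U X" and Z: "smooth_map_on U Z"
    and indep: "\<And>p. p \<in> U \<Longrightarrow> fst (X p) * snd (Z p) - snd (X p) * fst (Z p) \<noteq> 0"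
    and par: "\<And>p. p \<in> U \<Longrightarrow> \<exists>c. lie_bracket X Z p = pt_scale c (X p)"
    and comm: "\<And>p. p \<in> U \<Longrightarrow> lie_bracket X (lie_bracket X Z) p = 0"
  obtains W \<phi> a b r e where "W \<subseteq> U" "local_coordinates W \<phi>" "r > 0" "\<phi> ` W = ball a r \<times> ball b r"
    "\<And>q. q \<in> \<phi> ` W \<Longrightarrow> in_coordinates W \<phi> X q = (e (snd q), 0)" "\<And>y. y \<in> ball b r \<Longrightarrow> e y \<noteq> 0"
    "\<And>q. q \<in> \<phi> ` W \<Longrightarrow> in_coordinates W \<phi> Z q = (0, 1)"
proof -
  obtain s where s: "s > 0" "cball (fst p0) s \<times> cball (snd p0) s \<subseteq> U" using cball_prod_subset[OF U] .
  define A B where "A = ball (fst p0) s" and "B = ball (snd p0) s"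
  let ?U = "A \<times> B"
  have sub: "?U \<subseteq> U" using s ball_subset_cball unfolding A_def B_def by blast
  have AB: "open A" "convex A" "open B" "convex B" "snd p0 \<in> B" and p0: "p0 \<in> ?U"
    using s(1) by (auto simp: A_def B_def mem_Times_iff)
  have Uo: "open ?U" by (simp add: AB open_Times)
  have X': "smooth_map_on ?U X" and Z': "smooth_map_on ?U Z"
    using smooth_map_on_subset[OF _ U(1) Uo sub] X Z by auto
  have sX: "smooth_on ?U (\<lambda>q. fst (X q))" "smooth_on ?U (\<lambda>q. snd (X q))"
    and sZ: "smooth_on ?U (\<lambda>q. fst (Z q))" "smooth_on ?U (\<lambda>q. snd (Z q))"
    using X' Z' by (auto simp: smooth_map_on_def)
  define D where "D p = fst (X p) * snd (Z p) - snd (X p) * fst (Z p)" for p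
  have D: "D p \<noteq> 0" if "p \<in> ?U" for p using indep sub that unfolding D_def by blast
  define R where "R = lie_bracket X Z"
  have sR: "smooth_on ?U (\<lambda>q. fst (R q))" "smooth_on ?U (\<lambda>q. snd (R q))"
    unfolding R_def lie_bracket_def fst_conv snd_conv
    by (intro smooth_on_diff[OF Uo] smooth_on_vf_apply[OF Uo] X' Z' sX sZ)+
  \<comment> \<open>The factor in [X, Z] = c X, known so far only pointwise; Cramer's rule writes it
    as a quotient of smooth functions.\<close>
  define c where "c p = (fst (R p) * snd (Z p) - snd (R p) * fst (Z p)) / D p" for p
  have sc: "smooth_on ?U c"
    unfolding c_def D_def
    by (intro smooth_on_divide[OF Uo] smooth_on_diff[OF Uo] smooth_on_mult[OF Uo] sX sZ sR)
      (use D in \<open>auto simp: D_def\<close>)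
  have Rc: "R p = pt_scale (c p) (X p)" if p: "p \<in> ?U" for p
  proof -
    obtain k where k: "R p = pt_scale k (X p)" using par p sub unfolding R_def by blast
    have "c p = k * D p / D p" unfolding c_def k by (simp add: pt_scale_def D_def algebra_simps)
    then show ?thesis using D[OF p] k by simp
  qed
  have Xc: "vf_apply X c p = 0" if p: "p \<in> ?U" for p
  proof -
    note pd = smooth_on_has_pd[OF _ Uo p]
    have RX: "has_pd (\<lambda>q. fst (R q)) (pdx c p * fst (X p) + c p * pdx (\<lambda>q. fst (X q)) p) (pdy c p * fst (X p) + c p * pdy (\<lambda>q. fst (X q)) p) p"
      "has_pd (\<lambda>q. snd (R q)) (pdx c p * snd (X p) + c p * pdx (\<lambda>q. snd (X q)) p) (pdy c p * snd (X p) + c p * pdy (\<lambda>q. snd (X q)) p) p"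
      by (rule has_pd_cong[OF has_pd_mult[OF pd[OF sc] pd[OF sX(1)]] Uo p], simp add: Rc pt_scale_def)
         (rule has_pd_cong[OF has_pd_mult[OF pd[OF sc] pd[OF sX(2)]] Uo p], simp add: Rc pt_scale_def)
    \<comment> \<open>[X, c X] = (X c) X, so commutation forces X c = 0.\<close>
    have "lie_bracket X R p = pt_scale (vf_apply X c p) (X p)"
      unfolding lie_bracket_def vf_apply_def has_pdD[OF RX(1)] has_pdD[OF RX(2)] Rc[OF p]
      by (simp add: pt_scale_def algebra_simps)
    then have "pt_scale (vf_apply X c p) (X p) = 0" using comm p sub unfolding R_def by auto
    moreover have "X p \<noteq> 0" using D[OF p] by (auto simp: D_def)
    ultimately show ?thesis using C2.scale_eq_0_iff by blast
  qed
  have const_app: "vf_apply Y (\<lambda>_. k) p = 0" for Y k p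
    using has_pdD[OF has_pd_const[of k p]] by (simp add: vf_apply_def)
  note frob = frobenius[OF AB X' Z' _ _ indep[OF subsetD[OF sub]] Rc[unfolded R_def]]
  have "\<exists>\<gamma>. smooth_on ?U \<gamma> \<and> (\<forall>p\<in>?U. vf_apply X \<gamma> p = 0 \<and> vf_apply Z \<gamma> p = 0 - c p)"
  proof (rule frob)
    fix p assume p: "p \<in> ?U"
    have *: "vf_apply X (\<lambda>p. 0 - c p) p = - vf_apply X c p"
      using has_pdD[OF has_pd_diff[OF has_pd_const[of 0] smooth_on_has_pd[OF sc Uo p]]] by (simp add: vf_apply_def)
    show "vf_apply X (\<lambda>p. 0 - c p) p - vf_apply Z (\<lambda>_. 0) p = c p * 0"
      unfolding * Xc[OF p] const_app by simp
  qed (use smooth_on_const[OF Uo, of 0] smooth_on_diff[OF Uo smooth_on_const[OF Uo, of 0] sc] in simp_all)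
  then obtain \<gamma> where \<gamma>: "smooth_on ?U \<gamma>" "\<And>p. p \<in> ?U \<Longrightarrow> vf_apply X \<gamma> p = 0" "\<And>p. p \<in> ?U \<Longrightarrow> vf_apply Z \<gamma> p = - c p"
    by auto
  have exp_app: "vf_apply Y (\<lambda>p. exp (\<gamma> p)) p = exp (\<gamma> p) * vf_apply Y \<gamma> p" if "p \<in> ?U" for Y p
    unfolding vf_apply_def has_pdD[OF has_pd_comp1[OF smooth_on_has_pd[OF \<gamma>(1) Uo that] DERIV_exp]]
    by (simp add: algebra_simps)
  have "\<exists>x. smooth_on ?U x \<and> (\<forall>p\<in>?U. vf_apply X x p = exp (\<gamma> p) \<and> vf_apply Z x p = 0)"
  proof (rule frob)
    fix p assume p: "p \<in> ?U"
    show "vf_apply X (\<lambda>p. 0) p - vf_apply Z (\<lambda>p. exp (\<gamma> p)) p = c p * exp (\<gamma> p)"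
      by (simp add: const_app exp_app[OF p] \<gamma>(3)[OF p])
  qed (auto intro: smooth_on_const smooth_on_exp \<gamma>(1) Uo)
  then obtain x where x: "smooth_on ?U x" "\<And>p. p \<in> ?U \<Longrightarrow> vf_apply X x p = exp (\<gamma> p)" "\<And>p. p \<in> ?U \<Longrightarrow> vf_apply Z x p = 0"
    by auto
  have "\<exists>y. smooth_on ?U y \<and> (\<forall>p\<in>?U. vf_apply X y p = 0 \<and> vf_apply Z y p = 1)"
    by (rule frob) (auto intro: smooth_on_const Uo simp: const_app)
  then obtain y where y: "smooth_on ?U y" "\<And>p. p \<in> ?U \<Longrightarrow> vf_apply X y p = 0" "\<And>p. p \<in> ?U \<Longrightarrow> vf_apply Z y p = 1"
    by auto
  define \<phi> where "\<phi> = (\<lambda>p. (x p, y p))"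
  have s\<phi>: "smooth_map_on ?U \<phi>" using x(1) y(1) by (simp add: smooth_map_on_def \<phi>_def)
  have det: "pdx (\<lambda>q. fst (\<phi> q)) p * pdy (\<lambda>q. snd (\<phi> q)) p - pdy (\<lambda>q. fst (\<phi> q)) p * pdx (\<lambda>q. snd (\<phi> q)) p \<noteq> 0"
    if p: "p \<in> ?U" for p
  proof
    assume 0: "pdx (\<lambda>q. fst (\<phi> q)) p * pdy (\<lambda>q. snd (\<phi> q)) p - pdy (\<lambda>q. fst (\<phi> q)) p * pdx (\<lambda>q. snd (\<phi> q)) p = 0"
    \<comment> \<open>The Jacobian of (x, y) times D is the determinant of the values of X and Z on
      x and y, which is exp(gamma).\<close>
    have "vf_apply X x p * vf_apply Z y p - vf_apply Z x p * vf_apply X y p =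
      (pdx x p * pdy y p - pdy x p * pdx y p) * D p"
      by (simp add: vf_apply_def D_def algebra_simps)
    with 0 x y p show False by (simp add: \<phi>_def)
  qed
  obtain W a b r where Wb: "W \<subseteq> ?U" "local_coordinates W \<phi>" "r > 0" "\<phi> ` W = ball a r \<times> ball b r"
    by (rule local_coordinates_box[OF Uo p0 s\<phi> det])
  have Wo: "open W" using Wb(2) by (simp add: local_coordinates_def)
  interpret coords W \<phi> using Wb(2) by unfold_locales
  define e where "e q = exp (\<gamma> (\<psi> q))" for q
  have pX: "push X q = (e q, 0)" and pZ: "push Z q = (0, 1)" if q: "q \<in> \<phi> ` W" for q
  proof -
    obtain p where p: "p \<in> W" "q = \<phi> p" using q by blast
    then have "p \<in> ?U" using Wb(1) by blast
    then show "push X q = (e q, 0)" "push Z q = (0, 1)"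
      unfolding p(2) push_apply[OF p(1)] by (simp_all add: \<phi>_def x y e_def inv[OF p(1), unfolded \<phi>_def])
  qed
  have se: "smooth_on (\<phi> ` W) e"
    unfolding e_def
    by (rule smooth_on_comp[OF open_img Wo smooth_inv inv_mem(1) smooth_on_exp[OF Wo smooth_on_subset[OF \<gamma>(1) Uo Wo Wb(1)]]])
  have ex: "pdx e q = 0" if q: "q \<in> \<phi> ` W" for q
  proof -
    obtain p where p: "p \<in> W" "q = \<phi> p" using q by blast
    then have pU: "p \<in> ?U" using Wb(1) by blast
    have "vf_apply (push X) e q = vf_apply X (\<lambda>r. e (\<phi> r)) p"
      using vf_apply_push[OF p(1) smooth_on_has_pd[OF se open_img q, unfolded p(2)]] unfolding p(2) .
    also have "\<dots> = vf_apply X (\<lambda>p. exp (\<gamma> p)) p"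
      by (rule vf_apply_cong[OF Wo p(1)]) (simp_all add: e_def inv)
    also have "\<dots> = 0" by (simp add: exp_app[OF pU] \<gamma>(2)[OF pU])
    finally have "e q * pdx e q = 0" unfolding vf_apply_def pX[OF q] by simp
    then show ?thesis by (simp add: e_def)
  qed
  have ec: "e q = e (a, snd q)" if q: "q \<in> \<phi> ` W" for q
  proof -
    have m: "(t, snd q) \<in> \<phi> ` W" if "t \<in> ball a r" for t using q that unfolding Wb(4) by (simp add: mem_Times_iff)
    have "((\<lambda>t. e (t, snd q)) has_field_derivative 0) (at t within ball a r)" if t: "t \<in> ball a r" for t
      using has_pd_fst[OF smooth_on_has_pd[OF se open_img m[OF t]]] ex[OF m[OF t]]
      by (simp add: has_field_derivative_at_within)
    from has_field_derivative_zero_constant[OF convex_ball this]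
    obtain k where k: "\<And>t. t \<in> ball a r \<Longrightarrow> e (t, snd q) = k" by blast
    have "fst q \<in> ball a r" using q unfolding Wb(4) by (simp add: mem_Times_iff)
    then show ?thesis using k[of "fst q"] k[of a] Wb(3) by simp
  qed
  show ?thesis
  proof (rule that[OF subset_trans[OF Wb(1) sub] Wb(2,3,4)])
    show "push X q = ((\<lambda>t. e (a, t)) (snd q), 0)" if "q \<in> \<phi> ` W" for q
      using pX[OF that] ec[OF that] by simp
  qed (use pZ in \<open>auto simp: e_def\<close>)
qed

section \<open>Classification\<close>

lemma derived_subset:
  assumes "lie_algebra_on U g"
  shows "derived g \<subseteq> g"
  unfolding commutator_def using assms by (intro VF.span_minimal) (auto simp: lie_algebra_on_def)

lemma span_span_insert:
  "VF.span (VF.span (h \<union> {W}) \<union> {Z}) = VF.span (h \<union> {Z, W})"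
proof
  show "VF.span (h \<union> {Z, W}) \<subseteq> VF.span (VF.span (h \<union> {W}) \<union> {Z})"
    by (rule VF.span_minimal[OF _ VF.subspace_span]) (auto intro!: VF.span_base)
  have "VF.span (h \<union> {W}) \<union> {Z} \<subseteq> VF.span (h \<union> {Z, W})"
    using VF.span_mono[of "h \<union> {W}" "h \<union> {Z, W}"] VF.span_base[of Z "h \<union> {Z, W}"] by auto
  then show "VF.span (VF.span (h \<union> {W}) \<union> {Z}) \<subseteq> VF.span (h \<union> {Z, W})"
    by (rule VF.span_minimal[OF _ VF.subspace_span])
qed

lemma sum_V_cong: "(\<And>\<mu>. \<mu> \<in> S \<Longrightarrow> n \<mu> = m \<mu>) \<Longrightarrow> sum_V S n = sum_V S m"
  by (simp add: sum_V_def)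

text \<open>If 0 is a frequency, D lowers its degree bound by one, so h has the bound n 0 - 1 there
  (no summand if n 0 = 1), and the lost power of y is the extra generator of form 3.\<close>

lemma normal_form_d_y:
  assumes S: "finite S" "\<forall>\<mu>\<in>S. n \<mu> > 0"
  shows "\<exists>S' n'. finite S' \<and> (\<forall>\<mu>\<in>S'. n' \<mu> > 0) \<and> normal_form (sum_V S' n') (VF.span (sum_V S n \<union> {d_y}))"
proof (cases "0 \<in> S")
  case False
  then have "\<not> is_eigenvalue d_y (sum_V S n) 0"
    using is_eigenvalue_sum_V[OF S, of 0] by (simp add: d_y_aff)
  then show ?thesis using S unfolding normal_form_def by blast
next
  case True
  define S' where "S' = (if n 0 = 1 then S - {0} else S)"
  define n' where "n' = (\<lambda>\<mu>. if \<mu> = 0 then n 0 - 1 else n \<mu>)"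
  have S': "finite S'" "\<forall>\<mu>\<in>S'. n' \<mu> > 0" using S True by (auto simp: S'_def n'_def)
  have ins: "insert 0 S' = S" using True by (auto simp: S'_def)
  have ra: "raise S' n' 0 \<mu> = n \<mu>" if "\<mu> \<in> S" for \<mu>
    using that S(2) by (auto simp: raise_def mult_of_def S'_def n'_def)
  have "{fun_dx (exp_poly S P) | P. P \<in> deg_bounded S (raise S' n' 0)} = sum_V S (raise S' n' 0)"
    using S ra by (intro sum_V_eq[symmetric]) auto
  also have "\<dots> = sum_V S n" by (rule sum_V_cong) (rule ra)
  finally have "sum_V S n = VF.span (sum_V S' n' \<union> {fun_dx (\<lambda>y. y ^ mult_of S' n' 0)})"
    using sum_V_raise[OF S', of 0] by (simp add: ins)
  then have "VF.span (sum_V S n \<union> {d_y}) = VF.span (sum_V S' n' \<union> {d_y, fun_dx (\<lambda>y. y ^ mult_of S' n' 0)})"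
    by (simp only: span_span_insert)
  moreover have "mult_of S' n' 0 = eigenvalue_mult d_y (sum_V S' n') 0"
    using eigenvalue_mult_sum_V[OF S', of 0] by (simp add: d_y_aff)
  ultimately have "normal_form (sum_V S' n') (VF.span (sum_V S n \<union> {d_y}))"
    unfolding normal_form_def by (intro disjI2[OF disjI2[OF disjI1]] exI conjI) simp_all
  with S' show ?thesis by blast
qed

section \<open>The algebra in adapted coordinates\<close>

locale adapted = coords W \<phi> for W \<phi> +
  fixes U g X Z a b r e
  assumes U: "open U" and g: "lie_algebra_on U g" and WU: "W \<subseteq> U" and r: "r > 0"
    and img: "\<phi> ` W = ball a r \<times> ball b r"
    and X: "X \<in> derived g" and Z: "Z \<in> g" and fin: "finite_dim g" and ab: "abelian (derived g)"
    and pX: "\<And>q. q \<in> \<phi> ` W \<Longrightarrow> push X q = (e (snd q), 0)" and e_nz: "\<And>y. y \<in> ball b r \<Longrightarrow> e y \<noteq> 0"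
    and pZ: "\<And>q. q \<in> \<phi> ` W \<Longrightarrow> push Z q = (0, 1)"
    and par: "\<And>Y p. Y \<in> derived g \<Longrightarrow> p \<in> W \<Longrightarrow> \<exists>c. Y p = pt_scale c (X p)"
begin

abbreviation "A \<equiv> ball a r"
abbreviation "B \<equiv> ball b r"
abbreviation "Q \<equiv> A \<times> B"
abbreviation "gh \<equiv> push ` g"

lemma a: "a \<in> A" using r by simp

lemma Qo: "open Q" by (simp add: open_Times)

lemma smooth_W: "Y \<in> g \<Longrightarrow> smooth_map_on W Y"
  using g smooth_map_on_subset[OF _ U W WU] unfolding lie_algebra_on_def vector_field_on_def by blast

lemma smooth_Q: "Y \<in> g \<Longrightarrow> smooth_map_on Q (push Y)"
  using push_smooth[OF smooth_W] img by simp

lemma Xg: "X \<in> g" using X derived_subset[OF g] by blast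

lemma push_br: "Y \<in> g \<Longrightarrow> Y' \<in> g \<Longrightarrow> push (lie_bracket Y Y') = lie_bracket (push Y) (push Y')"
  by (intro push_bracket smooth_W)

lemma gh_subspace: "VF.subspace gh"
  by (rule linear_on_sub_image) (use g push_add push_scale in \<open>auto simp: lie_algebra_on_def linear_on_sub_def\<close>)

lemma gh_bracket: "Y \<in> gh \<Longrightarrow> Y' \<in> gh \<Longrightarrow> lie_bracket Y Y' \<in> gh"
proof -
  assume "Y \<in> gh" "Y' \<in> gh"
  then obtain y y' where y: "Y = push y" "Y' = push y'" "y \<in> g" "y' \<in> g" by blast
  then have "lie_bracket y y' \<in> g" using g unfolding lie_algebra_on_def by blast
  then show ?thesis unfolding y(1,2) push_br[OF y(3,4), symmetric] by (rule imageI)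
qed

lemma outside: "Y \<in> gh \<Longrightarrow> q \<notin> Q \<Longrightarrow> Y q = 0"
proof -
  assume "Y \<in> gh" "q \<notin> Q"
  then obtain y where "Y = push y" "q \<notin> \<phi> ` W" unfolding img by blast
  then show ?thesis by (simp add: push_outside)
qed

lemma const_in_x:
  assumes f: "smooth_on Q f" "\<And>q. q \<in> Q \<Longrightarrow> pdx f q = 0" and q: "q \<in> Q"
  shows "f q = f (a, snd q)"
proof -
  have "((\<lambda>t. f (t, snd q)) has_field_derivative 0) (at t within A)" if t: "t \<in> A" for t
  proof -
    have m: "(t, snd q) \<in> Q" using q t by (simp add: mem_Times_iff)
    from has_pd_fst[OF smooth_on_has_pd[OF f(1) Qo m]] f(2)[OF m]
    have "((\<lambda>t. f (t, snd q)) has_field_derivative 0) (at t)" by simp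
    then show ?thesis by (rule has_field_derivative_at_within)
  qed
  from has_field_derivative_zero_constant[OF convex_ball this]
  obtain k where k: "\<And>t. t \<in> A \<Longrightarrow> f (t, snd q) = k" by blast
  have "fst q \<in> A" using q by (simp add: mem_Times_iff)
  then show ?thesis using k[of "fst q"] k[OF a] by simp
qed

lemma const_in_y:
  assumes f: "smooth_on Q f" "\<And>q. q \<in> Q \<Longrightarrow> pdy f q = 0" and q: "y \<in> B"
  shows "f (a, y) = f (a, b)"
proof -
  have "((\<lambda>t. f (a, t)) has_field_derivative 0) (at t within B)" if t: "t \<in> B" for t
  proof -
    have m: "(a, t) \<in> Q" using a t by simp
    from has_pd_snd[OF smooth_on_has_pd[OF f(1) Qo m]] f(2)[OF m]
    have "((\<lambda>t. f (a, t)) has_field_derivative 0) (at t)" by simp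
    then show ?thesis by (rule has_field_derivative_at_within)
  qed
  from has_field_derivative_zero_constant[OF convex_ball this]
  obtain k where k: "\<And>t. t \<in> B \<Longrightarrow> f (a, t) = k" by blast
  show ?thesis using k[OF q] k[of b] r by simp
qed

lemma constant_on_box:
  assumes f: "smooth_on Q f" "\<And>q. q \<in> Q \<Longrightarrow> pdx f q = 0" "\<And>q. q \<in> Q \<Longrightarrow> pdy f q = 0" and q: "q \<in> Q"
  shows "f q = f (a, b)"
  using const_in_x[OF f(1,2) q] const_in_y[OF f(1,3), of "snd q"] q by (simp add: mem_Times_iff)

lemma slice_deriv:
  assumes f: "smooth_on Q f" and y: "y \<in> B"
  shows "((\<lambda>y. f (a, y)) has_field_derivative pdy f (a, y)) (at y)"
proof -
  have "(a, y) \<in> Q" using a y by simp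
  from has_pd_snd[OF smooth_on_has_pd[OF f Qo this]] show ?thesis by simp
qed

lemma slice_holomorphic:
  assumes f: "smooth_on Q f"
  shows "(\<lambda>y. f (a, y)) holomorphic_on B"
  unfolding holomorphic_on_open[OF open_ball] using slice_deriv[OF f] by blast

lemma e_deriv:
  assumes "y \<in> B"
  shows "(e has_field_derivative deriv e y) (at y)"
proof -
  have sX: "smooth_on Q (\<lambda>q. fst (push X q))" using smooth_Q[OF Xg] by (simp add: smooth_map_on_def)
  have "fst (push X (a, y)) = e y" if "y \<in> B" for y using pX[of "(a, y)"] that a img by simp
  from holomorphic_transform[OF slice_holomorphic[OF sX] this]
  have "e holomorphic_on B" by simp
  from holomorphic_derivI[OF this open_ball assms] show ?thesis .
qed

lemma bracket_Z:
  assumes Y: "smooth_map_on Q Y" and q: "q \<in> Q"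
  shows "lie_bracket (push Z) Y q = (pdy (\<lambda>q. fst (Y q)) q, pdy (\<lambda>q. snd (Y q)) q)"
proof -
  have "lie_bracket (push Z) Y q = lie_bracket (aff 0 (\<lambda>_. 0) 1) Y q"
    by (rule lie_bracket_cong[OF Qo q]) (simp_all add: pZ[unfolded img] aff_def)
  also have "\<dots> = (pdy (\<lambda>q. fst (Y q)) q, pdy (\<lambda>q. snd (Y q)) q)"
    unfolding lie_bracket_def vf_apply_def has_pdD[OF has_pd_aff(1)[OF DERIV_const]] has_pdD[OF has_pd_aff(2)[OF DERIV_const]]
    by (simp add: aff_def)
  finally show ?thesis .
qed

lemma bracket_X:
  assumes Y: "smooth_map_on Q Y" and q: "q \<in> Q"
  shows "lie_bracket (push X) Y q = (e (snd q) * pdx (\<lambda>q. fst (Y q)) q - snd (Y q) * deriv e (snd q), e (snd q) * pdx (\<lambda>q. snd (Y q)) q)"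
proof -
  have y: "snd q \<in> B" using q by (simp add: mem_Times_iff)
  have "lie_bracket (push X) Y q = lie_bracket (aff 0 e 0) Y q"
    by (rule lie_bracket_cong[OF Qo q]) (simp_all add: pX[unfolded img] aff_def)
  also have "\<dots> = (e (snd q) * pdx (\<lambda>q. fst (Y q)) q - snd (Y q) * deriv e (snd q), e (snd q) * pdx (\<lambda>q. snd (Y q)) q)"
    unfolding lie_bracket_def vf_apply_def has_pdD[OF has_pd_aff(1)[OF e_deriv[OF y]]] has_pdD[OF has_pd_aff(2)[OF e_deriv[OF y]]]
    by (simp add: aff_def)
  finally show ?thesis .
qed

lemma push_parallel: "q \<in> Q \<Longrightarrow> Y \<in> derived g \<Longrightarrow> snd (push Y q) = 0"
proof -
  assume "q \<in> Q" and Y: "Y \<in> derived g"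
  then obtain p where p: "p \<in> W" "q = \<phi> p" using img by blast
  obtain c where c: "Y p = pt_scale c (X p)" using par[OF Y p(1)] by blast
  have "vf_apply Y f p = c * vf_apply X f p" for f
    by (simp add: vf_apply_def c pt_scale_def algebra_simps)
  then have "snd (push Y q) = c * snd (push X q)" by (simp add: p(2) push_apply[OF p(1)])
  then show ?thesis using pX p by simp
qed

text \<open>Fields of the derived algebra are parallel to X, and commuting with e(y) d_x leaves a
  coefficient independent of x.\<close>

lemma derived_shape:
  assumes Y: "Y \<in> derived g" and q: "q \<in> Q"
  shows "push Y q = (fst (push Y (a, snd q)), 0)"
proof -
  have Yg: "Y \<in> g" using Y derived_subset[OF g] by blast
  have sY: "smooth_on Q (\<lambda>q. fst (push Y q))" using smooth_Q[OF Yg] by (simp add: smooth_map_on_def)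
  have "lie_bracket X Y = 0" using ab X Y unfolding abelian_def by blast
  moreover have "push 0 = 0" using push_scale[of 0 0] by (simp only: VF.scale_zero_left)
  ultimately have 0: "lie_bracket (push X) (push Y) = 0" using push_br[OF Xg Yg] by (simp only:)
  have "pdx (\<lambda>q. fst (push Y q)) q = 0" if q: "q \<in> Q" for q
  proof -
    have "e (snd q) * pdx (\<lambda>q. fst (push Y q)) q = 0"
      using bracket_X[OF smooth_Q[OF Yg] q] push_parallel[OF q Y] unfolding 0 by (simp add: zero_prod_def)
    then show ?thesis using e_nz[of "snd q"] q by (auto simp: mem_Times_iff)
  qed
  from const_in_x[OF sY this q] push_parallel[OF q Y] show ?thesis by (simp add: prod_eq_iff)
qed

lemma bracket_in_derived: "Y \<in> g \<Longrightarrow> Y' \<in> g \<Longrightarrow> lie_bracket Y Y' \<in> derived g"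
  unfolding commutator_def by (blast intro: VF.span_base)

text \<open>The brackets with Z and X lie in the derived algebra. Their vanishing d_y-components
  make the component l constant; their d_x-components give m_y = k(y) and m_x = (k' + beta e') /
  e.\<close>

lemma gh_shape:
  assumes "Y \<in> gh"
  obtains \<alpha> f \<beta> where "f holomorphic_on B" "Y = vf_restrict Q (aff \<alpha> f \<beta>)"
proof -
  obtain Y' where Y': "Y' \<in> g" "Y = push Y'" using assms by blast
  have sY: "smooth_map_on Q Y" using smooth_Q Y' by simp
  define m l where "m = (\<lambda>q. fst (Y q))" and "l = (\<lambda>q. snd (Y q))"
  have sm: "smooth_on Q m" "smooth_on Q l" using sY by (simp_all add: smooth_map_on_def m_def l_def)
  define k where "k y = fst (lie_bracket (push Z) Y (a, y))" for y
  define k' where "k' y = fst (lie_bracket (push X) Y (a, y))" for y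
  have BZ: "lie_bracket (push Z) Y q = (k (snd q), 0)" if "q \<in> Q" for q
    using derived_shape[OF bracket_in_derived[OF Z Y'(1)] that] by (simp add: k_def Y'(2) push_br Z Y'(1))
  have BX: "lie_bracket (push X) Y q = (k' (snd q), 0)" if "q \<in> Q" for q
    using derived_shape[OF bracket_in_derived[OF Xg Y'(1)] that] by (simp add: k'_def Y'(2) push_br Xg Y'(1))
  have my: "pdy m q = k (snd q)" and ly: "pdy l q = 0" if "q \<in> Q" for q
    using BZ[OF that] bracket_Z[OF sY that] by (simp_all add: m_def l_def)
  have eq: "e (snd q) \<noteq> 0" if "q \<in> Q" for q using that e_nz by (auto simp: mem_Times_iff)
  have lx: "pdx l q = 0" if "q \<in> Q" for q
    using BX[OF that] bracket_X[OF sY that] eq[OF that] by (simp add: l_def)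
  define \<beta> where "\<beta> = l (a, b)"
  have l: "l q = \<beta>" if "q \<in> Q" for q using constant_on_box[OF sm(2) lx ly that] by (simp add: \<beta>_def)
  have mx: "pdx m q = (k' (snd q) + \<beta> * deriv e (snd q)) / e (snd q)" if "q \<in> Q" for q
    using BX[OF that] bracket_X[OF sY that] eq[OF that] l[OF that] by (auto simp: m_def l_def field_simps)
  have smx: "smooth_on Q (pdx m)" by (rule smooth_on_pdx[OF sm(1) Qo])
  have depend_y: "pdx f q = 0" if "\<And>q. q \<in> Q \<Longrightarrow> f q = h (snd q)" "q \<in> Q" for f h q
    using pd_cong(1)[OF Qo that(2), of f "\<lambda>q. h (snd q)"] that(1) by (simp add: pdx_def)
  have mxx: "pdx (pdx m) q = 0" if "q \<in> Q" for q using depend_y[of "pdx m" "\<lambda>y. (k' y + \<beta> * deriv e y) / e y", OF mx that] .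
  \<comment> \<open>The order of differentiation is exchanged, because it is m_y that is known not
    to depend on x.\<close>
  have mxy: "pdy (pdx m) q = 0" if q: "q \<in> Q" for q
    using pdx_pdy_commute[OF Qo _ q, of m] sm(1) depend_y[of "pdy m" k, OF my q] by (simp add: smooth_on_iff_sep_holo Qo)
  define \<alpha> where "\<alpha> = pdx m (a, b)"
  have \<alpha>: "pdx m q = \<alpha>" if "q \<in> Q" for q using constant_on_box[OF smx mxx mxy that] by (simp add: \<alpha>_def)
  define f where "f y = m (a, y) - \<alpha> * a" for y
  have pdm: "has_pd (\<lambda>q. m q - \<alpha> * fst q) (pdx m q - (0 * fst q + \<alpha> * 1)) (pdy m q - (0 * fst q + \<alpha> * 0)) q" if "q \<in> Q" for q
    by (intro has_pd_diff has_pd_mult smooth_on_has_pd[OF sm(1) Qo that] has_pd_const has_pd_fst_proj)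
  have m: "m q = \<alpha> * fst q + f (snd q)" if q: "q \<in> Q" for q
  proof -
    have "smooth_on Q (\<lambda>q. m q - \<alpha> * fst q)" by (rule smooth_onI[OF Qo pdm])
    moreover have "pdx (\<lambda>q. m q - \<alpha> * fst q) q = 0" if "q \<in> Q" for q
      using has_pdD(1)[OF pdm[OF that]] \<alpha>[OF that] by simp
    ultimately have "m q - \<alpha> * fst q = m (a, snd q) - \<alpha> * fst (a, snd q)" by (rule const_in_x[OF _ _ q])
    then show ?thesis by (simp add: f_def algebra_simps)
  qed
  have "f holomorphic_on B"
    unfolding f_def by (intro holomorphic_intros slice_holomorphic sm)
  moreover have "Y = vf_restrict Q (aff \<alpha> f \<beta>)"
  proof
    fix q show "Y q = vf_restrict Q (aff \<alpha> f \<beta>) q"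
      using outside[OF assms, of q] m[of q] l[of q] by (simp add: vf_restrict_def aff_def m_def l_def prod_eq_iff)
  qed
  ultimately show ?thesis using that by blast
qed

lemma push_Z_eq: "push Z = vf_restrict Q d_y"
proof
  fix q show "push Z q = vf_restrict Q d_y q"
    using pZ[of q] push_outside[of q Z] by (simp add: vf_restrict_def d_y_aff aff_def img)
qed

lemma bracket_Z_aff:
  assumes "f holomorphic_on B"
  shows "lie_bracket (push Z) (vf_restrict Q (aff \<alpha> f \<beta>)) = dx_on Q (deriv f)"
proof
  fix q
  show "lie_bracket (push Z) (vf_restrict Q (aff \<alpha> f \<beta>)) q = dx_on Q (deriv f) q"
  proof (cases "q \<in> Q")
    case True
    then have y: "snd q \<in> B" by (simp add: mem_Times_iff)
    show ?thesis
      unfolding push_Z_eq lie_bracket_restrict[OF Qo] d_y_aff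
      using lie_bracket_aff[OF DERIV_const[of 0] holomorphic_derivI[OF assms open_ball y], of 0 1 \<alpha> \<beta>] True
      by (simp add: vf_restrict_def dx_on_apply)
  next
    case False
    then have "push Z q = 0" "vf_restrict Q (aff \<alpha> f \<beta>) q = 0" unfolding push_Z_eq by (simp_all add: vf_restrict_def)
    from lie_bracket_outside[where X = "push Z" and Y = "vf_restrict Q (aff \<alpha> f \<beta>)", OF this] False show ?thesis by (simp add: dx_on_apply)
  qed
qed

text \<open>The space F of the overview. It can be larger than the derived algebra, as form 3
  shows.\<close>

definition "K0 = {Y \<in> gh. \<exists>f. f holomorphic_on B \<and> Y = dx_on Q f}"

lemma K0_subspace: "VF.subspace K0"
proof (rule VF.subspaceI)
  show "0 \<in> K0" unfolding K0_def
    by (intro CollectI conjI exI[of _ "\<lambda>_. 0"] VF.subspace_0[OF gh_subspace] holomorphic_on_const dx_on_0[symmetric])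
next
  fix Y Y' assume "Y \<in> K0" "Y' \<in> K0"
  then obtain f f' where Y: "Y \<in> gh" "Y' \<in> gh" "f holomorphic_on B" "f' holomorphic_on B" "Y = dx_on Q f" "Y' = dx_on Q f'"
    unfolding K0_def by blast
  have "(\<lambda>y. f y + f' y) holomorphic_on B" by (intro holomorphic_intros Y)
  moreover have "Y + Y' = dx_on Q (\<lambda>y. f y + f' y)" unfolding Y(5,6) by (rule dx_on_add)
  ultimately show "Y + Y' \<in> K0"
    unfolding K0_def using VF.subspace_add[OF gh_subspace Y(1,2)] by blast
next
  fix c Y assume "Y \<in> K0"
  then obtain f where Y: "Y \<in> gh" "f holomorphic_on B" "Y = dx_on Q f"
    unfolding K0_def by blast
  have "(\<lambda>y. c * f y) holomorphic_on B" by (intro holomorphic_intros Y)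
  moreover have "vf_scale c Y = dx_on Q (\<lambda>y. c * f y)" unfolding Y(3) by (rule dx_on_scale)
  ultimately show "vf_scale c Y \<in> K0"
    unfolding K0_def using VF.subspace_scale[OF gh_subspace Y(1)] by blast
qed

text \<open>Bracketing with d_y removes both alpha x and beta d_y, so this holds for every field of
  the algebra, in particular for a dilation.\<close>

lemma deriv_K0:
  assumes "f holomorphic_on B" "vf_restrict Q (aff \<alpha> f \<beta>) \<in> gh"
  shows "dx_on Q (deriv f) \<in> K0"
proof -
  have "dx_on Q (deriv f) \<in> gh"
    using gh_bracket[OF imageI[OF Z] assms(2)] bracket_Z_aff[OF assms(1)] by simp
  then show ?thesis using holomorphic_deriv[OF assms(1) open_ball] unfolding K0_def by blast
qed

text \<open>Exponential polynomials are entire, so a space known on the box becomes the restriction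
  of a space of fields on C^2.\<close>

lemma K0_structure: "\<exists>S n. finite S \<and> (\<forall>\<mu>\<in>S. n \<mu> > 0) \<and> K0 = vf_restrict Q ` sum_V S n"
proof -
  obtain C where C: "finite C" "g = VF.span C" using fin unfolding finite_dim_def by blast
  have "gh = VF.span (push ` C)" unfolding C(2) by (rule vf_linear_span_image[OF push_add push_scale])
  then have sub: "K0 \<subseteq> VF.span (push ` C)" unfolding K0_def by blast
  have "\<exists>S n. finite S \<and> K0 = {dx_on Q (exp_poly S P) | P. P \<in> deg_bounded S n}"
  proof (rule deriv_invariant_structure[OF a open_ball convex_ball K0_subspace _ sub])
    show "\<exists>f. f holomorphic_on B \<and> Y = dx_on Q f" if "Y \<in> K0" for Y using that unfolding K0_def by blast
    show "dx_on Q (deriv f) \<in> K0" if "f holomorphic_on B" "dx_on Q f \<in> K0" for f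
      using that deriv_K0[of f 0 0] unfolding K0_def dx_on_def fun_dx_aff by blast
  qed (use C in simp)
  then obtain S n where S: "finite S" "K0 = {dx_on Q (exp_poly S P) | P. P \<in> deg_bounded S n}" by blast
  have "K0 = vf_restrict Q ` {fun_dx (exp_poly S P) | P. P \<in> deg_bounded S n}"
    unfolding S(2) dx_on_def by blast
  also have "\<dots> = vf_restrict Q ` sum_V {\<mu>\<in>S. n \<mu> > 0} n" by (simp only: deg_bounded_support[OF S(1)])
  finally show ?thesis using S(1) by (intro exI[of _ "{\<mu>\<in>S. n \<mu> > 0}"] exI[of _ n]) simp
qed

text \<open>h is a free parameter; for alpha \<noteq> 0 it is meant to be the function of a dilation
  (x + h(y)) d_x in the algebra.\<close>

lemma restrict_aff_decomp: "vf_restrict Q (aff \<alpha> f \<beta>) = dx_on Q (\<lambda>y. f y - \<alpha> * h y) + vf_scale \<alpha> (vf_restrict Q (aff 1 h 0)) + vf_scale \<beta> (push Z)"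
  by (auto simp: push_Z_eq dx_on_def vf_restrict_def fun_eq_iff aff_def fun_dx_aff d_y_aff vf_scale_def pt_scale_def zero_prod_def
    algebra_simps)

text \<open>Every field is f(y) d_x + beta d_y, so the algebra is \<open>K0\<close> plus d_y, and
  \<open>normal_form_d_y\<close> decides between forms 1 and 3.\<close>

lemma form_without_dilation:
  assumes no: "\<And>\<alpha> f \<beta>. f holomorphic_on B \<Longrightarrow> vf_restrict Q (aff \<alpha> f \<beta>) \<in> gh \<Longrightarrow> \<alpha> = 0"
  shows "\<exists>S n. finite S \<and> (\<forall>\<mu>\<in>S. n \<mu> > 0) \<and> has_form_in W \<phi> g (sum_V S n)"
proof -
  obtain S n where S: "finite S" "\<forall>\<mu>\<in>S. n \<mu> > 0" and K: "K0 = vf_restrict Q ` sum_V S n"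
    using K0_structure by blast
  have sub: "VF.subspace (sum_V S n)" using S by (rule sum_V_subspace)
  have "gh = vf_restrict Q ` VF.span (sum_V S n \<union> {d_y})"
    unfolding span_insert_subspace[OF sub]
  proof (intro equalityI subsetI)
    fix Y assume Y: "Y \<in> gh"
    obtain \<alpha> f \<beta> where f: "f holomorphic_on B" "Y = vf_restrict Q (aff \<alpha> f \<beta>)" using gh_shape[OF Y] .
    have "\<alpha> = 0" using no f Y by blast
    then have Yd: "Y = dx_on Q f + vf_scale \<beta> (push Z)"
      unfolding f(2) using restrict_aff_decomp[of 0 f \<beta> "\<lambda>_. 0"] by (simp only: VF.scale_zero_left add_0_right) simp
    then have "dx_on Q f = Y - vf_scale \<beta> (push Z)" by (simp only: add_diff_cancel_right')
    also have "\<dots> \<in> gh" using Y Z by (intro VF.subspace_diff VF.subspace_scale gh_subspace imageI)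
    finally have "dx_on Q f \<in> K0" using f(1) unfolding K0_def by blast
    then obtain Y1 where "Y1 \<in> sum_V S n" "dx_on Q f = vf_restrict Q Y1" unfolding K by blast
    then have "Y1 + vf_scale \<beta> d_y \<in> {Y + vf_scale c d_y | Y c. Y \<in> sum_V S n}"
      "Y = vf_restrict Q (Y1 + vf_scale \<beta> d_y)"
      unfolding Yd push_Z_eq by (blast, simp only: vf_restrict_add vf_restrict_scale)
    then show "Y \<in> vf_restrict Q ` {Y + vf_scale c d_y | Y c. Y \<in> sum_V S n}" by blast
  next
    fix Y assume "Y \<in> vf_restrict Q ` {Y + vf_scale c d_y | Y c. Y \<in> sum_V S n}"
    then obtain Y1 c where Y1: "Y = vf_restrict Q (Y1 + vf_scale c d_y)" "Y1 \<in> sum_V S n" by blast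
    have "vf_restrict Q Y1 \<in> gh" using Y1(2) K unfolding K0_def by blast
    then show "Y \<in> gh" unfolding Y1(1) vf_restrict_add vf_restrict_scale push_Z_eq[symmetric]
      using Z by (intro VF.subspace_add VF.subspace_scale gh_subspace imageI)
  qed
  then show ?thesis
    using normal_form_d_y[OF S] unfolding has_form_in_def img by blast
qed

text \<open>In the coordinate x + f0(y) the dilation becomes x d_x and d_y becomes d_y + f0' d_x,
  while fields f(y) d_x keep their shape. Since f0' d_x is one of those in \<open>K0\<close>, by
  \<open>deriv_K0\<close>, form 2 results with all of \<open>K0\<close> as h.\<close>

lemma form_with_dilation:
  assumes f0: "f0 holomorphic_on B" and A0: "vf_restrict Q (aff 1 f0 0) \<in> gh"
  shows "\<exists>\<phi>' S n. local_coordinates W \<phi>' \<and> finite S \<and> (\<forall>\<mu>\<in>S. n \<mu> > 0) \<and> has_form_in W \<phi>' g (sum_V S n)"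
proof -
  obtain S n where S: "finite S" "\<forall>\<mu>\<in>S. n \<mu> > 0" and K: "K0 = vf_restrict Q ` sum_V S n"
    using K0_structure by blast
  have sub: "VF.subspace (sum_V S n)" using S by (rule sum_V_subspace)
  have sv: "sum_V S n = {fun_dx (exp_poly S P) | P. P \<in> deg_bounded S n}"
    using S by (intro sum_V_eq) auto
  define \<tau> where "\<tau> q = (fst q - f0 (snd q), snd q)" for q :: C2
  define \<phi>' where "\<phi>' p = (fst (\<phi> p) + f0 (snd (\<phi> p)), snd (\<phi> p))" for p
  have \<tau>: "\<tau> (\<phi>' p) = \<phi> p" for p by (simp add: \<tau>_def \<phi>'_def)
  have inB: "snd (\<phi> p) \<in> B" if "p \<in> W" for p using that img by (metis imageI mem_Times_iff)
  \<comment> \<open>The image of the box under the shear, in general no longer a product.\<close>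
  define Q' where "Q' = (UNIV \<times> B) \<inter> \<tau> -` Q"
  have "continuous_on (UNIV \<times> B) \<tau>"
    unfolding \<tau>_def by (intro continuous_intros continuous_on_compose2[OF holomorphic_on_imp_continuous_on[OF f0]]) auto
  then have Q'o: "open Q'"
    unfolding Q'_def by (intro continuous_open_preimage Qo open_Times open_UNIV open_ball)
  have img': "\<phi>' ` W = Q'"
  proof (intro equalityI subsetI)
    fix q assume "q \<in> \<phi>' ` W"
    then obtain p where p: "p \<in> W" "q = \<phi>' p" by blast
    then have "\<tau> q \<in> Q" unfolding img[symmetric] by (simp add: \<tau>)
    moreover have "snd q \<in> B" using inB p by (simp add: \<phi>'_def)
    ultimately show "q \<in> Q'" unfolding Q'_def by (simp add: mem_Times_iff)
  next
    fix q assume "q \<in> Q'"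
    then have "\<tau> q \<in> \<phi> ` W" unfolding Q'_def img by blast
    then obtain p where p: "p \<in> W" "\<tau> q = \<phi> p" by blast
    then have "q = \<phi>' p" by (simp add: \<tau>_def \<phi>'_def prod_eq_iff) (metis diff_add_cancel prod.sel)
    with p show "q \<in> \<phi>' ` W" by blast
  qed
  have inj': "inj_on \<phi>' W"
    by (rule inj_onI) (metis \<tau> inj inj_onD)
  have s\<phi>: "smooth_on W (\<lambda>p. fst (\<phi> p))" "smooth_on W (\<lambda>p. snd (\<phi> p))"
    using smooth by (auto simp: smooth_map_on_def)
  have "smooth_on W (\<lambda>p. f0 (snd (\<phi> p)))"
    by (rule smooth_on_comp1[OF W s\<phi>(2), of f0 "deriv f0"], rule holomorphic_derivI[OF f0 open_ball], rule inB)
  then have s\<phi>': "smooth_map_on W \<phi>'"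
    unfolding smooth_map_on_def \<phi>'_def fst_conv snd_conv using s\<phi> smooth_on_add[OF W] by blast
  have pdf0: "has_pd (\<lambda>q. f0 (snd q)) (deriv f0 (snd q) * 0) (deriv f0 (snd q) * 1) q" if "snd q \<in> B" for q
    by (rule has_pd_comp1[OF has_pd_snd_proj holomorphic_derivI[OF f0 open_ball that]])
  have Q'B: "snd q \<in> B" if "q \<in> Q'" for q using that by (auto simp: Q'_def)
  have s\<tau>: "smooth_map_on Q' \<tau>"
    unfolding smooth_map_on_def \<tau>_def fst_conv snd_conv
  proof
    show "smooth_on Q' (\<lambda>q. fst q - f0 (snd q))"
      by (rule smooth_onI[OF Q'o], rule has_pd_diff[OF has_pd_fst_proj pdf0[OF Q'B]])
    show "smooth_on Q' snd" by (rule smooth_onI[OF Q'o], rule has_pd_snd_proj)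
  qed
  have \<tau>_in: "\<tau> q \<in> \<phi> ` W" if "q \<in> Q'" for q using that unfolding Q'_def img by blast
  have "smooth_on Q' (\<lambda>q. f (\<tau> q))" if "smooth_on (\<phi> ` W) f" for f
    by (rule smooth_on_comp[OF Q'o open_img s\<tau> \<tau>_in that])
  then have s\<psi>\<tau>: "smooth_map_on Q' (\<lambda>q. \<psi> (\<tau> q))"
    using smooth_inv unfolding smooth_map_on_def by blast
  have inv': "the_inv_into W \<phi>' q = \<psi> (\<tau> q)" if "q \<in> Q'" for q
  proof -
    obtain p where "p \<in> W" "q = \<phi>' p" using \<open>q \<in> Q'\<close> img' by blast
    then show ?thesis by (simp add: the_inv_into_f_f inj' \<tau> inv)
  qed
  have "smooth_map_on Q' (the_inv_into W \<phi>')"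
    unfolding smooth_map_on_def
  proof
    show "smooth_on Q' (\<lambda>q. fst (the_inv_into W \<phi>' q))"
      by (rule smooth_on_cong[OF Q'o conjunct1[OF s\<psi>\<tau>[unfolded smooth_map_on_def]]]) (simp add: inv')
    show "smooth_on Q' (\<lambda>q. snd (the_inv_into W \<phi>' q))"
      by (rule smooth_on_cong[OF Q'o conjunct2[OF s\<psi>\<tau>[unfolded smooth_map_on_def]]]) (simp add: inv')
  qed
  then have lc': "local_coordinates W \<phi>'"
    unfolding local_coordinates_def img' using W W_ne inj' Q'o s\<phi>' by blast
  interpret c': coords W \<phi>' using lc' by unfold_locales
  \<comment> \<open>The transformation rule of the shear. It constrains h only on B, because f0 is
    given only there while the target coefficients are entire.\<close>
  have key: "c'.push Y = vf_restrict Q' (aff \<alpha> h \<beta>)"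
    if Y: "push Y = vf_restrict Q (aff \<alpha> f \<beta>)" and h: "\<And>y. y \<in> B \<Longrightarrow> h y = f y - \<alpha> * f0 y + \<beta> * deriv f0 y" for Y \<alpha> \<beta> f h
  proof
    fix q
    show "c'.push Y q = vf_restrict Q' (aff \<alpha> h \<beta>) q"
    proof (cases "q \<in> Q'")
      case True
      then obtain p where p: "p \<in> W" "q = \<phi>' p" using img' by blast
      have pY: "push Y (\<phi> p) = (\<alpha> * fst (\<phi> p) + f (snd (\<phi> p)), \<beta>)"
        unfolding Y using p(1) img by (auto simp: vf_restrict_def aff_def)
      have "vf_apply Y (\<lambda>r. fst (\<phi> r) + f0 (snd (\<phi> r))) p = vf_apply (push Y) (\<lambda>q. fst q + f0 (snd q)) (\<phi> p)"
        by (rule vf_apply_push[OF p(1) has_pd_add[OF has_pd_fst_proj pdf0[OF inB[OF p(1)]]], symmetric])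
      also have "\<dots> = \<alpha> * fst (\<phi> p) + f (snd (\<phi> p)) + \<beta> * deriv f0 (snd (\<phi> p))"
        unfolding vf_apply_def has_pdD[OF has_pd_add[OF has_pd_fst_proj pdf0[OF inB[OF p(1)]]]] pY by simp
      finally have 1: "vf_apply Y (\<lambda>r. fst (\<phi> r) + f0 (snd (\<phi> r))) p =
        \<alpha> * fst (\<phi> p) + f (snd (\<phi> p)) + \<beta> * deriv f0 (snd (\<phi> p))" .
      have 2: "vf_apply Y (\<lambda>r. snd (\<phi> r)) p = \<beta>" using pY unfolding push_apply[OF p(1)] by simp
      show ?thesis
        using True 1 2 h[OF inB[OF p(1)]] unfolding p(2) c'.push_apply[OF p(1)]
        by (simp add: vf_restrict_def aff_def \<phi>'_def algebra_simps)
    next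
      case False
      then show ?thesis using c'.push_outside[of q Y] by (simp add: vf_restrict_def img')
    qed
  qed
  have f0': "dx_on Q (deriv f0) \<in> K0" by (rule deriv_K0[OF f0 A0])
  have K0g: "K0 \<subseteq> gh" unfolding K0_def by blast
  have "c'.push ` g = vf_restrict Q' ` VF.span (sum_V S n \<union> {d_y, x_dx})"
    unfolding span_insert2_subspace[OF sub]
  proof (intro equalityI subsetI)
    fix Y' assume "Y' \<in> c'.push ` g"
    then obtain Y where Y: "Y \<in> g" "Y' = c'.push Y" by blast
    obtain \<alpha> f \<beta> where f: "f holomorphic_on B" "push Y = vf_restrict Q (aff \<alpha> f \<beta>)" using gh_shape[OF imageI[OF Y(1)]] .
    \<comment> \<open>Removing alpha times the dilation and beta d_y leaves a field in
      \<open>K0\<close>; adding beta f0' then gives the coefficient in the new coordinates.\<close>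
    have "dx_on Q (\<lambda>y. f y - \<alpha> * f0 y) = push Y - vf_scale \<alpha> (vf_restrict Q (aff 1 f0 0)) - vf_scale \<beta> (push Z)"
      unfolding f(2) restrict_aff_decomp[of \<alpha> f \<beta> f0] by (simp only: algebra_simps)
    also have "\<dots> \<in> gh" using Y Z A0 by (intro VF.subspace_diff VF.subspace_scale gh_subspace imageI)
    finally have "dx_on Q (\<lambda>y. f y - \<alpha> * f0 y) \<in> gh" .
    moreover have "(\<lambda>y. f y - \<alpha> * f0 y) holomorphic_on B" by (intro holomorphic_intros f(1) f0)
    ultimately have "dx_on Q (\<lambda>y. f y - \<alpha> * f0 y) \<in> K0" unfolding K0_def by blast
    then have "dx_on Q (\<lambda>y. f y - \<alpha> * f0 y) + vf_scale \<beta> (dx_on Q (deriv f0)) \<in> K0"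
      by (intro VF.subspace_add VF.subspace_scale K0_subspace f0')
    then have "dx_on Q (\<lambda>y. f y - \<alpha> * f0 y + \<beta> * deriv f0 y) \<in> vf_restrict Q ` sum_V S n"
      unfolding K dx_on_scale dx_on_add .
    then obtain P where P: "P \<in> deg_bounded S n" "dx_on Q (\<lambda>y. f y - \<alpha> * f0 y + \<beta> * deriv f0 y) = dx_on Q (exp_poly S P)"
      unfolding sv dx_on_def by blast
    have "Y' = vf_restrict Q' (aff \<alpha> (exp_poly S P) \<beta>)"
      unfolding Y(2) by (rule key[OF f(2)]) (use P(2) in \<open>simp add: dx_on_eq_iff[OF a]\<close>)
    also have "aff \<alpha> (exp_poly S P) \<beta> = fun_dx (exp_poly S P) + vf_scale \<beta> d_y + vf_scale \<alpha> x_dx"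
      by (simp add: fun_dx_aff d_y_aff x_dx_aff aff_scale aff_add)
    finally show "Y' \<in> vf_restrict Q' ` {Y + vf_scale c d_y + vf_scale k x_dx | Y c k. Y \<in> sum_V S n}"
      using P(1) unfolding sv by blast
  next
    fix Y' assume "Y' \<in> vf_restrict Q' ` {Y + vf_scale c d_y + vf_scale k x_dx | Y c k. Y \<in> sum_V S n}"
    then obtain Y1 \<beta> \<alpha> where Y1: "Y' = vf_restrict Q' (Y1 + vf_scale \<beta> d_y + vf_scale \<alpha> x_dx)" "Y1 \<in> sum_V S n" by blast
    obtain P where P: "Y1 = fun_dx (exp_poly S P)" using Y1(2) unfolding sv by blast
    have "dx_on Q (exp_poly S P) \<in> K0" using Y1(2) unfolding K dx_on_def P by blast
    \<comment> \<open>The preimage of the given field: d_y in the new coordinates is d_y - f0' d_x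
      in the old ones.\<close>
    then have "dx_on Q (exp_poly S P) - vf_scale \<beta> (dx_on Q (deriv f0)) + vf_scale \<alpha> (vf_restrict Q (aff 1 f0 0)) + vf_scale \<beta> (push Z) \<in> gh"
      using K0g f0' Z A0 by (intro VF.subspace_add VF.subspace_diff VF.subspace_scale gh_subspace imageI) auto
    also have "dx_on Q (exp_poly S P) - vf_scale \<beta> (dx_on Q (deriv f0)) + vf_scale \<alpha> (vf_restrict Q (aff 1 f0 0)) + vf_scale \<beta> (push Z) =
      vf_restrict Q (aff \<alpha> (\<lambda>y. exp_poly S P y - \<beta> * deriv f0 y + \<alpha> * f0 y) \<beta>)"
      unfolding restrict_aff_decomp[of \<alpha> "\<lambda>y. exp_poly S P y - \<beta> * deriv f0 y + \<alpha> * f0 y" \<beta> f0] dx_on_scale dx_on_diff by simp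
    finally obtain Y where Y: "vf_restrict Q (aff \<alpha> (\<lambda>y. exp_poly S P y - \<beta> * deriv f0 y + \<alpha> * f0 y) \<beta>) = push Y" "Y \<in> g"
      by (rule imageE)
    have "Y' = vf_restrict Q' (aff \<alpha> (exp_poly S P) \<beta>)"
      unfolding Y1(1) P by (simp add: fun_dx_aff d_y_aff x_dx_aff aff_scale aff_add)
    also have "\<dots> = c'.push Y" by (rule key[OF Y(1)[symmetric], symmetric]) simp
    finally show "Y' \<in> c'.push ` g" using Y(2) by blast
  qed
  then have "has_form_in W \<phi>' g (sum_V S n)"
    unfolding has_form_in_def normal_form_def img' by blast
  with lc' S show ?thesis by blast
qed

lemma form_exists:
  "\<exists>\<phi>' S n. local_coordinates W \<phi>' \<and> finite S \<and> (\<forall>\<mu>\<in>S. n \<mu> > 0) \<and> has_form_in W \<phi>' g (sum_V S n)"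
proof (cases "\<exists>\<alpha> f \<beta>. f holomorphic_on B \<and> vf_restrict Q (aff \<alpha> f \<beta>) \<in> gh \<and> \<alpha> \<noteq> 0")
  case True
  then obtain \<alpha> f \<beta> where f: "f holomorphic_on B" "vf_restrict Q (aff \<alpha> f \<beta>) \<in> gh" "\<alpha> \<noteq> 0" by blast
  \<comment> \<open>Subtracting beta d_y and dividing by alpha produces a normalized
    dilation.\<close>
  have "vf_restrict Q (aff 1 (\<lambda>y. f y / \<alpha>) 0) = vf_scale (1 / \<alpha>) (vf_restrict Q (aff \<alpha> f \<beta>) - vf_scale \<beta> (push Z))"
    using f(3) by (auto simp: push_Z_eq vf_restrict_def fun_eq_iff aff_def d_y_aff vf_scale_def pt_scale_def zero_prod_def add_divide_distrib)
  also have "\<dots> \<in> gh" using f(2) Z by (intro VF.subspace_scale VF.subspace_diff gh_subspace imageI)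
  finally show ?thesis by (rule form_with_dilation[rotated]) (use f in \<open>intro holomorphic_intros; simp\<close>)
next
  case False
  then show ?thesis using form_without_dilation lc by blast
qed

end

section \<open>Choice of X and Z at a generic point\<close>

lemma rank_one_parallel:
  assumes T: "C2.dim T = 1" and x: "x \<in> T" "x \<noteq> 0" and y: "y \<in> T"
  shows "\<exists>c. y = pt_scale c x"
proof -
  obtain E where E: "E \<subseteq> T" "T \<subseteq> C2.span E" "card E = 1" using C2.basis_exists[of T] T by metis
  then obtain v where v: "E = {v}" by (auto simp: card_1_singleton_iff)
  obtain k l where kl: "x = pt_scale k v" "y = pt_scale l v"
    using E(2) x(1) y unfolding v C2.span_singleton by blast
  then have "k \<noteq> 0" using x(2) by (auto simp: pt_scale_def zero_prod_def)
  then have "y = pt_scale (l / k) x" unfolding kl by (simp add: pt_scale_def)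
  then show ?thesis by blast
qed

lemma zero_det_parallel:
  assumes "fst x * snd z - snd x * fst z = 0" "x \<noteq> 0"
  shows "\<exists>c. z = pt_scale c x"
proof (cases "fst x = 0")
  case True
  then have "snd x \<noteq> 0" using assms(2) by (auto simp: prod_eq_iff)
  then have "z = pt_scale (snd z / snd x) x" using assms(1) True by (simp add: pt_scale_def prod_eq_iff)
  then show ?thesis by blast
next
  case False
  then have "z = pt_scale (fst z / fst x) x" using assms(1) by (simp add: pt_scale_def prod_eq_iff field_simps)
  then show ?thesis by blast
qed

lemma normal_form_exists:
  assumes U: "open U" and g: "lie_algebra_on U g" and fin: "finite_dim g"
    and nn: "\<not> nilpotent g" and rk: "has_rank U g 2"
    and ab: "abelian (derived g)" and rk': "has_rank U (derived g) 1"
  shows "\<exists>W \<phi> S n. W \<subseteq> U \<and> local_coordinates W \<phi> \<and> finite S \<and> (\<forall>\<mu>\<in>S. n \<mu> > 0) \<and> has_form_in W \<phi> g (sum_V S n)"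
proof -
  have sm: "smooth_map_on U Y" if "Y \<in> g" for Y using g that unfolding lie_algebra_on_def vector_field_on_def by blast
  \<comment> \<open>On the empty set the algebra would be zero, hence nilpotent.\<close>
  have "U \<noteq> {}"
  proof
    assume "U = {}"
    then have "g \<subseteq> {0}" using g unfolding lie_algebra_on_def vector_field_on_def by (auto simp: fun_eq_iff)
    moreover have "0 \<in> g" using g VF.subspace_0 unfolding lie_algebra_on_def by blast
    ultimately have "lower_central_series g 0 = {0}" by auto
    with nn show False unfolding nilpotent_def by blast
  qed
  obtain D2 where D2: "open D2" "D2 \<subseteq> U" "U \<subseteq> closure D2" "\<forall>p\<in>D2. C2.dim ((\<lambda>X. X p) ` g) = 2"
    using rk unfolding has_rank_def by blast
  obtain D1 where D1: "open D1" "D1 \<subseteq> U" "U \<subseteq> closure D1" "\<forall>p\<in>D1. C2.dim ((\<lambda>X. X p) ` derived g) = 1"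
    using rk' unfolding has_rank_def by blast
  \<comment> \<open>Both ranks are to be generic at one common point; two open dense subsets of U
    meet.\<close>
  have "D2 \<noteq> {}" using D2(3) \<open>U \<noteq> {}\<close> by auto
  then have "D2 \<inter> D1 \<noteq> {}"
    using open_Int_closure_eq_empty[OF D2(1), of D1] D1(3) D2(2) by blast
  then obtain p0 where p0: "p0 \<in> D2" "p0 \<in> D1" by blast
  have "\<exists>X\<in>derived g. X p0 \<noteq> 0"
  proof (rule ccontr)
    assume "\<not> (\<exists>X\<in>derived g. X p0 \<noteq> 0)"
    then have "(\<lambda>X. X p0) ` derived g \<subseteq> C2.span {}" by auto
    from C2.dim_le_card[OF this] show False using D1(4) p0(2) by simp
  qed
  then obtain X where X: "X \<in> derived g" "X p0 \<noteq> 0" by blast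
  have Xg: "X \<in> g" using X derived_subset[OF g] by blast
  have "\<exists>Z\<in>g. Z p0 \<notin> C2.span {X p0}"
  proof (rule ccontr)
    assume "\<not> (\<exists>Z\<in>g. Z p0 \<notin> C2.span {X p0})"
    then have "(\<lambda>X. X p0) ` g \<subseteq> C2.span {X p0}" by auto
    from C2.dim_le_card[OF this] show False using D2(4) p0(1) by simp
  qed
  then obtain Z where Z: "Z \<in> g" "Z p0 \<notin> C2.span {X p0}" by blast
  define d where "d p = fst (X p) * snd (Z p) - snd (X p) * fst (Z p)" for p
  have d0: "d p0 \<noteq> 0"
    using zero_det_parallel[of "X p0" "Z p0"] X(2) Z(2) unfolding d_def C2.span_singleton by blast
  have sX: "smooth_on U (\<lambda>q. fst (X q))" "smooth_on U (\<lambda>q. snd (X q))"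
    and sZ: "smooth_on U (\<lambda>q. fst (Z q))" "smooth_on U (\<lambda>q. snd (Z q))"
    using sm[OF Xg] sm[OF Z(1)] by (auto simp: smooth_map_on_def)
  have "smooth_on U d" unfolding d_def by (intro smooth_on_diff smooth_on_mult U sX sZ)
  then have "continuous_on D1 d" using D1(2) smooth_on_continuous continuous_on_subset by blast
  then have "open (D1 \<inter> d -` (- {0}))" by (intro continuous_open_preimage D1(1)) auto
  \<comment> \<open>Staying in \<open>D1\<close> keeps the derived algebra of rank 1, so its fields
    are pointwise multiples of X; d \<noteq> 0 keeps X and Z independent.\<close>
  moreover define U0 where "U0 = D1 \<inter> d -` (- {0})"
  ultimately have U0: "open U0" "p0 \<in> U0" "U0 \<subseteq> U" using p0(2) d0 D1(2) by auto
  have par: "\<exists>c. Y p = pt_scale c (X p)" if "Y \<in> derived g" "p \<in> U0" for Y p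
  proof (rule rank_one_parallel)
    show "C2.dim ((\<lambda>X. X p) ` derived g) = 1" using D1(4) that(2) by (auto simp: U0_def)
    show "X p \<noteq> 0" using that(2) by (auto simp: U0_def d_def)
  qed (use X that in auto)
  have br: "lie_bracket X Z \<in> derived g"
    unfolding commutator_def using Xg Z(1) by (blast intro: VF.span_base)
  have comm: "lie_bracket X (lie_bracket X Z) p = 0" for p
    using ab X(1) br unfolding abelian_def by (metis zero_fun_apply)
  obtain W \<phi> a b r e where W: "W \<subseteq> U0" "local_coordinates W \<phi>" "r > 0" "\<phi> ` W = ball a r \<times> ball b r"
    "\<And>q. q \<in> \<phi> ` W \<Longrightarrow> in_coordinates W \<phi> X q = (e (snd q), 0)" "\<And>y. y \<in> ball b r \<Longrightarrow> e y \<noteq> 0"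
    "\<And>q. q \<in> \<phi> ` W \<Longrightarrow> in_coordinates W \<phi> Z q = (0, 1)"
  proof (rule adapted_coordinates[OF U0(1,2)])
    show "smooth_map_on U0 X" "smooth_map_on U0 Z"
      using smooth_map_on_subset[OF sm U U0(1,3)] Xg Z(1) by auto
    show "fst (X p) * snd (Z p) - snd (X p) * fst (Z p) \<noteq> 0" if "p \<in> U0" for p
      using that by (auto simp: U0_def d_def)
    show "\<exists>c. lie_bracket X Z p = pt_scale c (X p)" if "p \<in> U0" for p by (rule par[OF br that])
  next
    fix W \<phi> a b r e
    assume *: "W \<subseteq> U0" "local_coordinates W \<phi>" "r > 0" "\<phi> ` W = ball a r \<times> ball b r"
      "\<And>q. q \<in> \<phi> ` W \<Longrightarrow> in_coordinates W \<phi> X q = (e (snd q), 0)" "\<And>y. y \<in> ball b r \<Longrightarrow> e y \<noteq> 0"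
      "\<And>q. q \<in> \<phi> ` W \<Longrightarrow> in_coordinates W \<phi> Z q = (0, 1)"
    show thesis by (rule that[OF *])
  qed (rule comm)
  interpret adapted W \<phi> U g X Z a b r e
    using W U g U0(3) X Z fin ab par by unfold_locales auto
  show ?thesis using form_exists WU by blast
qed

theorem corollary6p5:
  fixes U :: "C2 set" and g :: "vfield set"
  assumes "open U"
    and "lie_algebra_on U g"
    and "finite_dim g"
    and "solvable g"
    and "\<not> nilpotent g"
    and "has_rank U g 2"
    and "abelian (derived g)"
    and "has_rank U (derived g) 1"
  shows "(\<exists>W \<phi> S n. W \<subseteq> U \<and> local_coordinates W \<phi> \<and>
            finite S \<and> (\<forall>\<mu>\<in>S. n \<mu> > 0) \<and> has_form_in W \<phi> g (sum_V S n)) \<and>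
         (\<forall>W \<phi> S n. W \<subseteq> U \<and> local_coordinates W \<phi> \<and>
            finite S \<and> (\<forall>\<mu>\<in>S. n \<mu> > 0) \<and> has_form_in W \<phi> g (sum_V S n) \<longrightarrow>
            in_coordinates W \<phi> ` derived g = vf_restrict (\<phi> ` W) ` sum_V S n)"
proof
  show "\<exists>W \<phi> S n. W \<subseteq> U \<and> local_coordinates W \<phi> \<and>
            finite S \<and> (\<forall>\<mu>\<in>S. n \<mu> > 0) \<and> has_form_in W \<phi> g (sum_V S n)"
    by (rule normal_form_exists[OF assms(1-3,5-8)])
  show "\<forall>W \<phi> S n. W \<subseteq> U \<and> local_coordinates W \<phi> \<and>
            finite S \<and> (\<forall>\<mu>\<in>S. n \<mu> > 0) \<and> has_form_in W \<phi> g (sum_V S n) \<longrightarrow>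
            in_coordinates W \<phi> ` derived g = vf_restrict (\<phi> ` W) ` sum_V S n"
    by (intro allI impI, elim conjE, rule derived_eq_sum_V[OF assms(1,2)])
qed

end
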